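(* Let $L>2m>0$ and let $$\mathfrak{g} = -V\,dt^{2}+2W\,d\varphi\, dt+\eta\, d\varphi^{2}+\frac{e^{2\gamma}}{\eta}(d\rho^{2}+dz^{2})$$ be the metric of a ($3+1$, vacuum) periodic stationary and axisymmetric black hole with period $L$, horizon length parameter $m$ (see context), and non-zero angular momentum $J\neq 0$. Assume also that the 2-metric $q=e^{2\gamma}(dz^{2}+d\rho^{2})$ is metrically complete at infinity. Then $$\frac{L}{m}\geq 4 .$$
   Context: Periodic stationary and axisymmetric black hole with period $L$ and horizon length parameter $m$ (where $L/2>m>0$): a solution of the vacuum Einstein equations ${\rm Ric}(\mathfrak{g})=0$ given in Weyl-Papapetrou coordinates $(t,\varphi,z,\rho)$, $t\in\mathbb{R}$, $\varphi\in\mathbb{R}/2\pi\mathbb{Z}$, $\rho>0$, $z\in\mathbb{R}$, by $$\mathfrak{g} = -V\,dt^{2}+2W\,d\varphi\, dt+\eta\, d\varphi^{2}+\frac{e^{2\gamma}}{\eta}(d\rho^{2}+dz^{2}),$$ where $V,W,\eta,\gamma$ are smooth functions of $(z,\rho)$ that are $L$-periodic in $z$, $\eta>0$, and $V\eta+W^{2}=\rho^{2}$. Because of periodicity, $z$ is regarded as an element of $\mathbb{R}/L\mathbb{Z}$, represented by $-L/2\le z\le L/2$ with endpoints identified; put $S=(\mathbb{R}/L\mathbb{Z})_z\times\mathbb{R}^+_\rho$. The boundary $\{\rho=0\}$ consists of the horizon $\{-m\le z\le m\}$ (a single horizon, of coordinate length $2m$) and the axis $\{m<|z|\le L/2\}$.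 The spacetime is required to be regular there: the metric extends smoothly across the axis, which is the fixed point set of the rotational Killing field $\partial_\varphi$ (no conical singularities, "no struts"), and extends smoothly to a non-degenerate Killing horizon with spherical cross-sections corresponding to $\{\rho=0,\ |z|\le m\}$, whose two poles are at $z=\pm m$. In particular $\eta$ has the usual black hole boundary behaviour as $\rho\to0$: with $$\omega_{S}(z,\rho)=\ln\left(\frac{\sqrt{(z-m)^{2}+\rho^{2}}+\sqrt{(z+m)^{2}+\rho^{2}}-2m}{\sqrt{(z-m)^{2}+\rho^{2}}+\sqrt{(z+m)^{2}+\rho^{2}}+2m}\right)$$ for $|z|\le L/2$, the function $\ln\eta-2\ln\rho+\omega_S$ is bounded near $\rho=0$ and extends continuously to $\{\rho=0\}$; $\rho\,\partial_\rho\ln\eta\to 2$ at points of the axis and $\rho\,\partial_\rho\ln\eta\to0$ at points of the horizon with $|z|<m$. The spatial hypersurfaces $\{t={\rm const}\}$, with spatial metric $\eta\,d\varphi^2+\frac{e^{2\gamma}}{\eta}(d\rho^2+dz^2)$, are always assumed to be metrically complete at infinity. No other assumption is made on the asymptotic behaviour as $\rho\to\infty$. Complete at infinity: $q$ (respectively, the spatial metric) is metrically complete at infinity if for $\rho_0>0$ the region $\{\rho\ge\rho_0\}$ with the induced Riemannian distance is a complete metric space (equivalently, every curve along which $\rho\to\infty$ has infinite length). Angular momentum: $J$ is the Komar angular momentum of the rotational Killing field $\xi=\partial_\varphi$, $J=\frac{1}{16\pi}\int_{\Sigma}\star d\xi^{\flat}$, where $\Sigma$ is the horizon cross-section or, equivalently,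 any 2-torus $\{t={\rm const},\ \rho={\rm const}\}$ in the quotient by $z\mapsto z+L$ (the overall sign is immaterial here). *)

theory Defs
  imports "HOL-Analysis.Analysis"
begin

lemma vector_4 [simp]:
  "(vector [a, b, c, d] :: 'a::zero ^ 4) $ 1 = a"
  "(vector [a, b, c, d] :: 'a ^ 4) $ 2 = b"
  "(vector [a, b, c, d] :: 'a ^ 4) $ 3 = c"
  "(vector [a, b, c, d] :: 'a ^ 4) $ 4 = d"
  by (simp_all add: vector_def)

primrec Ck_on :: "nat \<Rightarrow> 'a::real_normed_vector set \<Rightarrow> ('a \<Rightarrow> 'b::real_normed_vector) \<Rightarrow> bool" where
  "Ck_on 0 = (\<lambda>U f. continuous_on U f)"
| "Ck_on (Suc k) = (\<lambda>U f. (\<forall>x\<in>U. f differentiable (at x)) \<and>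
     (\<forall>v. Ck_on k U (\<lambda>x. frechet_derivative f (at x) v)))"

text \<open>Only used for open sets \<open>U\<close>.\<close>

definition smooth_on :: "'a::real_normed_vector set \<Rightarrow> ('a \<Rightarrow> 'b::real_normed_vector) \<Rightarrow> bool" where
  "smooth_on U f \<longleftrightarrow> (\<forall>k. Ck_on k U f)"

definition pd :: "'n::finite \<Rightarrow> (real ^ 'n \<Rightarrow> real) \<Rightarrow> real ^ 'n \<Rightarrow> real" where
  "pd i f x = frechet_derivative f (at x) (axis i 1)"

text \<open>A (pseudo-)Riemannian metric on a coordinate domain is given by its Gram matrix
  \<open>g x $ i $ j\<close>; \<open>christoffel g k i j\<close> is \<open>\<Gamma>\<^sup>k\<^sub>i\<^sub>j\<close>.\<close>

definition christoffel ::
  "(real ^ 'n \<Rightarrow> real ^ 'n ^ 'n) \<Rightarrow> 'n::finite \<Rightarrow> 'n \<Rightarrow> 'n \<Rightarrow> real ^ 'n \<Rightarrow> real" where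
  "christoffel g k i j x =
     (\<Sum>l\<in>UNIV. matrix_inv (g x) $ k $ l *
        (pd i (\<lambda>y. g y $ j $ l) x + pd j (\<lambda>y. g y $ i $ l) x - pd l (\<lambda>y. g y $ i $ j) x)) / 2"

definition ricci :: "(real ^ 'n \<Rightarrow> real ^ 'n ^ 'n) \<Rightarrow> 'n::finite \<Rightarrow> 'n \<Rightarrow> real ^ 'n \<Rightarrow> real" where
  "ricci g i j x =
     (\<Sum>k\<in>UNIV. pd k (christoffel g k i j) x - pd j (christoffel g k i k) x
        + (\<Sum>l\<in>UNIV. christoffel g k k l x * christoffel g l i j x
             - christoffel g k j l x * christoffel g l i k x))"

definition pullback ::
  "(real ^ 'm \<Rightarrow> real ^ 'm ^ 'm) \<Rightarrow> (real ^ 'n \<Rightarrow> real ^ 'm) \<Rightarrow> real ^ 'n \<Rightarrow> real ^ 'n ^ 'n" where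
  "pullback h \<Phi> x = (let J = matrix (frechet_derivative \<Phi> (at x)) in transpose J ** h (\<Phi> x) ** J)"


text \<open>The functions \<open>V, W, \<eta>, \<gamma>\<close> take the pair \<open>(z, \<rho>)\<close>. The coordinates \<open>1, 2, 3, 4\<close> of
  the spacetime are \<open>t, \<phi>, z, \<rho>\<close>; those of the spatial slices are \<open>\<phi>, z, \<rho>\<close>, and those of
  \<open>q\<close> are \<open>z, \<rho>\<close>. The angle \<open>\<phi>\<close> and (where it is periodic) \<open>z\<close> are lifted to the reals.\<close>

definition spacetime_metric ::
  "(real \<times> real \<Rightarrow> real) \<Rightarrow> (real \<times> real \<Rightarrow> real) \<Rightarrow> (real \<times> real \<Rightarrow> real) \<Rightarrow> (real \<times> real \<Rightarrow> real)
     \<Rightarrow> real ^ 4 \<Rightarrow> real ^ 4 ^ 4" where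
  "spacetime_metric V W \<eta> \<gamma> x = (let p = (x $ 3, x $ 4) in
     vector [vector [- V p, W p, 0, 0],
             vector [W p, \<eta> p, 0, 0],
             vector [0, 0, exp (2 * \<gamma> p) / \<eta> p, 0],
             vector [0, 0, 0, exp (2 * \<gamma> p) / \<eta> p]])"

definition spatial_metric ::
  "(real \<times> real \<Rightarrow> real) \<Rightarrow> (real \<times> real \<Rightarrow> real) \<Rightarrow> real ^ 3 \<Rightarrow> real ^ 3 ^ 3" where
  "spatial_metric \<eta> \<gamma> x = (let p = (x $ 2, x $ 3) in
     vector [vector [\<eta> p, 0, 0],
             vector [0, exp (2 * \<gamma> p) / \<eta> p, 0],
             vector [0, 0, exp (2 * \<gamma> p) / \<eta> p]])"

definition q_metric :: "(real \<times> real \<Rightarrow> real) \<Rightarrow> real ^ 2 \<Rightarrow> real ^ 2 ^ 2" where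
  "q_metric \<gamma> x = (let p = (x $ 1, x $ 2) in
     vector [vector [exp (2 * \<gamma> p), 0],
             vector [0, exp (2 * \<gamma> p)]])"


text \<open>Distance induced by a Riemannian metric \<open>G\<close> on the quotient of the region \<open>R\<close> by the
  translations in \<open>\<Lambda>\<close>. Points of the quotient are represented by lifts, so this is a
  pseudo-distance on \<open>R\<close>. The condition \<open>has_integral\<close> excludes paths of infinite length.\<close>

definition induced_dist ::
  "(real ^ 'n \<Rightarrow> real ^ 'n ^ 'n) \<Rightarrow> (real ^ 'n) set \<Rightarrow> (real ^ 'n) set \<Rightarrow> real ^ 'n \<Rightarrow> real ^ 'n \<Rightarrow> real" where
  "induced_dist G \<Lambda> R p q = Inf {l. \<exists>c. valid_path c \<and> path_image c \<subseteq> R \<and>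
     pathstart c = p \<and> pathfinish c - q \<in> \<Lambda> \<and>
     ((\<lambda>s. let c' = vector_derivative c (at s) in sqrt (c' \<bullet> (G (c s) *v c'))) has_integral l) {0..1}}"

definition complete_quotient ::
  "(real ^ 'n \<Rightarrow> real ^ 'n ^ 'n) \<Rightarrow> (real ^ 'n) set \<Rightarrow> (real ^ 'n) set \<Rightarrow> bool" where
  "complete_quotient G \<Lambda> R \<longleftrightarrow>
     (\<forall>\<sigma>::nat \<Rightarrow> real ^ 'n.
        range \<sigma> \<subseteq> R \<longrightarrow>
        (\<forall>e>0. \<exists>N. \<forall>i\<ge>N. \<forall>j\<ge>N. induced_dist G \<Lambda> R (\<sigma> i) (\<sigma> j) < e) \<longrightarrow>
        (\<exists>p\<in>R. (\<lambda>i. induced_dist G \<Lambda> R (\<sigma> i) p) \<longlonglongrightarrow> 0))"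

definition q_complete_at_infinity :: "real \<Rightarrow> (real \<times> real \<Rightarrow> real) \<Rightarrow> bool" where
  "q_complete_at_infinity L \<gamma> \<longleftrightarrow>
     (\<forall>\<rho>0>0. complete_quotient (q_metric \<gamma>)
        {vector [of_int k * L, 0] | k. True} {x. x $ 2 \<ge> \<rho>0})"

definition spatially_complete_at_infinity ::
  "real \<Rightarrow> (real \<times> real \<Rightarrow> real) \<Rightarrow> (real \<times> real \<Rightarrow> real) \<Rightarrow> bool" where
  "spatially_complete_at_infinity L \<eta> \<gamma> \<longleftrightarrow>
     (\<forall>\<rho>0>0. complete_quotient (spatial_metric \<eta> \<gamma>)
        {vector [of_int j * (2 * pi), of_int k * L, 0] | j k. True} {x. x $ 3 \<ge> \<rho>0})"


text \<open>Smooth extension across the axis. The interval \<open>m < z < L - m\<close> is a lift of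
  \<open>m < \<bar>z\<bar> \<le> L / 2\<close> in which the endpoints \<open>\<plusminus>L / 2\<close> are identified. Extending the metric in the Cartesian
  coordinates \<open>(t, \<rho> cos \<phi>, \<rho> sin \<phi>, z)\<close> excludes conical singularities, as \<open>\<phi>\<close> has period
  \<open>2\<pi>\<close>.\<close>

definition cartesian_coords :: "real ^ 4 \<Rightarrow> real ^ 4" where
  "cartesian_coords x = vector [x $ 1, x $ 4 * cos (x $ 2), x $ 4 * sin (x $ 2), x $ 3]"

definition axis_regular :: "real \<Rightarrow> real \<Rightarrow> (real ^ 4 \<Rightarrow> real ^ 4 ^ 4) \<Rightarrow> bool" where
  "axis_regular L m g \<longleftrightarrow>
     (\<exists>U h. open U \<and> {vector [t, 0, 0, z] | t z. m < z \<and> z < L - m} \<subseteq> U \<and>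
        smooth_on U h \<and> (\<forall>p\<in>U. transpose (h p) = h p \<and> det (h p) \<noteq> 0) \<and>
        (\<forall>x. x $ 4 > 0 \<and> cartesian_coords x \<in> U \<longrightarrow> pullback h cartesian_coords x = g x))"


text \<open>Smooth extension to a non-degenerate Killing horizon with spherical cross-sections.
  The extension is a metric on \<open>\<real> \<times> shell\<close>, where \<open>shell\<close> is a neighbourhood of the unit sphere
  of \<open>\<real>\<^sup>3\<close>; a point \<open>p\<close> has first coordinate \<open>v = p $ 1\<close> and shell component \<open>shell_part p\<close>.
  The horizon is \<open>\<real> \<times> S\<^sup>2\<close> and its Killing field is \<open>K = \<partial>\<^sub>v\<close>.\<close>

definition shell_part :: "real ^ 4 \<Rightarrow> real ^ 3" where
  "shell_part p = vector [p $ 2, p $ 3, p $ 4]"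

definition nondegenerate_Killing_horizon :: "real \<Rightarrow> real \<Rightarrow> (real ^ 4 \<Rightarrow> real ^ 4 ^ 4) \<Rightarrow> bool" where
  "nondegenerate_Killing_horizon \<epsilon> \<kappa> h \<longleftrightarrow>
     (let D = {p. 1 - \<epsilon> < norm (shell_part p) \<and> norm (shell_part p) < 1 + \<epsilon>};
          H = {p. norm (shell_part p) = 1};
          K = axis 1 1
      in smooth_on D h \<and> (\<forall>p\<in>D. transpose (h p) = h p \<and> det (h p) \<noteq> 0) \<and>
         \<comment> \<open>\<open>K\<close> is a Killing field\<close>
         (\<forall>p\<in>D. \<forall>s. h (p + s *\<^sub>R K) = h p) \<and>
         \<comment> \<open>\<open>K\<close> is tangent to \<open>H\<close>, so it is null on \<open>H\<close> and normal to the null hypersurface \<open>H\<close>\<close>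
         (\<forall>p\<in>H. \<forall>X. shell_part p \<bullet> shell_part X = 0 \<longrightarrow> K \<bullet> (h p *v X) = 0) \<and>
         \<comment> \<open>\<open>\<nabla>\<^sub>K K = \<kappa> K\<close> on \<open>H\<close>, with non-zero surface gravity\<close>
         \<kappa> \<noteq> 0 \<and> (\<forall>p\<in>H. \<forall>i. christoffel h i 1 1 p = \<kappa> * K $ i))"

text \<open>The map from the exterior to the extension sends \<open>\<partial>\<^sub>\<phi>\<close> to the rotation of the shell about
  its third axis and \<open>\<partial>\<^sub>t + \<Omega> \<partial>\<^sub>\<phi>\<close> to \<open>\<partial>\<^sub>v\<close>. Every map with this property has the form below: \<open>F\<close> gives
  the cylindrical radius and height in the shell, and \<open>a, b\<close> are the (usually divergent) shifts of
  \<open>t\<close> and of the angle.\<close>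

definition horizon_coords ::
  "real \<Rightarrow> (real \<times> real \<Rightarrow> real) \<Rightarrow> (real \<times> real \<Rightarrow> real) \<Rightarrow> (real \<times> real \<Rightarrow> real \<times> real)
     \<Rightarrow> real ^ 4 \<Rightarrow> real ^ 4" where
  "horizon_coords \<Omega> a b F x =
     (let p = (x $ 3, x $ 4); \<psi> = x $ 2 - \<Omega> * x $ 1 + b p
      in vector [x $ 1 + a p, fst (F p) * cos \<psi>, fst (F p) * sin \<psi>, snd (F p)])"

text \<open>\<open>F\<close> identifies a neighbourhood \<open>N\<close> of the horizon segment in the half-plane \<open>\<rho> \<ge> 0\<close> with
  the outer half-annulus, i.e. the outer shell modulo rotations. The horizon segment goes to the
  half-circle with poles at \<open>z = \<plusminus>m\<close>, and the adjacent parts of the axis to the axis of rotation.\<close>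

definition horizon_regular :: "real \<Rightarrow> real \<Rightarrow> (real ^ 4 \<Rightarrow> real ^ 4 ^ 4) \<Rightarrow> bool" where
  "horizon_regular L m g \<longleftrightarrow>
     (\<exists>\<epsilon> \<kappa> \<Omega> h N F F' a b.
        0 < \<epsilon> \<and> \<epsilon> < 1 \<and> nondegenerate_Killing_horizon \<epsilon> \<kappa> h \<and>
        openin (top_of_set {p. snd p \<ge> 0}) N \<and> N \<subseteq> {p. \<bar>fst p\<bar> < L / 2} \<and>
        {-m..m} \<times> {0} \<subseteq> N \<and>
        homeomorphism N {w. fst w \<ge> 0 \<and> 1 \<le> norm w \<and> norm w < 1 + \<epsilon>} F F' \<and>
        F ` ({-m..m} \<times> {0}) = {w. fst w \<ge> 0 \<and> norm w = 1} \<and>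
        F (m, 0) = (0, 1) \<and> F (-m, 0) = (0, -1) \<and>
        (\<forall>p\<in>N. snd p = 0 \<longleftrightarrow> fst (F p) = 0 \<or> norm (F p) = 1) \<and>
        (let N' = {p\<in>N. snd p > 0} in
           smooth_on N' F \<and> smooth_on N' a \<and> smooth_on N' b \<and>
           (\<forall>x. (x $ 3, x $ 4) \<in> N' \<longrightarrow> pullback h (horizon_coords \<Omega> a b F) x = g x)))"


definition omega_S :: "real \<Rightarrow> real \<times> real \<Rightarrow> real" where
  "omega_S m p = (let z = fst p; \<rho> = snd p;
       R = sqrt ((z - m)\<^sup>2 + \<rho>\<^sup>2) + sqrt ((z + m)\<^sup>2 + \<rho>\<^sup>2)
     in ln ((R - 2 * m) / (R + 2 * m)))"

definition eta_boundary_behaviour :: "real \<Rightarrow> real \<Rightarrow> (real \<times> real \<Rightarrow> real) \<Rightarrow> bool" where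
  "eta_boundary_behaviour L m \<eta> \<longleftrightarrow>
     \<comment> \<open>boundedness near \<open>\<rho> = 0\<close> follows by compactness\<close>
     (\<exists>\<delta>>0. \<exists>u. continuous_on ({-L/2..L/2} \<times> {0..\<delta>}) u \<and>
        (\<forall>z\<in>{-L/2..L/2}. \<forall>\<rho>\<in>{0<..\<delta>}.
           u (z, \<rho>) = ln (\<eta> (z, \<rho>)) - 2 * ln \<rho> + omega_S m (z, \<rho>))) \<and>
     (\<forall>z0. m < z0 \<and> z0 < L - m \<longrightarrow>
        ((\<lambda>(z, \<rho>). \<rho> * deriv (\<lambda>r. ln (\<eta> (z, r))) \<rho>) \<longlongrightarrow> 2)
          (at (z0, 0) within {p. snd p > 0})) \<and>
     (\<forall>z0. \<bar>z0\<bar> < m \<longrightarrow>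
        ((\<lambda>(z, \<rho>). \<rho> * deriv (\<lambda>r. ln (\<eta> (z, r))) \<rho>) \<longlongrightarrow> 0)
          (at (z0, 0) within {p. snd p > 0}))"


locale periodic_black_hole =
  fixes L m :: real and V W \<eta> \<gamma> :: "real \<times> real \<Rightarrow> real"
  assumes m_pos: "m > 0" and period_gt: "L > 2 * m"
    and smooth: "\<And>f. f \<in> {V, W, \<eta>, \<gamma>} \<Longrightarrow> smooth_on {p. snd p > 0} f"
    and periodic: "\<And>f z \<rho>. f \<in> {V, W, \<eta>, \<gamma>} \<Longrightarrow> \<rho> > 0 \<Longrightarrow> f (z + L, \<rho>) = f (z, \<rho>)"
    and eta_pos: "\<And>z \<rho>. \<rho> > 0 \<Longrightarrow> \<eta> (z, \<rho>) > 0"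
    and gram: "\<And>z \<rho>. \<rho> > 0 \<Longrightarrow> V (z, \<rho>) * \<eta> (z, \<rho>) + (W (z, \<rho>))\<^sup>2 = \<rho>\<^sup>2"
    and vacuum: "\<And>x i j. x $ 4 > 0 \<Longrightarrow> ricci (spacetime_metric V W \<eta> \<gamma>) i j x = 0"
    and axis: "axis_regular L m (spacetime_metric V W \<eta> \<gamma>)"
    and horizon: "horizon_regular L m (spacetime_metric V W \<eta> \<gamma>)"
    and eta_boundary: "eta_boundary_behaviour L m \<eta>"
    and complete: "spatially_complete_at_infinity L \<eta> \<gamma>"


definition levi_civita :: "4 \<Rightarrow> 4 \<Rightarrow> 4 \<Rightarrow> 4 \<Rightarrow> real" where
  "levi_civita i j k l = det (vector [axis i 1, axis j 1, axis k 1, axis l 1] :: real ^ 4 ^ 4)"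

definition exterior_deriv :: "(real ^ 'n \<Rightarrow> real ^ 'n) \<Rightarrow> real ^ 'n \<Rightarrow> real ^ 'n ^ 'n" where
  "exterior_deriv \<alpha> x = (\<chi> i j. pd i (\<lambda>y. \<alpha> y $ j) x - pd j (\<lambda>y. \<alpha> y $ i) x)"

text \<open>Hodge dual of a 2-form \<open>B\<close>:
  \<open>(\<star>B)\<^sub>k\<^sub>l = \<surd>\<bar>det g\<bar> B\<^sup>i\<^sup>j \<epsilon>\<^sub>i\<^sub>j\<^sub>k\<^sub>l / 2\<close>.\<close>

definition hodge_star :: "real ^ 4 ^ 4 \<Rightarrow> real ^ 4 ^ 4 \<Rightarrow> real ^ 4 ^ 4" where
  "hodge_star g B = (let B' = matrix_inv g ** B ** transpose (matrix_inv g) in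
     (\<chi> k l. sqrt \<bar>det g\<bar> * (\<Sum>i\<in>UNIV. \<Sum>j\<in>UNIV. B' $ i $ j * levi_civita i j k l) / 2))"

text \<open>Komar angular momentum of \<open>\<xi> = \<partial>\<^sub>\<phi>\<close> on the torus with the given \<open>t\<close> and \<open>\<rho>\<close>.\<close>

definition komar_angular_momentum ::
  "real \<Rightarrow> (real ^ 4 \<Rightarrow> real ^ 4 ^ 4) \<Rightarrow> real \<Rightarrow> real \<Rightarrow> real" where
  "komar_angular_momentum L g t \<rho> = (let \<xi> = axis 2 1 in
     1 / (16 * pi) * integral {0..2 * pi} (\<lambda>\<phi>. integral {-L/2..L/2} (\<lambda>z.
       let x = vector [t, \<phi>, z, \<rho>]
       in hodge_star (g x) (exterior_deriv (\<lambda>y. g y *v \<xi>) x) $ 2 $ 3)))"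

end

(* Write sigma = ln eta. The vacuum equations give (rho sigma_rho)_rho + rho sigma_zz = - rho K with K >= 0 the
   squared norm of the twist form divided by eta, a divergence-free twist field whose flux through the circles rho = const is
   the angular momentum, and - 4 Laplace(gamma) = |grad sigma|^2 + K. In particular q has nonnegative curvature.

   If the flux of gamma through some circle were negative, a bounded harmonic function h would make gamma + h decrease
   pointwise across it, so that this circle is strictly concave for the (still complete) metric e^(2(gamma + h)) |dw|^2. By the
   second variation of length, applied to nearly shortest curves moved along a parallel field, points of arbitrary
   height lie within a fixed distance of the circle, and a Hopf-Rinow argument contradicts completeness. So all the
   fluxes of gamma are nonnegative.

   Let alpha(rho) be rho times the mean of sigma_rho over the circle; it is nonincreasing. If alpha <= 1 somewhere, the
   nonzero twist flux forces K to be large, then alpha tends to minus infinity, then the integral of |grad sigma|^2 + K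
   is eventually bounded below and the flux of gamma becomes negative, a contradiction. Hence alpha > 1
   everywhere, so the mean of sigma is at most ln rho + const as rho -> 0. As sigma is 2 ln rho + O(1) on the axis
   and bounded below on compact parts of the horizon, a fraction 2 m / L of the circle, this mean is at least
   2 (1 - 2 m' / L) ln rho - const for every m' < m. Comparing, 4 m <= L. *)
theory Submission
  imports Defs
begin

section \<open>Curves in conformal half-planes\<close>

text \<open>The obstacle is that nothing but completeness is known as \<rho> tends to infinity.
  Shortest curves between two circles are never shown to exist: nearly shortest ones suffice,
  because a curve is moved to both sides at once and the first-order terms, which need not vanish,
  cancel in the sum. The displacement follows geodesics only to second order, w + v - p v^2/2, which
  makes the estimate algebraic. The harmonic correction is the real part of a polynomial in exp(i
  \<omega> w), hence bounded above the circle; it changes lengths by a bounded factor only. The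
  threshold 1 for \<alpha> is borderline: if the mean of \<sigma> is at most ln \<rho> + C, then
  \<rho> K is, up to errors, at least of order 1/\<rho>, which just fails to be integrable. Only the
  mean is controlled, however, while K depends on pointwise values; the oscillation of \<sigma> over
  a circle is absorbed by the integral of |grad \<sigma>|^2, that is, by the decrease of the flux of
  \<gamma>. The constant 4 solves 1 = 2 (1 - 2 m / L).\<close>

text \<open>Points \<open>(z, \<rho>)\<close> are written as complex numbers \<open>z + \<i> \<rho>\<close>.\<close>

definition conformal_connected :: "(complex \<Rightarrow> real) \<Rightarrow> real \<Rightarrow> complex \<Rightarrow> complex \<Rightarrow> real \<Rightarrow> bool" where
  "conformal_connected g \<rho> p q l \<longleftrightarrow> (\<exists>c. valid_path c \<and> path_image c \<subseteq> {w. \<rho> \<le> Im w} \<and>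
     pathstart c = p \<and> pathfinish c = q \<and>
     ((\<lambda>s. exp (g (c s)) * norm (vector_derivative c (at s))) has_integral l) {0..1})"

section \<open>Lengths of piecewise C1 curves under joining, cutting, translation and
  reversal\<close>

lemma conformal_connected_nonneg:
  assumes "conformal_connected g \<rho> p q l"
  shows "0 \<le> l"
proof -
  from assms obtain c where "((\<lambda>s. exp (g (c s)) * norm (vector_derivative c (at s))) has_integral l) {0..1}"
    unfolding conformal_connected_def by blast
  then show ?thesis
    by (rule has_integral_nonneg) simp
qed

lemma conformal_connected_imp_ge:
  assumes "conformal_connected g \<rho> p q l"
  shows "\<rho> \<le> Im p" "\<rho> \<le> Im q"
  using assms unfolding conformal_connected_def
  by (metis (no_types, lifting) mem_Collect_eq pathstart_in_path_image pathfinish_in_path_image subsetD)+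

text \<open>Both halves are rescaled affinely; the velocity of the joined curve is computed only off
  1/2 and the preimages of the finitely many corners, a set that the integral does not see.\<close>

lemma speed_has_integral_join:
  fixes c1 c2 :: "real \<Rightarrow> complex"
  assumes v: "valid_path c1" "valid_path c2"
    and 1: "((\<lambda>s. f (c1 s) * norm (vector_derivative c1 (at s))) has_integral i1) {0..1}"
    and 2: "((\<lambda>s. f (c2 s) * norm (vector_derivative c2 (at s))) has_integral i2) {0..1}"
  shows "((\<lambda>s. f ((c1 +++ c2) s) * norm (vector_derivative (c1 +++ c2) (at s))) has_integral i1 + i2) {0..1}"
proof -
  obtain s1 s2
    where s1: "finite s1" "\<forall>x\<in>{0..1} - s1. c1 differentiable at x"
      and s2: "finite s2" "\<forall>x\<in>{0..1} - s2. c2 differentiable at x"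
    using v by (auto simp: valid_path_def piecewise_C1_differentiable_on_def C1_differentiable_on_eq)
  have i1: "((\<lambda>x. 2 * (f (c1 (2*x)) * norm (vector_derivative c1 (at (2*x))))) has_integral i1) {0..1/2}"
   and i2: "((\<lambda>x. 2 * (f (c2 (2*x - 1)) * norm (vector_derivative c2 (at (2*x - 1))))) has_integral i2) {1/2..1}"
    using has_integral_affinity01 [OF 1, where m= 2 and c=0, THEN has_integral_cmul [where c=2]]
          has_integral_affinity01 [OF 2, where m= 2 and c="-1", THEN has_integral_cmul [where c=2]]
    by (simp_all only: image_affinity_atLeastAtMost_div_diff, simp_all add: mult_ac)
  have d1: "vector_derivative (c1 +++ c2) (at z) = 2 *\<^sub>R vector_derivative c1 (at (2*z))"
      if "0 \<le> z" "z*2 < 1" "2*z \<notin> s1" for z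
    unfolding joinpaths_def
  proof (rule vector_derivative_at [OF has_vector_derivative_transform_within])
    show "0 < \<bar>z - 1/2\<bar>"
      using that by auto
    have "((*) 2 has_vector_derivative 2) (at z)"
      by (simp add: has_vector_derivative_def has_derivative_def bounded_linear_mult_left)
    moreover have "(c1 has_vector_derivative vector_derivative c1 (at (2*z))) (at (2 * z))"
      using s1 that by (auto simp: algebra_simps vector_derivative_works)
    ultimately
    show "((\<lambda>x. c1 (2 * x)) has_vector_derivative 2 *\<^sub>R vector_derivative c1 (at (2*z))) (at z)"
      by (intro vector_diff_chain_at [simplified o_def])
  qed (use that in \<open>simp_all add: dist_real_def abs_if split: if_split_asm\<close>)
  have d2: "vector_derivative (c1 +++ c2) (at z) = 2 *\<^sub>R vector_derivative c2 (at (2*z - 1))"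
      if "1 < z*2" "z \<le> 1" "2*z - 1 \<notin> s2" for z
    unfolding joinpaths_def
  proof (rule vector_derivative_at [OF has_vector_derivative_transform_within])
    show "0 < \<bar>z - 1/2\<bar>"
      using that by auto
    have "((\<lambda>x. 2 * x - 1) has_vector_derivative 2) (at z)"
      by (auto intro!: derivative_eq_intros)
    moreover have "(c2 has_vector_derivative vector_derivative c2 (at (2*z - 1))) (at (2 * z - 1))"
      using s2 that by (auto simp: algebra_simps vector_derivative_works)
    ultimately
    show "((\<lambda>x. c2 (2 * x - 1)) has_vector_derivative 2 *\<^sub>R vector_derivative c2 (at (2*z - 1))) (at z)"
      by (intro vector_diff_chain_at [simplified o_def])
  qed (use that in \<open>simp_all add: dist_real_def abs_if split: if_split_asm\<close>)
  have fin1: "finite (insert (1/2) ((\<lambda>x::real. 2*x) -` s1))"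
    using s1 by (simp add: finite_vimageI inj_on_def)
  have fin2: "finite (insert (1/2) ((\<lambda>x::real. 2*x - 1) -` s2))"
    using s2 by (simp add: finite_vimageI inj_on_def)
  have "((\<lambda>s. f ((c1 +++ c2) s) * norm (vector_derivative (c1 +++ c2) (at s))) has_integral i1) {0..1/2}"
  proof (rule has_integral_spike_finite [OF fin1 _ i1])
    fix x assume "x \<in> {0..1/2} - insert (1/2) ((\<lambda>x::real. 2*x) -` s1)"
    then have "0 \<le> x" "x*2 < 1" "2*x \<notin> s1" by auto
    then show "f ((c1 +++ c2) x) * norm (vector_derivative (c1 +++ c2) (at x)) =
        2 * (f (c1 (2 * x)) * norm (vector_derivative c1 (at (2 * x))))"
      by (simp add: d1) (simp add: joinpaths_def)
  qed
  moreover have "((\<lambda>s. f ((c1 +++ c2) s) * norm (vector_derivative (c1 +++ c2) (at s))) has_integral i2) {1/2..1}"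
  proof (rule has_integral_spike_finite [OF fin2 _ i2])
    fix x assume "x \<in> {1/2..1} - insert (1/2) ((\<lambda>x::real. 2*x - 1) -` s2)"
    then have "1 < x*2" "x \<le> 1" "2*x - 1 \<notin> s2" by auto
    then show "f ((c1 +++ c2) x) * norm (vector_derivative (c1 +++ c2) (at x)) =
        2 * (f (c2 (2 * x - 1)) * norm (vector_derivative c2 (at (2 * x - 1))))"
      by (simp add: d2) (simp add: joinpaths_def)
  qed
  ultimately show ?thesis
    by (rule has_integral_combine[rotated 2]) auto
qed

lemma speed_has_integral_subpath:
  fixes c :: "real \<Rightarrow> complex"
  assumes v: "valid_path c" and uv: "0 \<le> u" "u \<le> v" "v \<le> 1"
    and I: "((\<lambda>s. f (c s) * norm (vector_derivative c (at s))) has_integral i) {u..v}"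
  shows "((\<lambda>s. f (subpath u v c s) * norm (vector_derivative (subpath u v c) (at s))) has_integral i) {0..1}"
proof (cases "v = u")
  case True
  have "vector_derivative (\<lambda>x. c u) (at s) = 0" for s
    by (rule vector_derivative_at) auto
  then show ?thesis
    using I True has_integral_unique[OF I[unfolded True] has_integral_null_real[of u u]]
    by (simp add: subpath_def)
next
  case False
  obtain S where S: "\<And>x. x \<in> {0..1} - S \<Longrightarrow> c differentiable at x" and fs: "finite S"
    using v unfolding piecewise_C1_differentiable_on_def C1_differentiable_on_eq valid_path_def by blast
  have *: "((\<lambda>x. f (c ((v - u) * x + u)) * norm (vector_derivative c (at ((v - u) * x + u))))
            has_integral (1 / (v - u)) * i) {0..1}"
    using uv False I
    apply simp
    apply (drule has_integral_affinity [where m="v-u" and c=u, simplified])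
    apply (simp_all add: image_affinity_atLeastAtMost_div_diff)
    apply (simp add: divide_simps)
    done
  have vd: "vector_derivative (\<lambda>x. c ((v-u) * x + u)) (at x) = (v-u) *\<^sub>R vector_derivative c (at ((v-u) * x + u))"
    if "x \<in> {0..1}"  "x \<notin> (\<lambda>t. (v-u) *\<^sub>R t + u) -` S" for x
  proof (rule vector_derivative_at [OF vector_diff_chain_at [simplified o_def]])
    show "((\<lambda>x. (v - u) * x + u) has_vector_derivative v - u) (at x)"
      by (intro derivative_eq_intros | simp)+
  qed (use S uv mult_left_le [of x "v-u"] that in \<open>auto simp: vector_derivative_works\<close>)
  have fin: "finite ((\<lambda>t. (v - u) *\<^sub>R t + u) -` S)"
    using fs by (auto simp: inj_on_def False finite_vimageI)
  show ?thesis
    unfolding subpath_def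
  proof (rule has_integral_spike_finite [OF fin])
    show "((\<lambda>x. (v - u) * (f (c ((v - u) * x + u)) * norm (vector_derivative c (at ((v - u) * x + u)))))
        has_integral i) {0..1}"
      using has_integral_cmul [OF *, where c = "v-u"] False by simp
    fix x assume "x \<in> {0..1} - (\<lambda>t. (v - u) *\<^sub>R t + u) -` S"
    then show "f (c ((v - u) * x + u)) * norm (vector_derivative (\<lambda>x. c ((v - u) * x + u)) (at x)) =
        (v - u) * (f (c ((v - u) * x + u)) * norm (vector_derivative c (at ((v - u) * x + u))))"
      using vd[of x] uv by simp
  qed
qed

lemma conformal_connected_trans:
  assumes "conformal_connected g \<rho> p q l1" "conformal_connected g \<rho> q r l2"
  shows "conformal_connected g \<rho> p r (l1 + l2)"
proof -
  from assms(1) obtain c1 where 1: "valid_path c1" "path_image c1 \<subseteq> {w. \<rho> \<le> Im w}"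
     "pathstart c1 = p" "pathfinish c1 = q"
     "((\<lambda>s. exp (g (c1 s)) * norm (vector_derivative c1 (at s))) has_integral l1) {0..1}"
    unfolding conformal_connected_def by auto
  from assms(2) obtain c2 where 2: "valid_path c2" "path_image c2 \<subseteq> {w. \<rho> \<le> Im w}"
     "pathstart c2 = q" "pathfinish c2 = r"
     "((\<lambda>s. exp (g (c2 s)) * norm (vector_derivative c2 (at s))) has_integral l2) {0..1}"
    unfolding conformal_connected_def by auto
  have "((\<lambda>s. exp (g ((c1 +++ c2) s)) * norm (vector_derivative (c1 +++ c2) (at s))) has_integral l1 + l2) {0..1}"
    using speed_has_integral_join[OF 1(1) 2(1), of "\<lambda>w. exp (g w)"] 1 2 by simp
  moreover have "path_image (c1 +++ c2) \<subseteq> {w. \<rho> \<le> Im w}"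
    using 1 2 by (simp add: path_image_join)
  ultimately show ?thesis
    unfolding conformal_connected_def using 1 2 by (intro exI[of _ "c1 +++ c2"]) (auto intro!: valid_path_join)
qed

text \<open>The intermediate value theorem gives a parameter at height \<open>R\<close>, and length
  is additive over the two subpaths.\<close>

lemma conformal_connected_split:
  assumes "conformal_connected g \<rho> p q l" and "Im p \<le> R" "R \<le> Im q"
  obtains x l1 l2 where "Im x = R" "conformal_connected g \<rho> p x l1" "conformal_connected g \<rho> x q l2" "l = l1 + l2"
proof -
  from assms(1) obtain c where c: "valid_path c" "path_image c \<subseteq> {w. \<rho> \<le> Im w}"
     "pathstart c = p" "pathfinish c = q"
     "((\<lambda>s. exp (g (c s)) * norm (vector_derivative c (at s))) has_integral l) {0..1}" (is "(?f has_integral l) _")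
    unfolding conformal_connected_def by auto
  have "continuous_on {0..1} (\<lambda>s. Im (c s))"
    using valid_path_imp_path[OF c(1)] by (auto simp: path_def intro: continuous_intros)
  then obtain u where u: "0 \<le> u" "u \<le> 1" "Im (c u) = R"
    using IVT'[of "\<lambda>s. Im (c s)" 0 R 1] assms c(3,4) by (auto simp: pathstart_def pathfinish_def)
  have int: "?f integrable_on {0..1}"
    using c(5) by blast
  have 1: "(?f has_integral integral {0..u} ?f) {0..u}" and 2: "(?f has_integral integral {u..1} ?f) {u..1}"
    using integrable_on_subinterval[OF int] u by (auto simp: has_integral_integral[symmetric])
  have "integral {0..1} ?f = l"
    using c(5) by blast
  then have l: "l = integral {0..u} ?f + integral {u..1} ?f"
    using Henstock_Kurzweil_Integration.integral_combine[OF u(1,2) int] by simp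
  have im: "path_image (subpath 0 u c) \<subseteq> {w. \<rho> \<le> Im w}" "path_image (subpath u 1 c) \<subseteq> {w. \<rho> \<le> Im w}"
    using path_image_subpath_subset[of 0 u c] path_image_subpath_subset[of u 1 c] u c(2) by auto
  have "conformal_connected g \<rho> p (c u) (integral {0..u} ?f)"
    unfolding conformal_connected_def
    using speed_has_integral_subpath[OF c(1) _ _ _ 1] u im c
    by (intro exI[of _ "subpath 0 u c"]) (auto intro!: valid_path_subpath simp: pathstart_def[of c])
  moreover have "conformal_connected g \<rho> (c u) q (integral {u..1} ?f)"
    unfolding conformal_connected_def
    using speed_has_integral_subpath[OF c(1) _ _ _ 2] u im c
    by (intro exI[of _ "subpath u 1 c"]) (auto intro!: valid_path_subpath simp: pathfinish_def[of c])
  ultimately show thesis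
    using that u l by blast
qed

lemma conformal_connected_shift:
  assumes "conformal_connected g \<rho> p q l" and g: "\<And>w. \<rho> \<le> Im w \<Longrightarrow> g (w + of_real T) = g w"
  shows "conformal_connected g \<rho> (p + of_real T) (q + of_real T) l"
proof -
  from assms(1) obtain c where c: "valid_path c" "path_image c \<subseteq> {w. \<rho> \<le> Im w}"
     "pathstart c = p" "pathfinish c = q"
     "((\<lambda>s. exp (g (c s)) * norm (vector_derivative c (at s))) has_integral l) {0..1}"
    unfolding conformal_connected_def by auto
  let ?c = "\<lambda>s. c s + of_real T"
  have vp: "valid_path ?c"
    using valid_path_offset[of c "- of_real T"] c(1) by simp
  obtain S where S: "\<And>x. x \<in> {0..1} - S \<Longrightarrow> c differentiable at x" and fs: "finite S"
    using c(1) unfolding piecewise_C1_differentiable_on_def C1_differentiable_on_eq valid_path_def by blast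
  have "vector_derivative ?c (at x) = vector_derivative c (at x)" if "x \<in> {0..1} - S" for x
    using S[OF that] by (auto intro!: vector_derivative_at derivative_eq_intros simp: vector_derivative_works)
  moreover have "g (c x + of_real T) = g (c x)" if "x \<in> {0..1}" for x
    using c(2) that by (intro g) (auto simp: path_image_def image_subset_iff)
  ultimately have "((\<lambda>s. exp (g (?c s)) * norm (vector_derivative ?c (at s))) has_integral l) {0..1}"
    by (intro has_integral_spike_finite[OF fs _ c(5)]) auto
  moreover have "path_image ?c \<subseteq> {w. \<rho> \<le> Im w}"
    using c(2) by (auto simp: path_image_def)
  ultimately show ?thesis
    unfolding conformal_connected_def using vp c(3,4)
    by (intro exI[of _ ?c]) (auto simp: pathstart_def pathfinish_def)
qed

text \<open>Bridge from arcs that carry their velocity explicitly to paths on the unit interval. The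
  given derivatives are one-sided at \<open>a\<close> and \<open>b\<close>, hence the exceptional
  set \<open>{0,1}\<close> in the proof.\<close>

lemma conformal_connected_C1:
  fixes c :: "real \<Rightarrow> complex"
  assumes ab: "a < b"
    and d: "\<And>t. t \<in> {a..b} \<Longrightarrow> (c has_vector_derivative c' t) (at t within {a..b})"
    and c': "continuous_on {a..b} c'"
    and im: "\<And>t. t \<in> {a..b} \<Longrightarrow> \<rho> \<le> Im (c t)"
    and g: "continuous_on {w. \<rho> \<le> Im w} g"
  shows "conformal_connected g \<rho> (c a) (c b) (integral {a..b} (\<lambda>t. exp (g (c t)) * norm (c' t)))"
proof -
  let ?k = "\<lambda>s. a + (b - a) * s"
  let ?c = "\<lambda>s. c (?k s)"
  have k: "?k s \<in> {a..b}" if "s \<in> {0..1}" for s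
  proof -
    have "0 \<le> (b - a) * s" "(b - a) * s \<le> (b - a) * 1"
      using that ab by (auto intro: mult_left_mono)
    then show ?thesis by simp
  qed
  have cont: "continuous_on {a..b} c"
    using d has_vector_derivative_continuous continuous_on_eq_continuous_within by blast
  have kk: "continuous_on {0..1} ?k" by (auto intro!: continuous_intros)
  have der: "(?c has_vector_derivative (b - a) *\<^sub>R c' (?k s)) (at s)" if "s \<in> {0<..<1}" for s
  proof -
    have "0 < (b - a) * s" "(b - a) * s < (b - a) * 1"
      using that ab by (auto intro: mult_strict_left_mono)
    then have "?k s \<in> {a<..<b}" by simp
    then have "(c has_vector_derivative c' (?k s)) (at (?k s))"
      using d[of "?k s"] by (simp add: at_within_Icc_at)
    moreover have "(?k has_vector_derivative (b - a)) (at s)"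
      by (auto intro!: derivative_eq_intros)
    ultimately show ?thesis
      using vector_diff_chain_at[of ?k "b - a" s c] by (simp add: o_def)
  qed
  have cc: "continuous_on {0..1} ?c"
    by (rule continuous_on_compose2[OF cont kk]) (use k in auto)
  have cc': "continuous_on {0..1} (\<lambda>s. c' (?k s))"
    by (rule continuous_on_compose2[OF c' kk]) (use k in auto)
  have vp: "valid_path ?c"
    unfolding valid_path_def piecewise_C1_differentiable_on_def
  proof (intro conjI exI[of _ "{0,1}"])
    show "?c C1_differentiable_on {0..1} - {0, 1}"
      unfolding C1_differentiable_on_def
    proof (intro exI[of _ "\<lambda>s. (b - a) *\<^sub>R c' (?k s)"] conjI ballI)
      show "continuous_on ({0..1} - {0, 1}) (\<lambda>s. (b - a) *\<^sub>R c' (?k s))"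
        by (intro continuous_intros continuous_on_subset[OF cc']) auto
    qed (use der in auto)
  qed (use cc in auto)
  let ?F = "\<lambda>t. exp (g (c t)) * norm (c' t)"
  have "continuous_on {a..b} ?F"
    using c' by (intro continuous_intros continuous_on_compose2[OF g cont]) (use im in auto)
  then have "(?F has_integral integral {a..b} ?F) {a..b}"
    using integrable_continuous_real by blast
  then have "((\<lambda>x. ?F ((b - a) * x + a)) has_integral (1 / (b - a)) * integral {a..b} ?F) {0..1}"
    using ab
    apply -
    apply (drule has_integral_affinity [where m="b-a" and c=a, simplified])
    apply (simp_all add: image_affinity_atLeastAtMost_div_diff)
    apply (simp add: divide_simps)
    done
  from has_integral_cmul[OF this, of "b - a"]
  have I: "((\<lambda>x. (b - a) * ?F (?k x)) has_integral integral {a..b} ?F) {0..1}"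
    using ab by (simp add: add.commute)
  have vd: "vector_derivative ?c (at s) = (b - a) *\<^sub>R c' (?k s)" if "s \<in> {0..1} - {0,1}" for s
    using der[of s] that by (intro vector_derivative_at) auto
  have "((\<lambda>s. exp (g (?c s)) * norm (vector_derivative ?c (at s))) has_integral integral {a..b} ?F) {0..1}"
  proof (rule has_integral_spike_finite[OF _ _ I, of "{0,1}"])
    fix s :: real assume "s \<in> {0..1} - {0, 1}"
    from vd[OF this] ab show "exp (g (?c s)) * norm (vector_derivative ?c (at s)) = (b - a) * ?F (?k s)"
      by (simp only: norm_scaleR) simp
  qed simp
  moreover have "path_image ?c \<subseteq> {w. \<rho> \<le> Im w}"
    using im k by (auto simp: path_image_def)
  ultimately show ?thesis
    unfolding conformal_connected_def using vp
    by (intro exI[of _ ?c]) (auto simp: pathstart_def pathfinish_def)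
qed

lemma conformal_connected_line:
  assumes g: "continuous_on {w. \<rho> \<le> Im w} g" and pq: "\<rho> \<le> Im p" "\<rho> \<le> Im q"
    and M: "\<And>w. w \<in> closed_segment p q \<Longrightarrow> exp (g w) \<le> M"
  obtains l where "conformal_connected g \<rho> p q l" "l \<le> M * dist p q"
proof -
  have seg: "linepath p q t \<in> closed_segment p q" if "t \<in> {0..1}" for t
    using that by (metis linepath_in_path path_image_linepath)
  have "closed_segment p q \<subseteq> {w. \<rho> \<le> Im w}"
    by (rule closed_segment_subset) (use pq in \<open>auto simp: convex_halfspace_Im_ge\<close>)
  then have im: "\<rho> \<le> Im (linepath p q t)" if "t \<in> {0..1}" for t
    using seg[OF that] by auto
  let ?F = "\<lambda>t. exp (g (linepath p q t)) * norm (q - p)"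
  have "conformal_connected g \<rho> (linepath p q 0) (linepath p q 1) (integral {0..1} ?F)"
    by (rule conformal_connected_C1)
       (auto simp: im g intro: has_vector_derivative_linepath_within)
  moreover have "integral {0..1} ?F \<le> integral {0..1} (\<lambda>t::real. M * dist p q)"
  proof (rule Henstock_Kurzweil_Integration.integral_le)
    show "?F integrable_on {0..1}"
      by (rule integrable_continuous_real)
         (intro continuous_intros continuous_on_compose2[OF g continuous_on_linepath], use im in auto)
    show "?F x \<le> M * dist p q" if "x \<in> {0..1}" for x
      using M[OF seg[OF that]] by (simp add: dist_norm norm_minus_commute mult_right_mono)
  qed auto
  ultimately show thesis
    using that by (simp add: linepath_def)
qed

lemma conformal_connected_sym:
  assumes "conformal_connected g \<rho> p q l"
  shows "conformal_connected g \<rho> q p l"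
proof -
  from assms obtain c where c: "valid_path c" "path_image c \<subseteq> {w. \<rho> \<le> Im w}"
     "pathstart c = p" "pathfinish c = q"
     "((\<lambda>s. exp (g (c s)) * norm (vector_derivative c (at s))) has_integral l) {0..1}"
    unfolding conformal_connected_def by auto
  obtain S where S: "\<And>x. x \<in> {0..1} - S \<Longrightarrow> c differentiable at x" and fs: "finite S"
    using c(1) unfolding piecewise_C1_differentiable_on_def C1_differentiable_on_eq valid_path_def by blast
  have I: "((\<lambda>x. exp (g (c (1 - x))) * norm (vector_derivative c (at (1 - x)))) has_integral l) {0..1}"
    using has_integral_affinity01 [OF c(5), where m= "-1" and c=1]
    by (simp add: image_affinity_atLeastAtMost)
  have "vector_derivative (\<lambda>x. c (1 - x)) (at x) = - vector_derivative c (at (1 - x))"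
    if "x \<in> {0..1} - (\<lambda>x. 1 - x) -` S" for x
  proof (rule vector_derivative_at)
    have "((\<lambda>x::real. 1 - x) has_vector_derivative - 1) (at x)"
      by (auto intro!: derivative_eq_intros)
    moreover have "(c has_vector_derivative vector_derivative c (at (1 - x))) (at (1 - x))"
      using that S by (auto simp: vector_derivative_works[symmetric])
    ultimately show "((\<lambda>x. c (1 - x)) has_vector_derivative - vector_derivative c (at (1 - x))) (at x)"
      using vector_diff_chain_at[of "\<lambda>x. 1 - x" "-1" x c] by (simp add: o_def)
  qed
  moreover have "finite ((\<lambda>x::real. 1 - x) -` S)"
    using fs by (simp add: finite_vimageI inj_on_def)
  ultimately have "((\<lambda>s. exp (g (reversepath c s)) * norm (vector_derivative (reversepath c) (at s))) has_integral l) {0..1}"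
    unfolding reversepath_def by (intro has_integral_spike_finite[OF _ _ I]) auto
  then show ?thesis
    unfolding conformal_connected_def using c by (intro exI[of _ "reversepath c"]) auto
qed

text \<open>A calibration: along the curve a primitive of \<beta>, evaluated at the height, grows no
  faster than length, because |\<beta>| is at most the conformal factor and |d Im w| at most
  |dw|.\<close>

lemma conformal_connected_lower_bound:
  assumes conn: "conformal_connected g \<rho> p q l"
    and \<beta>: "continuous_on UNIV \<beta>" "\<And>w. \<rho> \<le> Im w \<Longrightarrow> \<bar>\<beta> (Im w)\<bar> \<le> exp (g w)"
    and le: "Im p \<le> Im q"
  shows "integral {Im p..Im q} \<beta> \<le> l"
proof -
  from conn obtain c where c: "valid_path c" "path_image c \<subseteq> {w. \<rho> \<le> Im w}"
     "pathstart c = p" "pathfinish c = q"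
     "((\<lambda>s. exp (g (c s)) * norm (vector_derivative c (at s))) has_integral l) {0..1}"
    unfolding conformal_connected_def by auto
  obtain S where S: "\<And>x. x \<in> {0..1} - S \<Longrightarrow> c differentiable at x" and fs: "finite S"
    using c(1) unfolding piecewise_C1_differentiable_on_def C1_differentiable_on_eq valid_path_def by blast
  have cont: "continuous_on {0..1} c"
    using valid_path_imp_path[OF c(1)] by (simp add: path_def)
  obtain Y where "\<And>w. w \<in> path_image c \<Longrightarrow> norm w \<le> Y"
    using bounded_valid_path_image[OF c(1)] by (auto simp: bounded_iff)
  then have Y: "\<rho> \<le> Im (c s) \<and> Im (c s) \<le> Y" if "s \<in> {0..1}" for s
    using c(2) that abs_Im_le_cmod[of "c s"] by (force simp: path_image_def image_subset_iff)
  \<comment> \<open>The lower limit \<open>\<rho> - 1\<close> lies strictly below all heights on the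
    curve, so that \<open>B\<close> has a two-sided derivative at \<rho> too.\<close>
  define B where "B y = integral {\<rho> - 1..y} \<beta>" for y
  have B: "(B has_real_derivative \<beta> y) (at y)" if "\<rho> \<le> y" "y \<le> Y" for y
    unfolding B_def
    using integral_has_real_derivative[of "\<rho> - 1" "Y + 1" \<beta> y] that
    by (simp add: continuous_on_subset[OF \<beta>(1)] at_within_Icc_at)
  then have contB: "continuous_on {\<rho>..Y} B"
    by (meson DERIV_isCont continuous_at_imp_continuous_on atLeastAtMost_iff)
  define D where "D s = vector_derivative c (at s)" for s
  have I: "((\<lambda>s. \<beta> (Im (c s)) * Im (D s)) has_integral B (Im (c 1)) - B (Im (c 0))) {0..1}"
  proof (rule fundamental_theorem_of_calculus_interior_strong[OF fs])
    show "continuous_on {0..1} (\<lambda>s. B (Im (c s)))"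
      by (intro continuous_on_compose2[OF contB] continuous_intros cont) (use Y in auto)
    fix s assume s: "s \<in> {0<..<1} - S"
    then have "(c has_vector_derivative D s) (at s)"
      using S by (auto simp: D_def vector_derivative_works[symmetric])
    then have "((\<lambda>s. Im (c s)) has_real_derivative Im (D s)) (at s)"
      unfolding has_real_derivative_iff_has_vector_derivative
      by (rule bounded_linear.has_vector_derivative[OF bounded_linear_Im])
    then show "((\<lambda>s. B (Im (c s))) has_vector_derivative \<beta> (Im (c s)) * Im (D s)) (at s)"
      using DERIV_chain2[of B "\<beta> (Im (c s))" "\<lambda>s. Im (c s)" s, OF B] Y[of s] s
      by (simp add: has_real_derivative_iff_has_vector_derivative[symmetric])
  qed auto
  have "\<bar>\<beta> (Im (c s)) * Im (D s)\<bar> \<le> exp (g (c s)) * norm (D s)" if "s \<in> {0..1}" for s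
    unfolding abs_mult
    by (intro mult_mono \<beta>(2) abs_Im_le_cmod) (use Y that in auto)
  then have "B (Im (c 1)) - B (Im (c 0)) \<le> l"
    by (intro has_integral_le[OF I c(5)[folded D_def]]) (auto simp: abs_le_iff)
  moreover have "B (Im q) = B (Im p) + integral {Im p..Im q} \<beta>"
    unfolding B_def using conformal_connected_imp_ge[OF conn] le
    by (intro Henstock_Kurzweil_Integration.integral_combine[symmetric])
       (auto intro!: integrable_continuous_real continuous_on_subset[OF \<beta>(1)])
  ultimately show ?thesis
    using c(3,4) by (simp add: pathstart_def pathfinish_def)
qed

section \<open>Functions that are periodic in the horizontal direction\<close>

lemma periodic_of_int:
  fixes f :: "complex \<Rightarrow> 'a"
  assumes "\<And>w. \<rho> \<le> Im w \<Longrightarrow> f (w + of_real L) = f w" and "\<rho> \<le> Im w"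
  shows "f (w + of_real (of_int k * L)) = f w"
proof -
  have nat: "f (v + of_real (of_nat n * L)) = f v" if "\<rho> \<le> Im v" for n v
  proof (induction n)
    case (Suc n)
    have "f (v + of_real (of_nat (Suc n) * L)) = f ((v + of_real (of_nat n * L)) + of_real L)"
      by (simp add: algebra_simps)
    also have "\<dots> = f (v + of_real (of_nat n * L))"
      using that by (intro assms(1)) simp
    finally show ?case using Suc by simp
  qed simp
  show ?thesis
  proof (cases k rule: int_cases2)
    case (nonneg n)
    then show ?thesis using nat[OF assms(2)] by simp
  next
    case (nonpos n)
    then show ?thesis
      using nat[of "w + of_real (of_int k * L)" n] assms(2) by simp
  qed
qed

lemma ex_shift_to_fundamental_domain:
  fixes x L :: real
  assumes "0 < L"
  obtains k :: int where "0 \<le> x + of_int k * L" "x + of_int k * L \<le> L"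
proof
  show "0 \<le> x + of_int (- \<lfloor>x / L\<rfloor>) * L"
    using floor_divide_lower[OF assms, of x] by simp
  show "x + of_int (- \<lfloor>x / L\<rfloor>) * L \<le> L"
    using floor_divide_upper[OF assms, of x] by (simp add: algebra_simps)
qed

text \<open>One closed period of the strip is compact, and every point of the strip is a translate
  of a point in it.\<close>

lemma periodic_strip_bounded:
  fixes f :: "complex \<Rightarrow> 'a::real_normed_vector"
  assumes L: "0 < L" and f: "continuous_on {w. a \<le> Im w} f"
    and per: "\<And>w. a \<le> Im w \<Longrightarrow> f (w + of_real L) = f w"
  obtains B where "0 < B" "\<And>w. a \<le> Im w \<Longrightarrow> Im w \<le> b \<Longrightarrow> norm (f w) \<le> B"
proof -
  let ?K = "cbox (Complex 0 a) (Complex L b)"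
  have "compact (f ` ?K)"
    by (intro compact_continuous_image continuous_on_subset[OF f] compact_cbox) (auto simp: in_cbox_complex_iff)
  then obtain B where B: "\<And>w. w \<in> ?K \<Longrightarrow> norm (f w) \<le> B"
    by (force dest!: compact_imp_bounded simp: bounded_iff)
  show thesis
  proof
    show "0 < \<bar>B\<bar> + 1" by simp
    fix w assume w: "a \<le> Im w" "Im w \<le> b"
    obtain k :: int where k: "0 \<le> Re w + of_int k * L" "Re w + of_int k * L \<le> L"
      using ex_shift_to_fundamental_domain[OF L] .
    have "norm (f (w + of_real (of_int k * L))) \<le> B"
      by (rule B) (use k w in \<open>auto simp: in_cbox_complex_iff\<close>)
    then show "norm (f w) \<le> \<bar>B\<bar> + 1"
      using periodic_of_int[of a f L, OF per w(1)] by simp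
  qed
qed

section \<open>Hopf-Rinow: arbitrary heights within bounded length yield a ray of finite
  length\<close>

lemma conformal_connected_concat:
  fixes x :: "nat \<Rightarrow> complex"
  assumes "\<And>n. conformal_connected g \<rho> (x n) (x (Suc n)) (l n)"
  shows "i < j \<Longrightarrow> conformal_connected g \<rho> (x i) (x j) (sum l {i..<j})"
proof (induction j)
  case (Suc j)
  show ?case
  proof (cases "i = j")
    case True
    then show ?thesis using assms by simp
  next
    case False
    then show ?thesis
      using conformal_connected_trans[OF Suc.IH assms] Suc.prems by simp
  qed
qed simp

text \<open>The Hopf--Rinow step. Of the curves that reach ever greater height, infinitely many cross the
  height \<open>R\<close> at nearly the same point modulo \<open>L\<close> and after nearly the same length.\<close>

lemma bounded_escape_step:
  assumes L: "0 < L" and g: "continuous_on {w. \<rho> \<le> Im w} g"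
    and per: "\<And>w. \<rho> \<le> Im w \<Longrightarrow> g (w + of_real L) = g w"
    and esc: "\<And>n::nat. \<exists>y l. real n \<le> Im y \<and> conformal_connected g \<rho> x y l \<and> l \<le> b"
    and R: "Im x \<le> R" and \<epsilon>: "0 < \<epsilon>"
  obtains x' l where "Im x' = R" "conformal_connected g \<rho> x x' l"
    "\<And>n::nat. \<exists>y l'. real n \<le> Im y \<and> conformal_connected g \<rho> x' y l' \<and> l' \<le> b - l + \<epsilon>"
proof -
  have perk: "g (w + of_real (of_int k * L)) = g w" if "\<rho> \<le> Im w" for w k
    using periodic_of_int[of \<rho> g L, OF per that] .
  \<comment> \<open>For small \<open>n\<close> the height \<open>n\<close> may lie below
    \<open>R\<close>; replacing \<open>n\<close> by \<open>max n N0\<close> forces the curve to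
    cross height \<open>R\<close>.\<close>
  obtain N0 :: nat where N0: "R \<le> real N0"
    using real_arch_simple by blast
  have "\<exists>k::int. \<exists>z l r y. Im z = R \<and> 0 \<le> Re z \<and> Re z \<le> L \<and> 
      conformal_connected g \<rho> (x + of_real (of_int k * L)) z l \<and>
      conformal_connected g \<rho> z y r \<and> l + r \<le> b \<and> real n \<le> Im y" for n :: nat
  proof -
    obtain y l where yl: "real (max n N0) \<le> Im y" "conformal_connected g \<rho> x y l" "l \<le> b"
      using esc by blast
    have "R \<le> Im y"
      using yl(1) N0 by simp
    then obtain z l1 l2 where z: "Im z = R" "conformal_connected g \<rho> x z l1" "conformal_connected g \<rho> z y l2" "l = l1 + l2"
      using conformal_connected_split[OF yl(2) R] by metis
    obtain k :: int where k: "0 \<le> Re z + of_int k * L" "Re z + of_int k * L \<le> L"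
      using ex_shift_to_fundamental_domain[OF L] .
    show ?thesis
      using z yl k conformal_connected_shift[OF z(2) perk] conformal_connected_shift[OF z(3) perk]
      by (intro exI[of _ k] exI[of _ "z + of_real (of_int k * L)"] exI[of _ l1] exI[of _ l2]
           exI[of _ "y + of_real (of_int k * L)"]) auto
  qed
  then obtain k :: "nat \<Rightarrow> int" and z l r y where H: "\<And>n. Im (z n) = R" "\<And>n. 0 \<le> Re (z n)" "\<And>n. Re (z n) \<le> L"
      "\<And>n. conformal_connected g \<rho> (x + of_real (of_int (k n) * L)) (z n) (l n)"
      "\<And>n. conformal_connected g \<rho> (z n) (y n) (r n)" "\<And>n. l n + r n \<le> b" "\<And>n. real n \<le> Im (y n)"
    by metis
  have pos: "0 \<le> l n" "0 \<le> r n" for n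
    using H(4,5) conformal_connected_nonneg by blast+
  have \<rho>R: "\<rho> \<le> R"
    using conformal_connected_imp_ge(2)[OF H(4)] H(1) by metis
  obtain B where B: "0 < B" "\<And>w. \<rho> \<le> Im w \<Longrightarrow> Im w \<le> R \<Longrightarrow> norm (exp (g w)) \<le> B"
    using periodic_strip_bounded[OF L, of \<rho> "\<lambda>w. exp (g w)" R] g per by (auto intro: continuous_intros)
  \<comment> \<open>The crossing point, moved into one period, together with the length spent so
    far: a bounded sequence, so Bolzano-Weierstrass applies to both at once.\<close>
  define s where "s n = (z n, l n)" for n
  have "bounded (range s)"
  proof (rule bounded_subset)
    show "bounded (cbox (Complex 0 R) (Complex L R) \<times> {0..b})"
      by (intro bounded_Times bounded_cbox bounded_closed_interval)
    have "l n \<le> b" for n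
      using H(6)[of n] pos[of n] by linarith
    then show "range s \<subseteq> cbox (Complex 0 R) (Complex L R) \<times> {0..b}"
      using H(1-3) pos by (auto simp: s_def in_cbox_complex_iff)
  qed
  then obtain \<sigma> f where f: "strict_mono f" "(s \<circ> f) \<longlonglongrightarrow> \<sigma>"
    using bounded_imp_convergent_subsequence by blast
  \<comment> \<open>A difference below this costs at most \<open>B\<close> times itself for the
    segment between two crossing points, and itself for the change in the length already spent:
    together \<epsilon>.\<close>
  have "0 < \<epsilon> / (B + 1)"
    using \<epsilon> B by simp
  then obtain N where N: "\<And>i j. i \<ge> N \<Longrightarrow> j \<ge> N \<Longrightarrow> dist (s (f i)) (s (f j)) < \<epsilon> / (B + 1)"
    using LIMSEQ_imp_Cauchy[OF f(2)] unfolding Cauchy_def o_def by metis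
  define n0 where "n0 = f N"
  let ?T = "of_int (- k n0) * L"
  \<comment> \<open>From the crossing point with index \<open>n0\<close> one passes along a segment
    to a later crossing point and continues on the curve of the latter; the remaining budget
    \<open>b - l n0\<close> is exceeded by at most \<epsilon>.\<close>
  have key: "\<exists>y' l'. real n \<le> Im y' \<and> conformal_connected g \<rho> (z n0) y' l' \<and> l' \<le> b - l n0 + \<epsilon>" for n :: nat
  proof -
    define j where "j = f (max n N)"
    have jn: "n \<le> j"
      using seq_suble[OF f(1), of "max n N"] by (simp add: j_def)
    have ds: "dist (s n0) (s j) < \<epsilon> / (B + 1)"
      using N[of N "max n N"] by (simp add: n0_def j_def)
    have dz: "dist (z n0) (z j) < \<epsilon> / (B + 1)" and dl: "dist (l n0) (l j) < \<epsilon> / (B + 1)"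
      using ds dist_fst_le[of "s n0" "s j"] dist_snd_le[of "s n0" "s j"] by (simp_all add: s_def)
    obtain h where h: "conformal_connected g \<rho> (z n0) (z j) h" "h \<le> B * dist (z n0) (z j)"
    proof (rule conformal_connected_line[OF g])
      have "closed_segment (z n0) (z j) \<subseteq> {w. \<rho> \<le> Im w} \<inter> {w. Im w \<le> R}"
        by (rule closed_segment_subset)
           (use H(1) \<rho>R in \<open>auto intro!: convex_Int convex_halfspace_Im_ge convex_halfspace_Im_le\<close>)
      then show "exp (g w) \<le> B" if "w \<in> closed_segment (z n0) (z j)" for w
        using B(2)[of w] that by auto
    qed (use H(1) \<rho>R in auto)
    have "B * dist (z n0) (z j) + dist (l n0) (l j) \<le> B * (\<epsilon> / (B + 1)) + \<epsilon> / (B + 1)"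
      using dz dl B(1) by (intro add_mono mult_left_mono) auto
    also have "\<dots> = (B + 1) * (\<epsilon> / (B + 1))"
      by (simp only: distrib_right mult_1_left)
    also have "\<dots> = \<epsilon>"
      using B(1) by simp
    finally have "h + r j \<le> b - l n0 + \<epsilon>"
      using h(2) H(6)[of j] by (auto simp: dist_real_def)
    then show ?thesis
      using conformal_connected_trans[OF h(1) H(5)] H(7)[of j] jn
      by (intro exI[of _ "y j"] exI[of _ "h + r j"]) auto
  qed
  show thesis
  proof (rule that)
    show "Im (z n0 + of_real ?T) = R"
      using H(1) by simp
    show "conformal_connected g \<rho> x (z n0 + of_real ?T) (l n0)"
      using conformal_connected_shift[OF H(4)[of n0] perk, of "- k n0"] by (simp add: algebra_simps)
    show "\<exists>y l'. real n \<le> Im y \<and> conformal_connected g \<rho> (z n0 + of_real ?T) y l' \<and> l' \<le> b - l n0 + \<epsilon>" for n :: nat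
    proof -
      obtain y' l' where y': "real n \<le> Im y'" "conformal_connected g \<rho> (z n0) y' l'" "l' \<le> b - l n0 + \<epsilon>"
        using key by blast
      then show ?thesis
        using conformal_connected_shift[OF y'(2) perk, of "- k n0"]
        by (intro exI[of _ "y' + of_real ?T"] exI[of _ l']) auto
    qed
  qed
qed

text \<open>The previous step is iterated with errors \<open>(1/2)^n\<close>, raising the height by
  exactly one each time. The remaining budget never becomes negative, so the total length is at most
  the initial budget plus 2.\<close>

lemma bounded_escape_imp_ray:
  assumes L: "0 < L" and g: "continuous_on {w. \<rho> \<le> Im w} g"
    and per: "\<And>w. \<rho> \<le> Im w \<Longrightarrow> g (w + of_real L) = g w"
    and esc: "\<And>n::nat. \<exists>y l. real n \<le> Im y \<and> conformal_connected g \<rho> x0 y l \<and> l \<le> b0"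
  obtains x l where "\<And>n::nat. Im (x n) = Im x0 + real n"
    "\<And>n. conformal_connected g \<rho> (x n) (x (Suc n)) (l n)" "summable l"
proof -
  define A where "A x b \<longleftrightarrow> (\<forall>n::nat. \<exists>y l. real n \<le> Im y \<and> conformal_connected g \<rho> x y l \<and> l \<le> b)" for x b
  have "\<exists>s. \<forall>n::nat. (A (fst (s n)) (snd (s n)) \<and> Im (fst (s n)) = Im x0 + real n) \<and>
     (\<exists>l. conformal_connected g \<rho> (fst (s n)) (fst (s (Suc n))) l \<and> snd (s (Suc n)) = snd (s n) - l + (1/2)^n)"
  proof (rule dependent_nat_choice)
    show "\<exists>s. A (fst s) (snd s) \<and> Im (fst s) = Im x0 + real 0"
      using esc by (intro exI[of _ "(x0, b0)"]) (simp add: A_def)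
    fix s :: "complex \<times> real" and n :: nat
    assume s: "A (fst s) (snd s) \<and> Im (fst s) = Im x0 + real n"
    obtain x' l where x': "Im x' = Im x0 + real (Suc n)" "conformal_connected g \<rho> (fst s) x' l"
      "\<And>k::nat. \<exists>y l'. real k \<le> Im y \<and> conformal_connected g \<rho> x' y l' \<and> l' \<le> snd s - l + (1/2)^n"
    proof (rule bounded_escape_step[OF L g per, of "fst s" "snd s" "Im x0 + real (Suc n)" "(1/2)^n"])
      show "\<exists>y l. real k \<le> Im y \<and> conformal_connected g \<rho> (fst s) y l \<and> l \<le> snd s" for k :: nat
        using s unfolding A_def by blast
      show "Im (fst s) \<le> Im x0 + real (Suc n)" using s by simp
    qed (use that in auto)
    then show "\<exists>t. (A (fst t) (snd t) \<and> Im (fst t) = Im x0 + real (Suc n)) \<and>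
       (\<exists>l. conformal_connected g \<rho> (fst s) (fst t) l \<and> snd t = snd s - l + (1/2)^n)"
      by (intro exI[of _ "(x', snd s - l + (1/2)^n)"]) (auto simp: A_def)
  qed
  then obtain s l where s: "\<And>n::nat. A (fst (s n)) (snd (s n))" "\<And>n. Im (fst (s n)) = Im x0 + real n"
     "\<And>n. conformal_connected g \<rho> (fst (s n)) (fst (s (Suc n))) (l n)" "\<And>n. snd (s (Suc n)) = snd (s n) - l n + (1/2)^n"
    by metis
  have l0: "0 \<le> l n" for n
    using s(3) conformal_connected_nonneg by blast
  have "0 \<le> snd (s n)" for n
    using s(1)[of n] conformal_connected_nonneg unfolding A_def by (meson order_trans)
  moreover have "(\<Sum>i<n. l i) = snd (s 0) - snd (s n) + (\<Sum>i<n. (1/2)^i)" for n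
    by (induction n) (auto simp: s(4))
  moreover have "(\<Sum>i<n. (1/2::real)^i) \<le> 2" for n
    using sum_le_suminf[of "\<lambda>i. (1/2::real)^i" "{..<n}"] suminf_geometric[of "1/2::real"]
    by (simp add: summable_geometric)
  ultimately have "(\<Sum>i<n. l i) \<le> snd (s 0) + 2" for n
    by (smt (verit))
  then have "summable l"
    using l0 by (intro summableI_nonneg_bounded[of l "snd (s 0) + 2"]) auto
  then show thesis
    using that[of "\<lambda>n. fst (s n)" l] s by blast
qed

section \<open>From the metric \<open>q_metric\<close> on pairs of reals to complex notation\<close>

definition real2_to_complex :: "real ^ 2 \<Rightarrow> complex" where
  "real2_to_complex x = Complex (x $ 1) (x $ 2)"

definition complex_to_real2 :: "complex \<Rightarrow> real ^ 2" where
  "complex_to_real2 w = vector [Re w, Im w]"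

lemma real2_to_complex_inverse [simp]: "complex_to_real2 (real2_to_complex x) = x"
  by (simp add: complex_to_real2_def real2_to_complex_def vec_eq_iff forall_2)

lemma complex_to_real2_inverse [simp]: "real2_to_complex (complex_to_real2 w) = w"
  by (simp add: complex_to_real2_def real2_to_complex_def)

lemma bounded_linear_real2_to_complex: "bounded_linear real2_to_complex"
  unfolding linear_conv_bounded_linear[symmetric]
  by (auto intro!: linearI simp: real2_to_complex_def complex_eq_iff)

lemma bounded_linear_complex_to_real2: "bounded_linear complex_to_real2"
  unfolding linear_conv_bounded_linear[symmetric]
  by (auto intro!: linearI simp: complex_to_real2_def vec_eq_iff forall_2)

lemma norm_real2_to_complex: "norm (real2_to_complex v) = norm v"
  by (simp add: real2_to_complex_def cmod_def norm_vec_def L2_set_def sum_2)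

lemma norm_complex_to_real2: "norm (complex_to_real2 w) = norm w"
  by (metis complex_to_real2_inverse norm_real2_to_complex)

lemma q_metric_speed:
  "sqrt (v \<bullet> (q_metric \<gamma> x *v v)) = exp (\<gamma> (x $ 1, x $ 2)) * norm v"
proof -
  have "v \<bullet> (q_metric \<gamma> x *v v) = (exp (\<gamma> (x $ 1, x $ 2)))\<^sup>2 * (v \<bullet> v)"
    by (simp add: q_metric_def Let_def inner_vec_def matrix_vector_mult_def sum_2 exp_double
        algebra_simps)
  then show ?thesis
    by (simp add: real_sqrt_mult norm_eq_sqrt_inner)
qed

lemma valid_path_bounded_linear:
  assumes f: "bounded_linear f" and c: "valid_path c"
  shows "valid_path (\<lambda>t. f (c t))"
    and "\<exists>S. finite S \<and> (\<forall>t\<in>{0..1} - S. vector_derivative (\<lambda>t. f (c t)) (at t) = f (vector_derivative c (at t)))"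
proof -
  obtain S where S: "continuous_on {0..1} c" "finite S" "c C1_differentiable_on {0..1} - S"
    using c unfolding valid_path_def piecewise_C1_differentiable_on_def by blast
  then obtain D where D: "\<And>x. x \<in> {0..1} - S \<Longrightarrow> (c has_vector_derivative D x) (at x)" "continuous_on ({0..1} - S) D"
    unfolding C1_differentiable_on_def by blast
  have fD: "((\<lambda>t. f (c t)) has_vector_derivative f (D x)) (at x)" if "x \<in> {0..1} - S" for x
    using bounded_linear.has_vector_derivative[OF f D(1)[OF that]] .
  have "(\<lambda>t. f (c t)) C1_differentiable_on {0..1} - S"
    unfolding C1_differentiable_on_def
    by (intro exI[of _ "\<lambda>x. f (D x)"] conjI ballI fD bounded_linear.continuous_on[OF f D(2)])
  then show "valid_path (\<lambda>t. f (c t))"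
    unfolding valid_path_def piecewise_C1_differentiable_on_def
    using S(2) bounded_linear.continuous_on[OF f S(1)] by blast
  show "\<exists>S. finite S \<and> (\<forall>t\<in>{0..1} - S. vector_derivative (\<lambda>t. f (c t)) (at t) = f (vector_derivative c (at t)))"
    using S(2) fD D(1) by (metis vector_derivative_at)
qed

lemma q_length_imp_conformal_connected:
  assumes c: "valid_path c" "path_image c \<subseteq> {x. x $ 2 \<ge> \<rho>}" "pathstart c = p" "pathfinish c = q"
    and l: "((\<lambda>s. let c' = vector_derivative c (at s) in sqrt (c' \<bullet> (q_metric \<gamma> (c s) *v c'))) has_integral l) {0..1}"
  shows "conformal_connected (\<lambda>w. \<gamma> (Re w, Im w)) \<rho> (real2_to_complex p) (real2_to_complex q) l"
proof -
  let ?f = "real2_to_complex"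
  note vp = valid_path_bounded_linear[OF bounded_linear_real2_to_complex c(1)]
  obtain S where S: "finite S" "\<And>t. t \<in> {0..1} - S \<Longrightarrow> vector_derivative (\<lambda>t. ?f (c t)) (at t) = ?f (vector_derivative c (at t))"
    using vp(2) by blast
  have "((\<lambda>s. exp (\<gamma> (Re (?f (c s)), Im (?f (c s)))) * norm (vector_derivative (\<lambda>t. ?f (c t)) (at s))) has_integral l) {0..1}"
    by (rule has_integral_spike_finite[OF S(1) _ l])
       (simp add: S(2) q_metric_speed norm_real2_to_complex Let_def, simp add: real2_to_complex_def)
  moreover have "path_image (\<lambda>t. ?f (c t)) \<subseteq> {w. \<rho> \<le> Im w}"
    using c(2) by (auto simp: path_image_def real2_to_complex_def)
  ultimately show ?thesis
    unfolding conformal_connected_def using vp(1) c(3,4)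
    by (intro exI[of _ "\<lambda>t. ?f (c t)"]) (auto simp: pathstart_def pathfinish_def)
qed

lemma conformal_connected_imp_q_length:
  assumes "conformal_connected (\<lambda>w. \<gamma> (Re w, Im w)) \<rho> p q l"
  shows "\<exists>c. valid_path c \<and> path_image c \<subseteq> {x. x $ 2 \<ge> \<rho>} \<and>
     pathstart c = complex_to_real2 p \<and> pathfinish c = complex_to_real2 q \<and>
     ((\<lambda>s. let c' = vector_derivative c (at s) in sqrt (c' \<bullet> (q_metric \<gamma> (c s) *v c'))) has_integral l) {0..1}"
proof -
  let ?f = "complex_to_real2"
  from assms obtain c where c: "valid_path c" "path_image c \<subseteq> {w. \<rho> \<le> Im w}"
     "pathstart c = p" "pathfinish c = q"
     "((\<lambda>s. exp (\<gamma> (Re (c s), Im (c s))) * norm (vector_derivative c (at s))) has_integral l) {0..1}"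
    unfolding conformal_connected_def by auto
  note vp = valid_path_bounded_linear[OF bounded_linear_complex_to_real2 c(1)]
  obtain S where S: "finite S" "\<And>t. t \<in> {0..1} - S \<Longrightarrow> vector_derivative (\<lambda>t. ?f (c t)) (at t) = ?f (vector_derivative c (at t))"
    using vp(2) by blast
  have "((\<lambda>s. let c' = vector_derivative (\<lambda>t. ?f (c t)) (at s) in sqrt (c' \<bullet> (q_metric \<gamma> (?f (c s)) *v c'))) has_integral l) {0..1}"
    by (rule has_integral_spike_finite[OF S(1) _ c(5)])
       (simp add: S(2) q_metric_speed norm_complex_to_real2 Let_def, simp add: complex_to_real2_def)
  moreover have "path_image (\<lambda>t. ?f (c t)) \<subseteq> {x. x $ 2 \<ge> \<rho>}"
    using c(2) by (auto simp: path_image_def complex_to_real2_def)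
  ultimately show ?thesis
    using vp(1) c(3,4)
    by (intro exI[of _ "\<lambda>t. ?f (c t)"]) (auto simp: pathstart_def pathfinish_def)
qed

text \<open>Without this, \<open>Inf\<close> in \<open>induced_dist\<close> could not be compared
  with the length of a single curve.\<close>

lemma bdd_below_q_lengths:
  "bdd_below {l. \<exists>c. valid_path c \<and> path_image c \<subseteq> R \<and> pathstart c = p \<and> pathfinish c - q \<in> \<Lambda> \<and>
     ((\<lambda>s. let c' = vector_derivative c (at s) in sqrt (c' \<bullet> (q_metric \<gamma> (c s) *v c'))) has_integral l) {0..1}}"
proof (rule bdd_belowI[of _ 0], clarify)
  fix l c
  assume "((\<lambda>s. let c' = vector_derivative c (at s) in sqrt (c' \<bullet> (q_metric \<gamma> (c s) *v c'))) has_integral l) {0..1}"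
  then show "0 \<le> l"
    by (rule has_integral_nonneg) (simp add: q_metric_speed)
qed

lemma induced_dist_le:
  assumes "conformal_connected (\<lambda>w. \<gamma> (Re w, Im w)) \<rho> p q l" and "0 \<in> \<Lambda>"
  shows "induced_dist (q_metric \<gamma>) \<Lambda> {x. x $ 2 \<ge> \<rho>} (complex_to_real2 p) (complex_to_real2 q) \<le> l"
  unfolding induced_dist_def
  by (rule cInf_lower[OF _ bdd_below_q_lengths]) (use conformal_connected_imp_q_length[OF assms(1)] assms(2) in auto)

text \<open>The assumption \<open>conn\<close> excludes the empty set, whose \<open>Inf\<close>
  means nothing as a distance. The end point is known only modulo \<Lambda>, so the conclusion keeps
  just its height.\<close>

lemma induced_dist_less_imp_conformal_connected:
  assumes "induced_dist (q_metric \<gamma>) \<Lambda> {x. x $ 2 \<ge> \<rho>} (complex_to_real2 p) (complex_to_real2 q) < e"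
    and \<Lambda>: "0 \<in> \<Lambda>" "\<And>v. v \<in> \<Lambda> \<Longrightarrow> v $ 2 = 0"
    and conn: "conformal_connected (\<lambda>w. \<gamma> (Re w, Im w)) \<rho> p q l0"
  obtains q' l where "Im q' = Im q" "conformal_connected (\<lambda>w. \<gamma> (Re w, Im w)) \<rho> p q' l" "l < e"
proof -
  let ?S = "{l. \<exists>c. valid_path c \<and> path_image c \<subseteq> {x. x $ 2 \<ge> \<rho>} \<and> pathstart c = complex_to_real2 p \<and>
     pathfinish c - complex_to_real2 q \<in> \<Lambda> \<and>
     ((\<lambda>s. let c' = vector_derivative c (at s) in sqrt (c' \<bullet> (q_metric \<gamma> (c s) *v c'))) has_integral l) {0..1}}"
  obtain c0 where c0: "valid_path c0 \<and> path_image c0 \<subseteq> {x. x $ 2 \<ge> \<rho>} \<and> pathstart c0 = complex_to_real2 p \<and>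
     pathfinish c0 = complex_to_real2 q \<and>
     ((\<lambda>s. let c' = vector_derivative c0 (at s) in sqrt (c' \<bullet> (q_metric \<gamma> (c0 s) *v c'))) has_integral l0) {0..1}"
    using conformal_connected_imp_q_length[OF conn] by blast
  then have "l0 \<in> ?S"
    using \<Lambda>(1) by (intro CollectI exI[of _ c0]) (simp only: diff_self simp_thms)
  then have "?S \<noteq> {}" by blast
  then obtain l where l: "l \<in> ?S" "l < e"
    using cInf_lessD[of ?S e] assms(1) unfolding induced_dist_def by blast
  then obtain c where c: "valid_path c" "path_image c \<subseteq> {x. x $ 2 \<ge> \<rho>}" "pathstart c = complex_to_real2 p"
     "pathfinish c - complex_to_real2 q \<in> \<Lambda>"
     "((\<lambda>s. let c' = vector_derivative c (at s) in sqrt (c' \<bullet> (q_metric \<gamma> (c s) *v c'))) has_integral l) {0..1}"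
    by blast
  have "Im (real2_to_complex (pathfinish c)) = Im q"
    using \<Lambda>(2)[OF c(4)] by (simp add: real2_to_complex_def complex_to_real2_def)
  then show thesis
    using that q_length_imp_conformal_connected[OF c(1-3) refl c(5)] l(2) by simp
qed

text \<open>The points \<open>x n\<close> form a Cauchy sequence that cannot converge: reaching a
  limit point at height \<open>a\<close> from above costs a fixed amount in the strip between
  \<open>a\<close> and \<open>a + 1/2\<close>, while the heights of \<open>x n\<close> are
  unbounded.\<close>

lemma q_complete_imp_no_finite_ray:
  assumes q: "q_complete_at_infinity L \<gamma>" and \<rho>: "0 < \<rho>" and L: "0 < L"
    and cont: "continuous_on {w. 0 < Im w} (\<lambda>w. \<gamma> (Re w, Im w))"
    and per: "\<And>z r. 0 < r \<Longrightarrow> \<gamma> (z + L, r) = \<gamma> (z, r)"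
    and x: "\<And>n::nat. Im (x n) = y0 + real n"
    and conn: "\<And>n. conformal_connected (\<lambda>w. \<gamma> (Re w, Im w)) \<rho> (x n) (x (Suc n)) (l n)"
    and l: "summable l"
  shows False
proof -
  let ?g = "\<lambda>w. \<gamma> (Re w, Im w)"
  let ?\<Lambda> = "{vector [of_int k * L, 0] | k. True} :: (real ^ 2) set"
  let ?d = "induced_dist (q_metric \<gamma>) ?\<Lambda> {x. x $ 2 \<ge> \<rho>}"
  have \<Lambda>: "0 \<in> ?\<Lambda>" "\<And>v. v \<in> ?\<Lambda> \<Longrightarrow> v $ 2 = 0"
    by (auto simp: vec_eq_iff forall_2 intro!: exI[of _ 0])
  have cont\<rho>: "continuous_on {w. \<rho> \<le> Im w} ?g"
    by (rule continuous_on_subset[OF cont]) (use \<rho> in auto)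
  define \<sigma> where "\<sigma> n = complex_to_real2 (x n)" for n
  have x\<rho>: "\<rho> \<le> Im (x n)" for n
    using conformal_connected_imp_ge[OF conn] by blast
  have "range \<sigma> \<subseteq> {x. x $ 2 \<ge> \<rho>}"
    using x\<rho> by (auto simp: \<sigma>_def complex_to_real2_def)
  moreover have "\<exists>N. \<forall>i\<ge>N. \<forall>j\<ge>N. ?d (\<sigma> i) (\<sigma> j) < e" if e: "e > 0" for e
  proof -
    obtain N where N: "\<And>m n. m \<ge> N \<Longrightarrow> norm (sum l {m..<n}) < e"
      using l e unfolding summable_Cauchy by blast
    have lt: "conformal_connected ?g \<rho> (x i) (x j) (sum l {i..<j})" if "i < j" for i j
      using conformal_connected_concat[of ?g \<rho> x l] conn that by blast
    have "?d (\<sigma> i) (\<sigma> j) < e" if ij: "i \<ge> N" "j \<ge> N" for i j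
    proof -
      consider "i < j" | "j < i" | "i = j" by linarith
      then show ?thesis
      proof cases
        case 1
        then show ?thesis
          using induced_dist_le[OF lt \<Lambda>(1), of i j] N[OF ij(1), of j] by (simp add: \<sigma>_def)
      next
        case 2
        then show ?thesis
          using induced_dist_le[OF conformal_connected_sym[OF lt] \<Lambda>(1), of j i] N[OF ij(2), of i] by (simp add: \<sigma>_def)
      next
        case 3
        \<comment> \<open>Even the vanishing of the distance from a point to itself needs a curve as
          witness: the degenerate segment.\<close>
        obtain h where "conformal_connected ?g \<rho> (x i) (x i) h" "h \<le> exp (?g (x i)) * dist (x i) (x i)"
          by (rule conformal_connected_line[OF cont\<rho> x\<rho> x\<rho>, of i i "exp (?g (x i))"]) auto
        then show ?thesis
          using induced_dist_le[OF _ \<Lambda>(1), of \<gamma> \<rho> "x i" "x i" h] 3 e by (simp add: \<sigma>_def)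
      qed
    qed
    then show ?thesis by blast
  qed
  ultimately obtain p where p: "p \<in> {x. x $ 2 \<ge> \<rho>}" "(\<lambda>i. ?d (\<sigma> i) p) \<longlonglongrightarrow> 0"
    using q \<rho> unfolding q_complete_at_infinity_def complete_quotient_def by blast
  define P where "P = real2_to_complex p"
  have P: "complex_to_real2 P = p" "\<rho> \<le> Im P"
    using p(1) by (auto simp: P_def) (simp add: real2_to_complex_def)
  define a where "a = Im P"
  have "?g (w + of_real L) = ?g w" if "\<rho> \<le> Im w" for w
    using per[of "Im w" "Re w"] that \<rho> by simp
  then obtain B where B: "0 < B" "\<And>w. \<rho> \<le> Im w \<Longrightarrow> Im w \<le> a + 1 \<Longrightarrow> norm (?g w) \<le> B"
    using periodic_strip_bounded[OF L cont\<rho>] by blast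
  \<comment> \<open>A continuous minorant of the conformal factor. The bound
    \<open>exp (- B)\<close> is available only up to height \<open>a + 1\<close>, so the function is
    tapered to zero there.\<close>
  define \<beta> where "\<beta> y = exp (- B) * max 0 (min 1 (a + 1 - y))" for y
  have \<beta>c: "continuous_on S \<beta>" for S
    unfolding \<beta>_def by (intro continuous_intros)
  have \<beta>le: "\<bar>\<beta> (Im w)\<bar> \<le> exp (?g w)" if "\<rho> \<le> Im w" for w
  proof (cases "Im w \<le> a + 1")
    case True
    have "\<bar>\<beta> (Im w)\<bar> \<le> exp (- B) * 1"
      unfolding \<beta>_def abs_mult by (intro mult_mono) auto
    also have "\<dots> \<le> exp (?g w)"
      using B(2)[OF that True] by auto
    finally show ?thesis .
  qed (simp add: \<beta>_def)
  define k where "k = integral {a..a + 1/2} \<beta>"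
  have "integral {a..a + 1/2} (\<lambda>y. exp (- B) * (1/2)) \<le> k"
    unfolding k_def
    by (rule Henstock_Kurzweil_Integration.integral_le)
       (auto intro!: integrable_continuous_real \<beta>c simp: \<beta>_def)
  moreover have "integral {a..a + 1/2} (\<lambda>y. exp (- B) * (1/2)) = exp (- B) / 4"
    by simp
  ultimately have k: "0 < k"
    using exp_gt_zero[of "- B"] by linarith
  obtain N1 :: nat where N1: "a + 1 - y0 \<le> real N1"
    using real_arch_simple by blast
  obtain N2 where N2: "\<And>i. i \<ge> N2 \<Longrightarrow> norm (?d (\<sigma> i) p) < k"
    using LIMSEQ_D[OF p(2) k] by auto
  define i where "i = max N1 N2"
  have xi: "a + 1 \<le> Im (x i)"
    using N1 by (simp add: i_def x)
  \<comment> \<open>Serves to exhibit some curve from \<open>x i\<close> to the limit point, so that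
    the distance is an infimum over a nonempty set.\<close>
  obtain M where M: "\<And>w. w \<in> closed_segment (x i) P \<Longrightarrow> exp (?g w) \<le> M"
  proof -
    have "closed_segment (x i) P \<subseteq> {w. \<rho> \<le> Im w}"
      by (rule closed_segment_subset) (use x\<rho> P(2) in \<open>auto simp: convex_halfspace_Im_ge\<close>)
    then have "compact ((\<lambda>w. exp (?g w)) ` closed_segment (x i) P)"
      by (intro compact_continuous_image continuous_on_exp continuous_on_subset[OF cont\<rho>]) auto
    then show thesis
      using that by (force dest!: compact_imp_bounded simp: bounded_iff)
  qed
  obtain l0 where l0: "conformal_connected ?g \<rho> (x i) P l0"
    using conformal_connected_line[OF cont\<rho> x\<rho> P(2) M] by blast
  have "?d (\<sigma> i) p < k"
    using N2[of i] by (simp add: i_def)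
  then have "?d (complex_to_real2 (x i)) (complex_to_real2 P) < k"
    by (simp add: \<sigma>_def P(1))
  then obtain q' h where q': "Im q' = Im P" "conformal_connected ?g \<rho> (x i) q' h" "h < k"
    by (rule induced_dist_less_imp_conformal_connected[OF _ \<Lambda> l0])
  have "k \<le> integral {Im q'..Im (x i)} \<beta>"
    unfolding k_def q'(1) a_def[symmetric]
    by (rule integral_subset_le) (use xi in \<open>auto intro!: integrable_continuous_real \<beta>c simp: \<beta>_def\<close>)
  also have "\<dots> \<le> h"
    by (rule conformal_connected_lower_bound[OF conformal_connected_sym[OF q'(2)] \<beta>c \<beta>le])
       (use q'(1) xi in \<open>auto simp: a_def\<close>)
  finally show False
    using q'(3) by simp
qed

section \<open>The second variation of length\<close>

lemma norm_exp_minus_quadratic_le: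
  fixes q :: complex
  assumes "norm q \<le> 1/4"
  shows "norm (exp q - (1 + q + q\<^sup>2/2)) \<le> norm q ^ 3"
proof -
  have "norm (exp q - (\<Sum>i\<le>2. q ^ i / fact i)) \<le> exp \<bar>Re q\<bar> * norm q ^ Suc 2 / fact 2"
    by (rule Taylor_exp)
  moreover have "exp \<bar>Re q\<bar> \<le> 2"
  proof -
    have "\<bar>Re q\<bar> \<le> 1/2"
      using abs_Re_le_cmod[of q] assms by linarith
    then show ?thesis
      using exp_bound_half[of "\<bar>Re q\<bar>"] by simp
  qed
  then have "exp \<bar>Re q\<bar> * norm q ^ Suc 2 / fact 2 \<le> 2 * norm q ^ Suc 2 / fact 2"
    by (intro divide_right_mono mult_right_mono) auto
  ultimately show ?thesis
    by (simp add: eval_nat_numeral algebra_simps)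
qed

lemma norm_mult_le:
  fixes x y :: complex
  assumes "norm x \<le> a" "norm y \<le> b"
  shows "norm (x * y) \<le> a * b"
  unfolding norm_mult using assms by (intro mult_mono) (auto intro: order_trans[OF norm_ge_zero])

text \<open>Here \<open>A\<close> and \<open>x1\<close> count as first order in \<open>b\<close>,
  \<open>q2\<close> and \<open>x2\<close> as second order; everything higher goes into the cubic
  remainder.\<close>

lemma exp_times_expansion:
  fixes A x1 q2 x2 :: complex
  assumes b: "0 \<le> b" "b \<le> 1/8" and A: "norm A \<le> b" and x1: "norm x1 \<le> b"
    and q2: "norm q2 \<le> b\<^sup>2" and x2: "norm x2 \<le> b\<^sup>2"
  shows "norm (exp (A + q2) * (1 + (x1 + x2)) - (1 + (A + x1) + (q2 + x2 + A * x1 + A\<^sup>2/2))) \<le> 40 * b^3"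
proof -
  let ?q = "A + q2" let ?x = "x1 + x2"
  have b2: "b\<^sup>2 \<le> b" "b^4 \<le> b^3" "b^5 \<le> b^3"
    using b by (auto simp: power2_eq_square mult_left_le intro!: power_decreasing)
  have q: "norm ?q \<le> 2 * b"
    using norm_triangle_ineq[of A q2] A q2 b2 by linarith
  have x: "norm ?x \<le> 2 * b"
    using norm_triangle_ineq[of x1 x2] x1 x2 b2 by linarith
  have "norm (exp ?q - (1 + ?q + ?q\<^sup>2/2)) \<le> norm ?q ^ 3"
    using q b by (intro norm_exp_minus_quadratic_le) linarith
  also have "\<dots> \<le> (2 * b) ^ 3"
    using q by (intro power_mono) auto
  finally have e: "norm (exp ?q - (1 + ?q + ?q\<^sup>2/2)) \<le> 8 * b ^ 3"
    by (simp add: power_mult_distrib)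
  have "norm (1 + ?x) \<le> 2"
    using norm_triangle_ineq[of 1 ?x] x b by simp
  from norm_mult_le[OF e this]
  have E1: "norm ((exp ?q - (1 + ?q + ?q\<^sup>2/2)) * (1 + ?x)) \<le> 16 * b ^ 3"
    by simp
  have n2: "norm (A * q2) \<le> b^3" "norm (A * x2) \<le> b^3" "norm (x1 * q2) \<le> b^3"
     "norm (q2 * q2) \<le> b^4" "norm (q2 * x2) \<le> b^4"
    using norm_mult_le[OF A q2] norm_mult_le[OF A x2] norm_mult_le[OF x1 q2]
          norm_mult_le[OF q2 q2] norm_mult_le[OF q2 x2]
    by (simp_all add: eval_nat_numeral mult_ac)
  have n3: "norm (?q * ?q) \<le> 4 * b\<^sup>2"
    using norm_mult_le[OF q q] by (simp add: power2_eq_square)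
  have n4: "norm (?q * ?q * ?x) \<le> 8 * b^3"
    using norm_mult_le[OF n3 x] by (simp add: eval_nat_numeral mult_ac)
  have split: "exp ?q * (1 + ?x) - (1 + (A + x1) + (q2 + x2 + A * x1 + A\<^sup>2/2)) =
     (exp ?q - (1 + ?q + ?q\<^sup>2/2)) * (1 + ?x) +
     (A * q2 + q2 * q2 / 2 + A * x2 + x1 * q2 + q2 * x2 + ?q * ?q * ?x / 2)"
    by (simp add: field_simps power2_eq_square)
  have "norm (A * q2 + q2 * q2 / 2 + A * x2 + x1 * q2 + q2 * x2 + ?q * ?q * ?x / 2)
     \<le> norm (A * q2) + norm (q2 * q2) / 2 + norm (A * x2) + norm (x1 * q2) + norm (q2 * x2) + norm (?q * ?q * ?x) / 2"
    by (intro norm_triangle_le add_mono) (simp_all add: norm_divide)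
  also have "\<dots> \<le> 24 * b ^ 3"
    using n2 n4 b2 zero_le_power[OF b(1), of 3] by linarith
  finally show ?thesis
    unfolding split using E1 by (intro norm_triangle_le) linarith
qed

text \<open>To be read with \<open>A = p v\<close>, \<open>S = s v^2\<close>,
  \<open>k1 = \<kappa> |v|^2\<close> and \<open>y\<close> the derivative of the moving field
  relative to the tangent vector. In the product of conformal factor and relative velocity all
  second-order terms cancel except \<open>(k1 - k2)/2\<close>, whose real part is nonpositive: this
  is where nonnegative curvature enters.\<close>

lemma second_variation_factor_le:
  fixes A y S k2 :: complex and k1 D e a :: real
  assumes a: "0 \<le> a" "a \<le> 1/16" and A: "norm A \<le> a" and y: "norm y \<le> a" and S: "norm S \<le> a\<^sup>2"
    and k: "k1 \<le> 0" "\<bar>k1\<bar> \<le> a\<^sup>2" "norm k2 \<le> \<bar>k1\<bar>"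
    and D: "D \<le> Re (A - A\<^sup>2/2 + S/2) + k1/2 + e" and e: "0 \<le> e" "e \<le> 1/2"
  shows "exp D * norm (1 + y - A - A * y + A\<^sup>2 - S/2 - k2/2) \<le> 1 + Re y + (norm y)\<^sup>2/2 + 400 * a^3 + 8 * e"
proof -
  define q2 where "q2 = - A\<^sup>2/2 + S/2 + of_real k1/2"
  define x1 where "x1 = y - A"
  define x2 where "x2 = - A * y + A\<^sup>2 - S/2 - k2/2"
  define \<beta> where "\<beta> = (of_real k1 - k2)/2"
  have A2: "norm (A\<^sup>2) \<le> a\<^sup>2" and Ay: "norm (A * y) \<le> a\<^sup>2"
    using norm_mult_le[OF A A] norm_mult_le[OF A y] by (simp_all add: power2_eq_square)
  have q2: "norm q2 \<le> (2 * a)\<^sup>2"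
  proof -
    have "norm q2 \<le> norm (A\<^sup>2)/2 + norm S/2 + \<bar>k1\<bar>/2"
      unfolding q2_def by (intro norm_triangle_le add_mono) (simp_all add: norm_divide)
    also have "\<dots> \<le> (2 * a)\<^sup>2"
      using A2 S k by (simp add: power_mult_distrib)
    finally show ?thesis .
  qed
  have x2: "norm x2 \<le> (2 * a)\<^sup>2"
  proof -
    have "norm x2 \<le> norm (A * y) + norm (A\<^sup>2) + norm S/2 + norm k2/2"
      unfolding x2_def by (intro norm_triangle_le norm_triangle_le_diff add_mono) (simp_all add: norm_divide)
    also have "\<dots> \<le> (2 * a)\<^sup>2"
      using A2 Ay S k by (simp add: power_mult_distrib)
    finally show ?thesis .
  qed
  have x1: "norm x1 \<le> 2 * a"
    unfolding x1_def using norm_triangle_ineq4[of y A] A y by linarith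
  have "norm (exp (A + q2) * (1 + (x1 + x2)) - (1 + (A + x1) + (q2 + x2 + A * x1 + A\<^sup>2/2))) \<le> 40 * (2 * a)^3"
    by (rule exp_times_expansion) (use a A x1 x2 q2 in auto)
  \<comment> \<open>The cancellation: parallel transport and the geodesic correction remove
    \<open>A\<close> and \<open>S\<close> altogether.\<close>
  moreover have "1 + (A + x1) + (q2 + x2 + A * x1 + A\<^sup>2/2) = 1 + y + \<beta>"
    by (simp add: q2_def x1_def x2_def \<beta>_def power2_eq_square algebra_simps diff_divide_distrib add_divide_distrib)
  ultimately have m: "norm (exp (A + q2) * (1 + (x1 + x2))) \<le> norm (1 + y + \<beta>) + 320 * a^3"
    using norm_triangle_sub[of "exp (A + q2) * (1 + (x1 + x2))" "1 + y + \<beta>"] by (simp add: power_mult_distrib)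
  have \<beta>: "norm \<beta> \<le> a\<^sup>2" "Re \<beta> \<le> 0"
  proof -
    have "norm \<beta> \<le> (\<bar>k1\<bar> + norm k2)/2"
      unfolding \<beta>_def using norm_triangle_ineq4[of "of_real k1" k2] by (simp add: norm_divide)
    also have "\<dots> \<le> (a\<^sup>2 + a\<^sup>2)/2"
      using k by (intro divide_right_mono add_mono) auto
    finally show "norm \<beta> \<le> a\<^sup>2" by simp
    show "Re \<beta> \<le> 0"
      unfolding \<beta>_def using abs_Re_le_cmod[of k2] k by simp
  qed
  \<comment> \<open>The square root is replaced by its tangent at 1, since
    \<open>(n - 1)\<^sup>2\<close> is nonnegative for the norm \<open>n\<close>.\<close>
  have "2 * norm (1 + y + \<beta>) \<le> 1 + (norm (1 + y + \<beta>))\<^sup>2"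
    using zero_le_power2[of "norm (1 + y + \<beta>) - 1"] by (simp add: power2_diff)
  also have "(norm (1 + y + \<beta>))\<^sup>2 = 1 + 2 * Re (y + \<beta>) + (norm (y + \<beta>))\<^sup>2"
    unfolding cmod_power2 by (simp add: power2_eq_square algebra_simps)
  finally have "norm (1 + y + \<beta>) \<le> 1 + Re (y + \<beta>) + (norm (y + \<beta>))\<^sup>2/2"
    by simp
  moreover have "(norm (y + \<beta>))\<^sup>2 \<le> (norm y)\<^sup>2 + 3 * a^3"
  proof -
    have "(norm (y + \<beta>))\<^sup>2 \<le> (norm y + a\<^sup>2)\<^sup>2"
      using norm_triangle_ineq[of y \<beta>] \<beta> by (intro power_mono) auto
    also have "\<dots> = (norm y)\<^sup>2 + 2 * norm y * a\<^sup>2 + a\<^sup>2 * a\<^sup>2"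
      by (simp add: power2_sum)
    also have "\<dots> \<le> (norm y)\<^sup>2 + 2 * a * a\<^sup>2 + a * a\<^sup>2"
      using y a by (intro add_mono mult_right_mono mult_left_mono) (auto simp: power2_eq_square mult_left_le)
    finally show ?thesis by (simp add: eval_nat_numeral)
  qed
  ultimately have n: "norm (1 + y + \<beta>) \<le> 1 + Re y + (norm y)\<^sup>2/2 + 2 * a^3"
    using \<beta>(2) zero_le_power[OF a(1), of 3] unfolding plus_complex.sel by linarith
  define Z where "Z = 1 + Re y + (norm y)\<^sup>2/2 + 322 * a^3"
  have Z: "norm (exp (A + q2) * (1 + (x1 + x2))) \<le> Z"
    unfolding Z_def using m n by simp
  \<comment> \<open>A rough bound that turns the factor \<open>exp e \<le> 1 + 2 * e\<close> into
    the additive error \<open>8 * e\<close>.\<close>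
  have "Z \<le> 4"
  proof -
    have "a^3 \<le> (1/16)^3" using a by (intro power_mono) auto
    moreover have "(norm y)\<^sup>2 \<le> 1\<^sup>2" using y a by (intro power_mono) auto
    moreover have "Re y \<le> 1" using y a complex_Re_le_cmod[of y] by linarith
    ultimately show ?thesis unfolding Z_def power_divide by simp
  qed
  have "exp D \<le> exp (Re (A + q2)) * exp e"
    unfolding exp_add[symmetric] using D by (simp add: q2_def)
  then have "exp D * norm (1 + (x1 + x2)) \<le> (exp (Re (A + q2)) * exp e) * norm (1 + (x1 + x2))"
    by (intro mult_right_mono) auto
  also have "\<dots> = exp e * norm (exp (A + q2) * (1 + (x1 + x2)))"
    by (simp add: norm_mult)
  also have "\<dots> \<le> exp e * Z"
    using Z by (intro mult_left_mono) auto
  also have "\<dots> \<le> (1 + 2 * e) * Z"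
  proof (rule mult_right_mono)
    have "e\<^sup>2 \<le> e"
      using e by (simp add: power2_eq_square mult_left_le)
    then show "exp e \<le> 1 + 2 * e"
      using exp_bound[of e] e by linarith
    show "0 \<le> Z"
      using order_trans[OF norm_ge_zero Z] .
  qed
  also have "\<dots> \<le> Z + 8 * e"
    using \<open>Z \<le> 4\<close> e mult_left_mono[of Z 4 e] by (simp add: algebra_simps)
  also have "\<dots> \<le> 1 + Re y + (norm y)\<^sup>2/2 + 400 * a^3 + 8 * e"
    unfolding Z_def using a by simp
  finally show ?thesis
    by (simp add: x1_def x2_def algebra_simps)
qed

text \<open>Uniform continuity on a box slightly larger than one period of the strip;
  \<open>\<delta> \<le> a/2\<close> keeps displaced points in the half-plane.\<close>

lemma periodic_strip_uniformly_continuous: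
  fixes f :: "complex \<Rightarrow> 'a::real_normed_vector"
  assumes L: "0 < L" and f: "continuous_on {w. 0 < Im w} f"
    and per: "\<And>w. 0 < Im w \<Longrightarrow> f (w + of_real L) = f w"
    and a: "0 < a" and \<epsilon>: "0 < \<epsilon>"
  obtains \<delta> where "0 < \<delta>" "\<delta> \<le> a/2"
    "\<And>w u. a \<le> Im w \<Longrightarrow> Im w \<le> b \<Longrightarrow> norm u \<le> \<delta> \<Longrightarrow> norm (f (w + u) - f w) \<le> \<epsilon>"
proof -
  let ?K = "cbox (Complex (-1) (a/2)) (Complex (L + 1) (b + 1))"
  have per': "f (w + of_real (of_int k * L)) = f w" if "0 < Im w" for w k
    using periodic_of_int[of "Im w" f L w k] per that by (meson order_refl less_le_trans)
  have "uniformly_continuous_on ?K f"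
    by (intro compact_uniformly_continuous continuous_on_subset[OF f] compact_cbox)
       (use a in \<open>auto simp: in_cbox_complex_iff\<close>)
  then obtain d where d: "0 < d" "\<And>x y. x \<in> ?K \<Longrightarrow> y \<in> ?K \<Longrightarrow> dist y x < d \<Longrightarrow> dist (f y) (f x) < \<epsilon>"
    unfolding uniformly_continuous_on_def using \<epsilon> by metis
  define \<delta> where "\<delta> = min (d/2) (min (a/2) 1)"
  show thesis
  proof
    show "0 < \<delta>" "\<delta> \<le> a/2"
      using d a by (auto simp: \<delta>_def)
    fix w u :: complex assume w: "a \<le> Im w" "Im w \<le> b" and u: "norm u \<le> \<delta>"
    have ru: "\<bar>Re u\<bar> \<le> \<delta>" "\<bar>Im u\<bar> \<le> \<delta>"
      using abs_Re_le_cmod[of u] abs_Im_le_cmod[of u] u by linarith+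
    have \<delta>: "\<delta> \<le> 1" "\<delta> \<le> a/2" "\<delta> < d"
      using d(1) by (auto simp: \<delta>_def)
    obtain k :: int where k: "0 \<le> Re w + of_int k * L" "Re w + of_int k * L \<le> L"
      using ex_shift_to_fundamental_domain[OF L] .
    let ?w = "w + of_real (of_int k * L)"
    have "dist (f (?w + u)) (f ?w) < \<epsilon>"
    proof (rule d(2))
      show "?w \<in> ?K" using k w a by (auto simp: in_cbox_complex_iff)
      show "?w + u \<in> ?K" using k w a ru \<delta> by (auto simp: in_cbox_complex_iff)
      show "dist (?w + u) ?w < d" using u \<delta> by (simp add: dist_norm)
    qed
    moreover have "f (?w + u) = f (w + u)"
      using per'[of "w + u" k] w ru \<delta> a by (simp add: algebra_simps)
    moreover have "f ?w = f w"
      using per'[of w k] w a by simp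
    ultimately show "norm (f (w + u) - f w) \<le> \<epsilon>"
      by (simp add: dist_norm)
  qed
qed

text \<open>A conformal metric \<open>e\<^sup>2\<^sup>g \<bar>dw\<bar>\<^sup>2\<close> of nonnegative curvature on a half-cylinder; \<open>p = 2 \<partial>g/\<partial>w\<close>,
  \<open>s = \<partial>p/\<partial>w\<close> and \<open>\<kappa> = \<Delta>g/2\<close>.\<close>

locale conformal_superharmonic =
  fixes L :: real and g :: "complex \<Rightarrow> real" and p s :: "complex \<Rightarrow> complex" and \<kappa> :: "complex \<Rightarrow> real"
  assumes L_pos: "0 < L"
    and g_deriv: "\<And>w. 0 < Im w \<Longrightarrow> (g has_derivative (\<lambda>v. Re (p w * v))) (at w)"
    and p_deriv: "\<And>w. 0 < Im w \<Longrightarrow> (p has_derivative (\<lambda>v. s w * v + of_real (\<kappa> w) * cnj v)) (at w)"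
    and s_cont: "continuous_on {w. 0 < Im w} s"
    and \<kappa>_cont: "continuous_on {w. 0 < Im w} \<kappa>"
    and g_per: "\<And>w. 0 < Im w \<Longrightarrow> g (w + of_real L) = g w"
    and p_per: "\<And>w. 0 < Im w \<Longrightarrow> p (w + of_real L) = p w"
    and s_per: "\<And>w. 0 < Im w \<Longrightarrow> s (w + of_real L) = s w"
    and \<kappa>_per: "\<And>w. 0 < Im w \<Longrightarrow> \<kappa> (w + of_real L) = \<kappa> w"
    and \<kappa>_nonpos: "\<And>w. 0 < Im w \<Longrightarrow> \<kappa> w \<le> 0"
begin

lemma g_cont: "continuous_on {w. 0 < Im w} g"
  by (intro continuous_at_imp_continuous_on ballI has_derivative_continuous) (auto intro: g_deriv)

lemma p_cont: "continuous_on {w. 0 < Im w} p"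
  by (intro continuous_at_imp_continuous_on ballI has_derivative_continuous) (auto intro: p_deriv)

text \<open>Taylor's formula with Lagrange remainder along a segment; uniform continuity of the
  second derivatives \<open>s\<close> and \<kappa> makes the error uniform over the strip.\<close>

lemma taylor_uniform:
  assumes a: "0 < a" and \<epsilon>: "0 < \<epsilon>"
  obtains \<delta> where "0 < \<delta>" "\<delta> \<le> a/2"
    "\<And>w u. a \<le> Im w \<Longrightarrow> Im w \<le> b \<Longrightarrow> norm u \<le> \<delta> \<Longrightarrow>
       g (w + u) \<le> g w + Re (p w * u) + Re (s w * u\<^sup>2)/2 + \<kappa> w * (norm u)\<^sup>2/2 + \<epsilon> * (norm u)\<^sup>2"
proof -
  obtain \<delta>1 where \<delta>1: "0 < \<delta>1" "\<delta>1 \<le> a/2"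
    "\<And>w u. a \<le> Im w \<Longrightarrow> Im w \<le> b \<Longrightarrow> norm u \<le> \<delta>1 \<Longrightarrow> norm (s (w + u) - s w) \<le> \<epsilon>"
    using periodic_strip_uniformly_continuous[OF L_pos s_cont s_per a \<epsilon>] by blast
  obtain \<delta>2 where \<delta>2: "0 < \<delta>2" "\<delta>2 \<le> a/2"
    "\<And>w u. a \<le> Im w \<Longrightarrow> Im w \<le> b \<Longrightarrow> norm u \<le> \<delta>2 \<Longrightarrow> norm (\<kappa> (w + u) - \<kappa> w) \<le> \<epsilon>"
    using periodic_strip_uniformly_continuous[OF L_pos \<kappa>_cont \<kappa>_per a \<epsilon>] by blast
  show thesis
  proof
    show "0 < min \<delta>1 \<delta>2" "min \<delta>1 \<delta>2 \<le> a/2" using \<delta>1 \<delta>2 by auto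
    fix w u :: complex assume w: "a \<le> Im w" "Im w \<le> b" and u: "norm u \<le> min \<delta>1 \<delta>2"
    have tu: "norm (of_real t * u) \<le> norm u" if "0 \<le> t" "t \<le> 1" for t :: real
      using that by (simp add: norm_mult mult_left_le_one_le)
    have pos: "0 < Im (w + of_real t * u)" if "0 \<le> t" "t \<le> 1" for t :: real
    proof -
      have "\<bar>Im (of_real t * u)\<bar> \<le> a/2"
        using abs_Im_le_cmod[of "of_real t * u"] tu[OF that] u \<delta>1(2) by linarith
      then show ?thesis
        using w a unfolding plus_complex.sel by linarith
    qed
    \<comment> \<open>\<open>F m\<close> is the derivative of order \<open>m\<close> of
      \<open>g\<close> along the segment from \<open>w\<close> to \<open>w + u\<close>, for orders
      0, 1 and 2.\<close>
    define F where "F m t = (if m = 0 then g (w + of_real t * u) else if m = 1 then Re (p (w + of_real t * u) * u)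
       else Re (s (w + of_real t * u) * u\<^sup>2) + \<kappa> (w + of_real t * u) * (norm u)\<^sup>2)" for m :: nat and t :: real
    have line: "((\<lambda>t. w + of_real t * u) has_derivative (\<lambda>h. of_real h * u)) (at t)" for t
      by (auto intro!: derivative_eq_intros)
    have "DERIV (F m) t :> F (Suc m) t" if m: "m < 2" "0 \<le> t" "t \<le> 1" for m t
    proof -
      consider "m = 0" | "m = 1" using m(1) by linarith
      then show ?thesis
      proof cases
        case 1
        have "((\<lambda>t. g (w + of_real t * u)) has_derivative (\<lambda>h. Re (p (w + of_real t * u) * (of_real h * u)))) (at t)"
          using has_derivative_compose[OF line g_deriv[OF pos[OF m(2,3)]]] .
        then show ?thesis
          unfolding has_field_derivative_def F_def using 1
          by (simp add: fun_eq_iff algebra_simps has_derivative_eq_rhs)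
      next
        case 2
        have "((\<lambda>t. p (w + of_real t * u)) has_derivative
          (\<lambda>h. s (w + of_real t * u) * (of_real h * u) + of_real (\<kappa> (w + of_real t * u)) * cnj (of_real h * u))) (at t)"
          using has_derivative_compose[OF line p_deriv[OF pos[OF m(2,3)]]] .
        from has_derivative_Re[OF has_derivative_mult_left[OF this, of u]]
        have "((\<lambda>t. Re (p (w + of_real t * u) * u)) has_derivative
          (\<lambda>h. h * (Re (s (w + of_real t * u) * u\<^sup>2) + \<kappa> (w + of_real t * u) * (norm u)\<^sup>2))) (at t)"
          by (rule has_derivative_eq_rhs)
             (simp add: fun_eq_iff cmod_power2 power2_eq_square[of u] power2_eq_square[of "Re u"]
               power2_eq_square[of "Im u"] algebra_simps)
        then show ?thesis
          unfolding has_field_derivative_def F_def using 2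
          by (simp add: mult_commute_abs)
      qed
    qed
    then obtain t where t: "0 < t" "t < 1" "F 0 1 = (\<Sum>m<2. F m 0 / fact m * 1 ^ m) + F 2 t / fact 2 * 1 ^ 2"
      using Maclaurin[of 1 2 F "F 0"] by auto
    have tt: "norm (of_real t * u) \<le> \<delta>1" "norm (of_real t * u) \<le> \<delta>2"
      using tu[of t] t u by auto
    have "norm ((s (w + of_real t * u) - s w) * u\<^sup>2) \<le> \<epsilon> * (norm u)\<^sup>2"
      using \<delta>1(3)[OF w tt(1)] by (simp add: norm_mult norm_power mult_right_mono)
    then have "Re (s (w + of_real t * u) * u\<^sup>2) \<le> Re (s w * u\<^sup>2) + \<epsilon> * (norm u)\<^sup>2"
      using complex_Re_le_cmod[of "(s (w + of_real t * u) - s w) * u\<^sup>2"] by (simp add: left_diff_distrib)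
    moreover have "\<kappa> (w + of_real t * u) \<le> \<kappa> w + \<epsilon>"
      using \<delta>2(3)[OF w tt(2)] by (simp add: abs_le_iff)
    then have "\<kappa> (w + of_real t * u) * (norm u)\<^sup>2 \<le> (\<kappa> w + \<epsilon>) * (norm u)\<^sup>2"
      by (intro mult_right_mono) auto
    ultimately have "F 2 t / 2 \<le> Re (s w * u\<^sup>2)/2 + \<kappa> w * (norm u)\<^sup>2/2 + \<epsilon> * (norm u)\<^sup>2"
      unfolding distrib_right by (simp add: F_def del: times_complex.sel)
    moreover have "g (w + u) = g w + Re (p w * u) + F 2 t / 2"
      using t(3) by (simp add: F_def eval_nat_numeral)
    ultimately show "g (w + u) \<le> g w + Re (p w * u) + Re (s w * u\<^sup>2)/2 + \<kappa> w * (norm u)\<^sup>2/2 + \<epsilon> * (norm u)\<^sup>2"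
      by linarith
  qed
qed

text \<open>With \<open>w\<close> on a curve with velocity \<open>\<tau>\<close> and \<open>X\<close> parallel along it, the curve moved by the field \<open>d \<phi> X\<close>
  passes through \<open>w + (v - p v\<^sup>2/2)\<close>, and the norm in the estimate is that of its velocity
  if \<open>\<phi>' = - e\<^sup>g \<bar>\<tau>\<bar>/l\<close>.\<close>

definition variation_estimate :: "real \<Rightarrow> real \<Rightarrow> real \<Rightarrow> real \<Rightarrow> real \<Rightarrow> real \<Rightarrow> bool" where
  "variation_estimate a b l0 \<epsilon> \<eta> d0 \<longleftrightarrow> (\<forall>d \<phi> l. \<forall>w \<tau> X v. \<bar>d\<bar> \<le> d0 \<longrightarrow> a \<le> Im w \<longrightarrow> Im w \<le> b \<longrightarrow>
     norm X = exp (- g w) \<longrightarrow> \<bar>\<phi>\<bar> \<le> 1 \<longrightarrow> l0 \<le> l \<longrightarrow> v = of_real (d * \<phi>) * X \<longrightarrow>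
       norm (v - p w * v\<^sup>2/2) \<le> \<eta> \<and>
       exp (g (w + (v - p w * v\<^sup>2/2))) *
         norm (\<tau> + (1 - p w * v) * (of_real (d * (- exp (g w) * norm \<tau> / l)) * X - p w * \<tau> * v)
            - (s w * \<tau> + of_real (\<kappa> w) * cnj \<tau>) * v\<^sup>2/2)
       \<le> exp (g w) * norm \<tau> * (1 + d * Re (of_real (- exp (g w) * norm \<tau> / l) * X / \<tau>) + d\<^sup>2/(2 * l\<^sup>2) + \<epsilon> * d\<^sup>2))"

text \<open>By periodicity all coefficients are bounded on the strip, so one \<open>d0\<close>
  serves every point, tangent vector and field, independently of the curve.\<close>

lemma ex_variation_estimate:
  assumes a: "0 < a" and l0: "0 < l0" and \<epsilon>: "0 < \<epsilon>" and \<eta>: "0 < \<eta>"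
  obtains d0 where "0 < d0" "variation_estimate a b l0 \<epsilon> \<eta> d0"
proof -
  have sub: "{w. a \<le> Im w} \<subseteq> {w. 0 < Im w}" using a by auto
  obtain B1 where B1: "0 < B1" "\<And>w. a \<le> Im w \<Longrightarrow> Im w \<le> b \<Longrightarrow> norm (p w) \<le> B1"
    by (rule periodic_strip_bounded[OF L_pos continuous_on_subset[OF p_cont sub], of b]) (use p_per a in auto)
  obtain B2 where B2: "0 < B2" "\<And>w. a \<le> Im w \<Longrightarrow> Im w \<le> b \<Longrightarrow> norm (s w) \<le> B2"
    by (rule periodic_strip_bounded[OF L_pos continuous_on_subset[OF s_cont sub], of b]) (use s_per a in auto)
  obtain B3 where B3: "0 < B3" "\<And>w. a \<le> Im w \<Longrightarrow> Im w \<le> b \<Longrightarrow> norm (\<kappa> w) \<le> B3"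
    by (rule periodic_strip_bounded[OF L_pos continuous_on_subset[OF \<kappa>_cont sub], of b]) (use \<kappa>_per a in auto)
  have "continuous_on {w. 0 < Im w} (\<lambda>w. exp (- g w))"
    by (intro continuous_intros g_cont)
  then obtain B4 where B4: "0 < B4" "\<And>w. a \<le> Im w \<Longrightarrow> Im w \<le> b \<Longrightarrow> norm (exp (- g w)) \<le> B4"
    using periodic_strip_bounded[OF L_pos continuous_on_subset[OF _ sub], of "\<lambda>w. exp (- g w)" b] g_per a
    by (metis less_le_trans)
  define B where "B = B1 + B2 + B3 + B4 + 1"
  have B: "1 \<le> B" and pB: "\<And>w. a \<le> Im w \<Longrightarrow> Im w \<le> b \<Longrightarrow> norm (p w) \<le> B"
    and sB: "\<And>w. a \<le> Im w \<Longrightarrow> Im w \<le> b \<Longrightarrow> norm (s w) \<le> B"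
    and \<kappa>B: "\<And>w. a \<le> Im w \<Longrightarrow> Im w \<le> b \<Longrightarrow> \<bar>\<kappa> w\<bar> \<le> B"
    and gB: "\<And>w. a \<le> Im w \<Longrightarrow> Im w \<le> b \<Longrightarrow> exp (- g w) \<le> B"
    using B1 B2 B3 B4 unfolding B_def by (smt (verit) real_norm_def)+
  \<comment> \<open>\<open>B\<^sup>2 * |d|\<close> bounds \<open>p w * v\<close> and
    \<open>|d| / l0\<close> bounds the relative derivative of the field, so \<open>K * |d|\<close>
    is a common size for the first-order terms.\<close>
  define K where "K = B\<^sup>2 + 1/l0"
  have BB: "B \<le> B\<^sup>2" using B by (simp add: power2_eq_square)
  have K: "1 \<le> K" "B\<^sup>2 \<le> K" "1/l0 \<le> K" "B^3 \<le> K\<^sup>2"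
  proof -
    show "1 \<le> K" "B\<^sup>2 \<le> K" "1/l0 \<le> K"
      using B BB l0 unfolding K_def by (simp_all add: add_increasing2)
    have "B^3 \<le> B^4" using B by (intro power_increasing) auto
    also have "\<dots> = (B\<^sup>2)\<^sup>2" by simp
    also have "\<dots> \<le> K\<^sup>2" using \<open>B\<^sup>2 \<le> K\<close> by (intro power_mono) auto
    finally show "B^3 \<le> K\<^sup>2" .
  qed
  \<comment> \<open>The error \<open>8 * e\<close> with \<open>e = \<epsilon>1 * d\<^sup>2\<close>
    uses one half of \<open>\<epsilon> * d\<^sup>2\<close>, and the cubic term
    \<open>400 * (K * |d|)^3\<close> the other half.\<close>
  define \<epsilon>1 where "\<epsilon>1 = \<epsilon>/16"
  define \<epsilon>2 where "\<epsilon>2 = \<epsilon>1/(8 * B\<^sup>2)"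
  have \<epsilon>12: "0 < \<epsilon>1" "0 < \<epsilon>2" using \<epsilon> B by (auto simp: \<epsilon>1_def \<epsilon>2_def)
  obtain \<delta> where \<delta>: "0 < \<delta>" "\<delta> \<le> a/2"
    "\<And>w u. a \<le> Im w \<Longrightarrow> Im w \<le> b \<Longrightarrow> norm u \<le> \<delta> \<Longrightarrow>
       g (w + u) \<le> g w + Re (p w * u) + Re (s w * u\<^sup>2)/2 + \<kappa> w * (norm u)\<^sup>2/2 + \<epsilon>2 * (norm u)\<^sup>2"
    using taylor_uniform[OF a \<epsilon>12(2)] by blast
  \<comment> \<open>In this order: \<open>K * |d| \<le> 1/16\<close>, smallness of the two kinds of
    cubic terms, displacement at most \<delta> and at most \<eta>; the last two entries give
    \<open>e \<le> 1/2\<close>.\<close>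
  define d0 where "d0 = Min {1/(16 * K), \<epsilon>1/(4 * B^3 * K), \<epsilon>/(800 * K^3), \<delta>/(2 * B), \<eta>/(2 * B), 1, 1/(2 * \<epsilon>1)}"
  have d0: "0 < d0" "d0 \<le> 1/(16 * K)" "d0 \<le> \<epsilon>1/(4 * B^3 * K)" "d0 \<le> \<epsilon>/(800 * K^3)" "d0 \<le> \<delta>/(2 * B)" "d0 \<le> \<eta>/(2 * B)"
    "d0 \<le> 1" "d0 \<le> 1/(2 * \<epsilon>1)"
  proof -
    have "0 < K" "0 < B" using K(1) B by linarith+
    then show "0 < d0"
      unfolding d0_def using \<epsilon> \<epsilon>12 \<eta> \<delta>(1) by (subst Min_gr_iff) auto
  qed (unfold d0_def, (rule Min_le; simp)+)
  have "variation_estimate a b l0 \<epsilon> \<eta> d0"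
    unfolding variation_estimate_def
  proof (intro allI impI)
    fix d \<phi> l :: real and w \<tau> X v :: complex
    assume d: "\<bar>d\<bar> \<le> d0" and w: "a \<le> Im w" "Im w \<le> b" and X: "norm X = exp (- g w)" and \<phi>: "\<bar>\<phi>\<bar> \<le> 1"
      and l: "l0 \<le> l" and v: "v = of_real (d * \<phi>) * X"
    define A where "A = p w * v"
    define S where "S = s w * v\<^sup>2"
    define k1 where "k1 = \<kappa> w * (norm v)\<^sup>2"
    define u where "u = v - p w * v\<^sup>2/2"
    have nv: "norm v \<le> B * \<bar>d\<bar>"
    proof -
      have "norm v = \<bar>d\<bar> * \<bar>\<phi>\<bar> * exp (- g w)"
        by (simp add: v norm_mult X abs_mult)
      also have "\<dots> \<le> \<bar>d\<bar> * 1 * B"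
        using \<phi> gB[OF w] by (intro mult_mono) auto
      finally show ?thesis by (simp add: mult.commute)
    qed
    have nv2: "(norm v)\<^sup>2 \<le> B\<^sup>2 * d\<^sup>2"
      using power_mono[OF nv, of 2] by (simp add: power_mult_distrib)
    have "norm A \<le> B * (B * \<bar>d\<bar>)"
      unfolding A_def norm_mult using pB[OF w] nv B by (intro mult_mono) auto
    also have "\<dots> \<le> K * \<bar>d\<bar>"
      using K(2) by (simp add: power2_eq_square mult_right_mono flip: mult.assoc)
    finally have nA: "norm A \<le> K * \<bar>d\<bar>" .
    have nS3: "norm S \<le> B^3 * d\<^sup>2"
    proof -
      have "norm S \<le> B * (B\<^sup>2 * d\<^sup>2)"
        unfolding S_def norm_mult norm_power using sB[OF w] nv2 B by (intro mult_mono) auto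
      then show ?thesis by (simp add: eval_nat_numeral)
    qed
    have nk3: "\<bar>k1\<bar> \<le> B^3 * d\<^sup>2"
    proof -
      have "\<bar>k1\<bar> \<le> B * (B\<^sup>2 * d\<^sup>2)"
        unfolding k1_def abs_mult using \<kappa>B[OF w] nv2 B by (intro mult_mono) auto
      then show ?thesis by (simp add: eval_nat_numeral)
    qed
    have Kd2: "B^3 * d\<^sup>2 \<le> (K * \<bar>d\<bar>)\<^sup>2"
      using K(4) by (simp add: power_mult_distrib mult_right_mono)
    have k1: "k1 \<le> 0"
      unfolding k1_def using \<kappa>_nonpos[of w] w a by (intro mult_nonpos_nonneg) auto
    have Kd: "K * \<bar>d\<bar> \<le> 1/16"
    proof -
      have "K * \<bar>d\<bar> \<le> K * (1/(16 * K))"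
        using d d0(2) K by (intro mult_left_mono) auto
      then show ?thesis using K by simp
    qed
    have nA1: "norm A \<le> 1" using nA Kd by linarith
    have u_eq: "u = v * (1 - A/2)"
      by (simp add: u_def A_def power2_eq_square algebra_simps)
    have n1: "norm (1 - A/2) \<le> 2"
      using norm_triangle_ineq4[of 1 "A/2"] nA1 by (simp add: norm_divide)
    have nu: "norm u \<le> 2 * (B * \<bar>d\<bar>)"
      using norm_mult_le[OF nv n1] by (simp add: u_eq mult.commute)
    have "2 * (B * \<bar>d\<bar>) \<le> \<delta>" "2 * (B * \<bar>d\<bar>) \<le> \<eta>"
      using d d0(5,6) B by (simp_all add: field_simps)
        (smt (verit, best) mult_left_mono mult.commute)+
    then have u\<delta>: "norm u \<le> \<delta>" "norm u \<le> \<eta>"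
      using nu by linarith+
    have nu2: "(norm u)\<^sup>2 \<le> 4 * (B\<^sup>2 * d\<^sup>2)"
      using power_mono[OF nu, of 2] by (simp add: power_mult_distrib)
    define e where "e = \<epsilon>1 * d\<^sup>2"
    have third: "B^3 * d\<^sup>2 * (K * \<bar>d\<bar>) \<le> \<epsilon>1 * d\<^sup>2/4"
    proof -
      have "\<bar>d\<bar> * (4 * B^3 * K) \<le> \<epsilon>1"
        using d d0(3) B K by (simp add: pos_le_divide_eq) (smt (verit, best) mult_right_mono zero_le_mult_iff zero_le_power)
      then have "d\<^sup>2 * (\<bar>d\<bar> * (4 * B^3 * K)) \<le> d\<^sup>2 * \<epsilon>1"
        by (intro mult_left_mono) auto
      then show ?thesis by (simp add: mult_ac)
    qed
    have D: "g (w + u) - g w \<le> Re (A - A\<^sup>2/2 + S/2) + k1/2 + e"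
    proof -
      have pu: "p w * u = A - A\<^sup>2/2"
        by (simp add: u_def A_def power2_eq_square algebra_simps)
      \<comment> \<open>In quadratic terms \<open>u\<close> may be replaced by \<open>v\<close>, as
        \<open>u = v * (1 - A/2)\<close> makes only a cubic error.\<close>
      have "Re (s w * u\<^sup>2) \<le> Re S + 2 * (B^3 * d\<^sup>2 * (K * \<bar>d\<bar>))"
      proof -
        have "s w * u\<^sup>2 = S + S * (A * (A/4 - 1))"
          by (simp add: u_eq S_def power2_eq_square algebra_simps)
        moreover have "norm (A/4 - 1) \<le> 2"
          using norm_triangle_ineq4[of "A/4" 1] nA1 by (simp add: norm_divide)
        then have "norm (S * (A * (A/4 - 1))) \<le> B^3 * d\<^sup>2 * (K * \<bar>d\<bar> * 2)"
          by (intro norm_mult_le nS3 nA)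
        ultimately show ?thesis
          using complex_Re_le_cmod[of "S * (A * (A/4 - 1))"] by simp
      qed
      moreover have "\<kappa> w * (norm u)\<^sup>2 \<le> k1 + 2 * (B^3 * d\<^sup>2 * (K * \<bar>d\<bar>))"
      proof -
        have nn: "(norm (1 - A/2))\<^sup>2 = 1 + ((norm A)\<^sup>2/4 - Re A)"
          unfolding cmod_power2 by (simp add: power2_eq_square field_simps)
        have "(norm A)\<^sup>2 \<le> norm A"
          using nA1 by (simp add: power2_eq_square mult_left_le)
        then have "\<bar>(norm A)\<^sup>2/4 - Re A\<bar> \<le> 2 * norm A"
          using abs_Re_le_cmod[of A] zero_le_power2[of "norm A"] by linarith
        then have "\<bar>k1 * ((norm A)\<^sup>2/4 - Re A)\<bar> \<le> B^3 * d\<^sup>2 * (2 * (K * \<bar>d\<bar>))"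
          unfolding abs_mult using nk3 nA B by (intro mult_mono) auto
        moreover have "\<kappa> w * (norm u)\<^sup>2 = k1 + k1 * ((norm A)\<^sup>2/4 - Re A)"
          unfolding u_eq norm_mult power_mult_distrib nn k1_def by (simp add: algebra_simps)
        ultimately show ?thesis by (simp add: abs_le_iff)
      qed
      moreover have "\<epsilon>2 * (norm u)\<^sup>2 \<le> \<epsilon>1 * d\<^sup>2/2"
        using mult_left_mono[OF nu2, of \<epsilon>2] \<epsilon>12 B by (simp add: \<epsilon>2_def)
      moreover have "Re (A - A\<^sup>2/2 + S/2) = Re (A - A\<^sup>2/2) + Re S/2"
        by simp
      ultimately show ?thesis
        using \<delta>(3)[OF w u\<delta>(1)] third unfolding pu e_def by linarith
    qed
    have e: "0 \<le> e" "e \<le> 1/2"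
    proof -
      show "0 \<le> e" using \<epsilon>12 by (simp add: e_def)
      have "d\<^sup>2 \<le> \<bar>d\<bar> * 1"
        unfolding power2_eq_square abs_mult_self_eq[symmetric, of d] using d d0(7) by (intro mult_left_mono) auto
      also have "\<dots> \<le> 1/(2 * \<epsilon>1)" using d d0(8) by simp
      finally show "e \<le> 1/2" using \<epsilon>12 by (simp add: e_def field_simps)
    qed
    have main: "exp (g (w + u)) *
         norm (\<tau> + (1 - p w * v) * (of_real (d * (- exp (g w) * norm \<tau> / l)) * X - p w * \<tau> * v)
            - (s w * \<tau> + of_real (\<kappa> w) * cnj \<tau>) * v\<^sup>2/2)
       \<le> exp (g w) * norm \<tau> * (1 + d * Re (of_real (- exp (g w) * norm \<tau> / l) * X / \<tau>) + d\<^sup>2/(2 * l\<^sup>2) + \<epsilon> * d\<^sup>2)"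
    \<comment> \<open>For \<tau> = 0 both sides vanish; otherwise the velocity is divided by
      \<tau>.\<close>
    proof (cases "\<tau> = 0")
      case False
      define y where "y = of_real (d * (- exp (g w) * norm \<tau> / l)) * X / \<tau>"
      define k2 where "k2 = of_real (\<kappa> w) * (cnj \<tau> / \<tau>) * v\<^sup>2"
      have lpos: "0 < l" using l l0 by linarith
      have ny: "norm y = \<bar>d\<bar>/l"
        using False lpos by (simp add: y_def norm_mult norm_divide X abs_mult exp_minus)
      also have "\<dots> \<le> \<bar>d\<bar> * (1/l0)"
        using l l0 by (simp add: frac_le)
      also have "\<dots> \<le> K * \<bar>d\<bar>"
        using K(3) by (subst mult.commute, intro mult_right_mono) auto
      finally have nyK: "norm y \<le> K * \<bar>d\<bar>" .
      have nk2: "norm k2 \<le> \<bar>k1\<bar>"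
        using False by (simp add: k2_def k1_def norm_mult norm_divide norm_power abs_mult)
      have eq: "\<tau> + (1 - p w * v) * (of_real (d * (- exp (g w) * norm \<tau> / l)) * X - p w * \<tau> * v)
            - (s w * \<tau> + of_real (\<kappa> w) * cnj \<tau>) * v\<^sup>2/2 = \<tau> * (1 + y - A - A * y + A\<^sup>2 - S/2 - k2/2)"
      proof -
        have yt: "of_real (d * (- exp (g w) * norm \<tau> / l)) * X = \<tau> * y"
          using False by (simp add: y_def)
        have kt: "of_real (\<kappa> w) * cnj \<tau> * v\<^sup>2 = \<tau> * k2"
          using False by (simp add: k2_def)
        have "(s w * \<tau> + of_real (\<kappa> w) * cnj \<tau>) * v\<^sup>2 = \<tau> * (S + k2)"
          unfolding distrib_right kt by (simp add: S_def algebra_simps)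
        then show ?thesis
          unfolding yt by (simp add: A_def power2_eq_square algebra_simps add_divide_distrib)
      qed
      have "exp (g (w + u) - g w) * norm (1 + y - A - A * y + A\<^sup>2 - S/2 - k2/2)
          \<le> 1 + Re y + (norm y)\<^sup>2/2 + 400 * (K * \<bar>d\<bar>)^3 + 8 * e"
        by (rule second_variation_factor_le[where ?k1.0 = k1])
           (use Kd nA nyK nS3 Kd2 nk3 k1 nk2 D e K in auto)
      also have "\<dots> \<le> 1 + Re y + d\<^sup>2/(2 * l\<^sup>2) + \<epsilon> * d\<^sup>2"
      proof -
        have "\<bar>d\<bar> * (800 * K^3) \<le> \<epsilon>"
          using d d0(4) K by (simp add: pos_le_divide_eq) (smt (verit, best) mult_right_mono zero_le_power)
        then have "d\<^sup>2 * (\<bar>d\<bar> * (800 * K^3)) \<le> d\<^sup>2 * \<epsilon>"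
          by (intro mult_left_mono) auto
        moreover have "d\<^sup>2 * (\<bar>d\<bar> * (800 * K^3)) = 2 * (400 * (K * \<bar>d\<bar>)^3)"
          by (simp add: power_mult_distrib eval_nat_numeral) 
        moreover have "(norm y)\<^sup>2/2 = d\<^sup>2/(2 * l\<^sup>2)"
          by (simp add: ny power_divide)
        ultimately show ?thesis
          by (simp add: e_def \<epsilon>1_def mult.commute)
      qed
      finally have fin: "exp (g (w + u) - g w) * norm (1 + y - A - A * y + A\<^sup>2 - S/2 - k2/2) * (exp (g w) * norm \<tau>)
          \<le> (1 + Re y + d\<^sup>2/(2 * l\<^sup>2) + \<epsilon> * d\<^sup>2) * (exp (g w) * norm \<tau>)"
        by (intro mult_right_mono) auto
      have eg: "exp (g (w + u)) = exp (g (w + u) - g w) * exp (g w)"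
        by (simp flip: exp_add)
      have Rey: "d * Re (of_real (- exp (g w) * norm \<tau> / l) * X / \<tau>) = Re y"
      proof -
        define Z where "Z = of_real (- exp (g w) * norm \<tau> / l) * X / \<tau>"
        have "y = of_real d * Z"
          by (simp add: y_def Z_def)
        then show ?thesis unfolding Z_def[symmetric] by simp
      qed
      show ?thesis
        using fin unfolding eq norm_mult Rey eg by (simp only: mult_ac)
    qed simp
    then show "norm (v - p w * v\<^sup>2/2) \<le> \<eta> \<and>
       exp (g (w + (v - p w * v\<^sup>2/2))) *
         norm (\<tau> + (1 - p w * v) * (of_real (d * (- exp (g w) * norm \<tau> / l)) * X - p w * \<tau> * v)
            - (s w * \<tau> + of_real (\<kappa> w) * cnj \<tau>) * v\<^sup>2/2)
       \<le> exp (g w) * norm \<tau> * (1 + d * Re (of_real (- exp (g w) * norm \<tau> / l) * X / \<tau>) + d\<^sup>2/(2 * l\<^sup>2) + \<epsilon> * d\<^sup>2)"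
      using u\<delta>(2) unfolding u_def by blast
  qed
  then show thesis using that d0(1) by blast
qed

end

section \<open>Arcs with explicit velocity, and the width of a strip\<close>

definition C1_arc :: "real \<Rightarrow> real \<Rightarrow> (real \<Rightarrow> complex) \<Rightarrow> (real \<Rightarrow> complex) \<Rightarrow> bool" where
  "C1_arc a b c c' \<longleftrightarrow> a \<le> b \<and>
     (\<forall>t\<in>{a..b}. (c has_vector_derivative c' t) (at t within {a..b})) \<and> continuous_on {a..b} c'"

definition arc_length :: "(complex \<Rightarrow> real) \<Rightarrow> real \<Rightarrow> real \<Rightarrow> (real \<Rightarrow> complex) \<Rightarrow> (real \<Rightarrow> complex) \<Rightarrow> real" where
  "arc_length g a b c c' = integral {a..b} (\<lambda>t. exp (g (c t)) * norm (c' t))"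

lemma C1_arc_continuous: "C1_arc a b c c' \<Longrightarrow> continuous_on {a..b} c"
  unfolding C1_arc_def using has_vector_derivative_continuous continuous_on_eq_continuous_within by blast

lemma C1_arc_subset:
  assumes "C1_arc a b c c'" "a \<le> a'" "a' \<le> b'" "b' \<le> b"
  shows "C1_arc a' b' c c'"
  unfolding C1_arc_def
proof (intro conjI ballI)
  fix t assume t: "t \<in> {a'..b'}"
  have "{a'..b'} \<subseteq> {a..b}" using assms by auto
  then show "(c has_vector_derivative c' t) (at t within {a'..b'})"
    using assms(1) t unfolding C1_arc_def by (metis has_vector_derivative_within_subset subsetD)
next
  have "{a'..b'} \<subseteq> {a..b}" using assms by auto
  then show "continuous_on {a'..b'} c'"
    using assms(1) unfolding C1_arc_def by (metis continuous_on_subset)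
qed (rule assms(3))

text \<open>The parameters with value \<open>y\<close> form a nonempty compact set; before its least
  element the value cannot exceed \<open>y\<close>, by the intermediate value theorem.\<close>

lemma first_hit:
  fixes f :: "real \<Rightarrow> real"
  assumes f: "continuous_on {a..b} f" and ab: "a \<le> b" and y: "f a \<le> y" "y \<le> f b"
  obtains t where "a \<le> t" "t \<le> b" "f t = y" "\<And>s. a \<le> s \<Longrightarrow> s \<le> t \<Longrightarrow> f s \<le> y"
proof -
  let ?S = "{t \<in> {a..b}. f t = y}"
  have "closed ?S"
    using continuous_closed_preimage_constant[OF f, of y] by simp
  moreover have "bounded ?S"
    by (rule bounded_subset[OF bounded_closed_interval[of a b]]) auto
  ultimately have "compact ?S"
    by (simp add: compact_eq_bounded_closed)
  moreover obtain x where "a \<le> x" "x \<le> b" "f x = y"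
    using IVT'[OF y ab f] by metis
  then have "?S \<noteq> {}" by auto
  ultimately have "\<exists>t\<in>?S. \<forall>s\<in>?S. t \<le> s"
    by (rule compact_attains_inf)
  then obtain t where t: "t \<in> ?S" "\<And>s. s \<in> ?S \<Longrightarrow> t \<le> s"
    by metis
  have "f s \<le> y" if s: "a \<le> s" "s \<le> t" for s
  proof (rule ccontr)
    assume "\<not> f s \<le> y"
    moreover have "continuous_on {a..s} f"
      using t(1) s by (intro continuous_on_subset[OF f]) auto
    ultimately obtain s' where s': "a \<le> s'" "s' \<le> s" "f s' = y"
      using IVT'[of f a y s] y(1) s(1) by (metis linear)
    then have "t \<le> s'"
      using t s by (intro t(2)) auto
    then have "s = t" using s s' by linarith
    then show False
      using \<open>\<not> f s \<le> y\<close> t(1) by simp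
  qed
  then show thesis
    using that t(1) by auto
qed

lemma last_hit:
  fixes f :: "real \<Rightarrow> real"
  assumes f: "continuous_on {a..b} f" and ab: "a \<le> b" and y: "f a \<le> y" "y \<le> f b"
  obtains t where "a \<le> t" "t \<le> b" "f t = y" "\<And>s. t \<le> s \<Longrightarrow> s \<le> b \<Longrightarrow> y \<le> f s"
proof -
  have "continuous_on {-b..-a} (\<lambda>t. - f (- t))"
    by (intro continuous_intros continuous_on_compose2[OF f]) auto
  then obtain t where t: "- b \<le> t" "t \<le> - a" "- f (- t) = - y" "\<And>s. - b \<le> s \<Longrightarrow> s \<le> t \<Longrightarrow> - f (- s) \<le> - y"
    by (rule first_hit[of "-b" "-a" "\<lambda>t. - f (- t)" "- y"]) (use ab y in auto)
  show thesis
  proof (rule that[of "- t"])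
    show "y \<le> f s" if "- t \<le> s" "s \<le> b" for s
      using t(4)[of "- s"] that by simp
  qed (use t in auto)
qed

context conformal_superharmonic
begin

lemma arc_integrand_continuous:
  assumes "C1_arc a b c c'" "\<And>t. t \<in> {a..b} \<Longrightarrow> 0 < Im (c t)"
  shows "continuous_on {a..b} (\<lambda>t. exp (g (c t)) * norm (c' t))"
proof -
  have "continuous_on {a..b} (\<lambda>t. g (c t))"
    by (rule continuous_on_compose2[OF g_cont C1_arc_continuous[OF assms(1)]]) (use assms(2) in auto)
  moreover have "continuous_on {a..b} c'"
    using assms(1) by (simp add: C1_arc_def)
  ultimately show ?thesis
    by (intro continuous_intros)
qed

lemma arc_length_ge_dist:
  assumes c: "C1_arc a b c c'" and pos: "\<And>t. t \<in> {a..b} \<Longrightarrow> 0 < Im (c t)"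
    and \<mu>: "\<And>t. t \<in> {a..b} \<Longrightarrow> \<mu> \<le> exp (g (c t))"
  shows "\<mu> * norm (c b - c a) \<le> arc_length g a b c c'"
proof -
  have ab: "a \<le> b" and c': "continuous_on {a..b} c'" 
    and d: "\<And>t. t \<in> {a..b} \<Longrightarrow> (c has_vector_derivative c' t) (at t within {a..b})"
    using c by (auto simp: C1_arc_def)
  have "(c' has_integral (c b - c a)) {a..b}"
    by (rule fundamental_theorem_of_calculus[OF ab d])
  then have "norm (c b - c a) \<le> integral {a..b} (\<lambda>t. norm (c' t))"
    using integral_norm_bound_integral[of c' "{a..b}" "\<lambda>t. norm (c' t)"] c'
    by (auto intro!: integrable_continuous_real continuous_intros simp: integral_unique)
  moreover have "\<mu> * norm (c' t) \<le> exp (g (c t)) * norm (c' t)" if "t \<in> {a..b}" for t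
    using \<mu>[OF that] by (intro mult_right_mono) auto
  then have "integral {a..b} (\<lambda>t. \<mu> * norm (c' t)) \<le> arc_length g a b c c'"
    unfolding arc_length_def using c' arc_integrand_continuous[OF c pos]
    by (intro Henstock_Kurzweil_Integration.integral_le) (auto intro!: integrable_continuous_real continuous_intros)
  ultimately show ?thesis
  proof (cases "0 \<le> \<mu>")
    case True
    then have "\<mu> * norm (c b - c a) \<le> \<mu> * integral {a..b} (\<lambda>t. norm (c' t))"
      using \<open>norm (c b - c a) \<le> _\<close> by (intro mult_left_mono)
    then show ?thesis
      using \<open>integral {a..b} (\<lambda>t. \<mu> * norm (c' t)) \<le> _\<close> by simp
  next
    case False
    then have "\<mu> * norm (c b - c a) \<le> 0"
      by (intro mult_nonpos_nonneg) auto
    moreover have "0 \<le> arc_length g a b c c'"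
      unfolding arc_length_def
      by (rule integral_nonneg[OF integrable_continuous_real[OF arc_integrand_continuous[OF c pos]]]) auto
    ultimately show ?thesis by linarith
  qed
qed

text \<open>Arcs are confined to the closed strip so that estimates uniform over the strip apply to
  them.\<close>

definition crossing_lengths :: "real \<Rightarrow> real \<Rightarrow> real set" where
  "crossing_lengths r R = {arc_length g a b c c' |a b c c'. C1_arc a b c c' \<and>
     (\<forall>t\<in>{a..b}. r \<le> Im (c t) \<and> Im (c t) \<le> R) \<and> Im (c a) = r \<and> Im (c b) = R}"

definition width :: "real \<Rightarrow> real \<Rightarrow> real" where
  "width r R = Inf (crossing_lengths r R)"

lemma crossing_lengths_nonempty:
  assumes "0 < r" "r < R"
  shows "crossing_lengths r R \<noteq> {}"
proof -
  have "Complex 0 = (\<lambda>t. t *\<^sub>R \<i>)"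
    by (simp add: fun_eq_iff complex_eq_iff)
  then have "C1_arc r R (\<lambda>t. Complex 0 t) (\<lambda>t. \<i>)"
    unfolding C1_arc_def using assms
    by (auto intro!: derivative_eq_intros)
  then have "arc_length g r R (\<lambda>t. Complex 0 t) (\<lambda>t. \<i>) \<in> crossing_lengths r R"
    unfolding crossing_lengths_def
    by (intro CollectI exI[of _ r] exI[of _ R] exI[of _ "\<lambda>t. Complex 0 t"] exI[of _ "\<lambda>t. \<i>"] conjI refl) auto
  then show ?thesis by blast
qed

lemma crossing_lengths_lower_bound:
  assumes r: "0 < r" "r < R"
  obtains l0 where "0 < l0" "\<And>l. l \<in> crossing_lengths r R \<Longrightarrow> l0 \<le> l"
proof -
  obtain B where B: "0 < B" "\<And>w. r \<le> Im w \<Longrightarrow> Im w \<le> R \<Longrightarrow> norm (g w) \<le> B"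
    by (rule periodic_strip_bounded[OF L_pos continuous_on_subset[OF g_cont], of r R]) (use g_per r in auto)
  show thesis
  proof
    show "0 < exp (- B) * (R - r)" using r by simp
    fix l assume "l \<in> crossing_lengths r R"
    then obtain a b c c' where c: "C1_arc a b c c'" "\<forall>t\<in>{a..b}. r \<le> Im (c t) \<and> Im (c t) \<le> R"
      "Im (c a) = r" "Im (c b) = R" "l = arc_length g a b c c'"
      unfolding crossing_lengths_def by blast
    have "R - r \<le> norm (c b - c a)"
      using abs_Im_le_cmod[of "c b - c a"] c(3,4) by simp
    then have "exp (- B) * (R - r) \<le> exp (- B) * norm (c b - c a)"
      by (intro mult_left_mono) auto
    also have "\<dots> \<le> l"
      unfolding c(5)
    proof (rule arc_length_ge_dist[OF c(1)])
      fix t assume t: "t \<in> {a..b}"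
      show "0 < Im (c t)" using c(2) t r by force
      show "exp (- B) \<le> exp (g (c t))" using B(2)[of "c t"] c(2) t by auto
    qed
    finally show "exp (- B) * (R - r) \<le> l" .
  qed
qed

lemma width_le:
  assumes "0 < r" "r < R" "l \<in> crossing_lengths r R"
  shows "width r R \<le> l"
proof -
  obtain l0 where "\<And>l. l \<in> crossing_lengths r R \<Longrightarrow> l0 \<le> l"
    using crossing_lengths_lower_bound[OF assms(1,2)] by metis
  then show ?thesis
    unfolding width_def by (intro cInf_lower assms(3) bdd_belowI[of _ l0])
qed

lemma width_pos:
  assumes "0 < r" "r < R"
  shows "0 < width r R"
proof -
  obtain l0 where l0: "0 < l0" "\<And>l. l \<in> crossing_lengths r R \<Longrightarrow> l0 \<le> l"
    using crossing_lengths_lower_bound[OF assms] by metis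
  have "l0 \<le> width r R"
    unfolding width_def by (intro cInf_greatest crossing_lengths_nonempty[OF assms] l0(2))
  then show ?thesis using l0(1) by linarith
qed

text \<open>The arc first has to climb from height \<open>r - h\<close> to \<open>r\<close>, at a
  cost of at least \<open>\<mu> * h\<close>, and what follows contains a crossing of the
  strip.\<close>

lemma arc_length_dip:
  assumes r: "0 < r0" "r0 \<le> r" "r < R" and c: "C1_arc a b c c'"
    and im: "\<And>t. t \<in> {a..b} \<Longrightarrow> r0 \<le> Im (c t)"
    and h: "Im (c a) \<le> r - h" "0 \<le> h" and b: "Im (c b) = R"
    and \<mu>: "0 \<le> \<mu>" "\<And>w. r0 \<le> Im w \<Longrightarrow> Im w \<le> r \<Longrightarrow> \<mu> \<le> exp (g w)"
  shows "width r R + \<mu> * h \<le> arc_length g a b c c'"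
proof -
  let ?F = "\<lambda>t. exp (g (c t)) * norm (c' t)"
  have ab: "a \<le> b" using c by (simp add: C1_arc_def)
  have cont: "continuous_on {a..b} (\<lambda>t. Im (c t))"
    using C1_arc_continuous[OF c] by (intro continuous_intros)
  have pos: "0 < Im (c t)" if "t \<in> {a..b}" for t
    using im[OF that] r by linarith
  \<comment> \<open>\<open>t0\<close> is the first time at height \<open>r\<close>,
    \<open>t2\<close> the first later time at height \<open>R\<close>, and \<open>t1\<close> the
    last time at height \<open>r\<close> before \<open>t2\<close>; between \<open>t1\<close> and
    \<open>t2\<close> the arc stays in the strip.\<close>
  obtain t0 where t0: "a \<le> t0" "t0 \<le> b" "Im (c t0) = r" "\<And>s. a \<le> s \<Longrightarrow> s \<le> t0 \<Longrightarrow> Im (c s) \<le> r"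
    by (rule first_hit[OF cont ab, of r]) (use h b r in auto)
  obtain t2 where t2: "t0 \<le> t2" "t2 \<le> b" "Im (c t2) = R" "\<And>s. t0 \<le> s \<Longrightarrow> s \<le> t2 \<Longrightarrow> Im (c s) \<le> R"
    by (rule first_hit[OF continuous_on_subset[OF cont] t0(2), of R]) (use t0 b r in auto)
  obtain t1 where t1: "t0 \<le> t1" "t1 \<le> t2" "Im (c t1) = r" "\<And>s. t1 \<le> s \<Longrightarrow> s \<le> t2 \<Longrightarrow> r \<le> Im (c s)"
    by (rule last_hit[OF continuous_on_subset[OF cont] t2(1), of r]) (use t0 t2 b r in auto)
  note Fc = arc_integrand_continuous[OF c pos]
  have "h \<le> norm (c t0 - c a)"
    using abs_Im_le_cmod[of "c t0 - c a"] t0(3) h by simp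
  then have "\<mu> * h \<le> \<mu> * norm (c t0 - c a)"
    using \<mu>(1) by (intro mult_left_mono)
  also have "\<dots> \<le> arc_length g a t0 c c'"
    using t0 im pos by (intro arc_length_ge_dist C1_arc_subset[OF c] \<mu>(2)) auto
  finally have 1: "\<mu> * h \<le> integral {a..t0} ?F"
    by (simp add: arc_length_def)
  have "arc_length g t1 t2 c c' \<in> crossing_lengths r R"
    unfolding crossing_lengths_def using t0 t1 t2 
    by (intro CollectI exI[of _ t1] exI[of _ t2] exI[of _ c] exI[of _ c'] conjI C1_arc_subset[OF c]) auto
  then have "width r R \<le> integral {t1..t2} ?F"
    using width_le r by (simp add: arc_length_def)
  also have "\<dots> \<le> integral {t0..b} ?F"
    using t0 t1 t2 by (intro integral_subset_le integrable_continuous_real continuous_on_subset[OF Fc]) auto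
  finally have "width r R + \<mu> * h \<le> integral {a..t0} ?F + integral {t0..b} ?F"
    using 1 by simp
  also have "\<dots> = integral {a..b} ?F"
    by (rule Henstock_Kurzweil_Integration.integral_combine[OF t0(1,2)]) (rule integrable_continuous_real[OF Fc])
  finally show ?thesis by (simp add: arc_length_def)
qed

text \<open>\<open>X\<close> is the parallel unit field along \<open>c\<close> that starts horizontally; the curve is moved along the
  (second-order approximations of the) geodesics in the directions \<open>\<plusminus> \<phi> X\<close>.\<close>

lemma variation_arcs:
  assumes r: "0 < r" "r < R" and c: "C1_arc a b c c'"
    and im: "\<And>t. t \<in> {a..b} \<Longrightarrow> r \<le> Im (c t) \<and> Im (c t) \<le> R"
    and l: "l = arc_length g a b c c'" "l0 \<le> l" "0 < l0"
    and d: "variation_estimate r R l0 \<epsilon> (r/2) d" "0 \<le> d"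
  obtains c1 c1' c2 c2' where "C1_arc a b c1 c1'" "C1_arc a b c2 c2'"
    "\<And>t. t \<in> {a..b} \<Longrightarrow> r/2 \<le> Im (c1 t)" "\<And>t. t \<in> {a..b} \<Longrightarrow> r/2 \<le> Im (c2 t)"
    "Im (c1 a) = Im (c a) - d\<^sup>2 * (exp (- 2 * g (c a)) * Im (p (c a)))/2"
    "Im (c2 a) = Im (c a) - d\<^sup>2 * (exp (- 2 * g (c a)) * Im (p (c a)))/2"
    "c1 b = c b" "c2 b = c b"
    "arc_length g a b c1 c1' + arc_length g a b c2 c2' \<le> l * (2 + d\<^sup>2/l\<^sup>2 + 2 * \<epsilon> * d\<^sup>2)"
proof -
  have ab: "a \<le> b" and c': "continuous_on {a..b} c'" 
    and dc: "\<And>t. t \<in> {a..b} \<Longrightarrow> (c has_vector_derivative c' t) (at t within {a..b})"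
    using c by (auto simp: C1_arc_def)
  have cc: "continuous_on {a..b} c" by (rule C1_arc_continuous[OF c])
  have pos: "0 < Im (c t)" if "t \<in> {a..b}" for t
    using im[OF that] r by linarith
  have lpos: "0 < l" using l by linarith
  define F where "F t = exp (g (c t)) * norm (c' t)" for t
  have Fc: "continuous_on {a..b} F"
    unfolding F_def by (rule arc_integrand_continuous[OF c pos])
  have pc: "continuous_on {a..b} (\<lambda>t. p (c t))" and sc: "continuous_on {a..b} (\<lambda>t. s (c t))" 
    and \<kappa>c: "continuous_on {a..b} (\<lambda>t. \<kappa> (c t))"
    using pos by (auto intro!: continuous_on_compose2[OF p_cont cc] continuous_on_compose2[OF s_cont cc]
       continuous_on_compose2[OF \<kappa>_cont cc])
  \<comment> \<open>Falls from 1 to 0 linearly in arc length: the upper end stays fixed, and the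
    square of the arc-length derivative integrates to \<open>1/l\<close>.\<close>
  define \<phi> where "\<phi> t = 1 - integral {a..t} F / l" for t
  \<comment> \<open>In complex notation \<open>p\<close> is the Christoffel symbol of the conformal
    metric, so \<open>X' = - p * c' * X\<close> is parallel transport and \<open>Q\<close> provides
    its integrating factor.\<close>
  define Q where "Q t = integral {a..t} (\<lambda>x. p (c x) * c' x)" for t
  define X where "X t = exp (- Q t) * of_real (exp (- g (c a)))" for t
  have dQ: "(Q has_vector_derivative p (c t) * c' t) (at t within {a..b})" if "t \<in> {a..b}" for t
    unfolding Q_def by (intro integral_has_vector_derivative that continuous_intros pc c')
  have dF: "((\<lambda>t. integral {a..t} F) has_vector_derivative F t) (at t within {a..b})" if "t \<in> {a..b}" for t
    by (intro integral_has_vector_derivative that Fc)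
  have d\<phi>: "(\<phi> has_vector_derivative (- exp (g (c t)) * norm (c' t) / l)) (at t within {a..b})" if "t \<in> {a..b}" for t
    unfolding \<phi>_def using dF[OF that] lpos
    unfolding has_real_derivative_iff_has_vector_derivative[symmetric]
    by (auto intro!: derivative_eq_intros simp: F_def)
  have dX: "(X has_vector_derivative - p (c t) * c' t * X t) (at t within {a..b})" if "t \<in> {a..b}" for t
  proof -
    have "((\<lambda>t. exp (- Q t)) has_vector_derivative - (p (c t) * c' t) * exp (- Q t)) (at t within {a..b})"
      using field_vector_diff_chain_within[OF has_vector_derivative_minus[OF dQ[OF that]]
          has_field_derivative_at_within[OF DERIV_exp]]
      by (simp add: o_def)
    from has_vector_derivative_mult_left[OF this, of "of_real (exp (- g (c a)))"]
    show ?thesis unfolding X_def by (simp add: mult_ac)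
  qed
  have gc: "((\<lambda>t. g (c t)) has_vector_derivative Re (p (c t) * c' t)) (at t within {a..b})" if "t \<in> {a..b}" for t
    using has_derivative_compose[OF dc[OF that, unfolded has_vector_derivative_def] g_deriv[OF pos[OF that]]]
    by (simp add: has_vector_derivative_def algebra_simps)
  \<comment> \<open>The real part of \<open>Q\<close> is the increase of \<open>g\<close> along the
    arc; this makes \<open>X\<close> a unit field for the conformal metric.\<close>
  have ReQ: "Re (Q t) = g (c t) - g (c a)" if t: "t \<in> {a..b}" for t
  proof -
    have "((\<lambda>x. p (c x) * c' x) has_integral Q t) {a..t}"
      unfolding Q_def using t
      by (intro integrable_integral integrable_continuous_real continuous_intros continuous_on_subset[OF pc]
          continuous_on_subset[OF c']) auto
    from has_integral_Re[OF this] have "((\<lambda>x. Re (p (c x) * c' x)) has_integral Re (Q t)) {a..t}" .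
    moreover have "((\<lambda>x. Re (p (c x) * c' x)) has_integral (g (c t) - g (c a))) {a..t}"
    proof (rule fundamental_theorem_of_calculus)
      fix x assume "x \<in> {a..t}"
      then show "((\<lambda>t. g (c t)) has_vector_derivative Re (p (c x) * c' x)) (at x within {a..t})"
        using t by (intro has_vector_derivative_within_subset[OF gc]) auto
    qed (use t in auto)
    ultimately show ?thesis
      by (rule has_integral_unique)
  qed
  have nX: "norm (X t) = exp (- g (c t))" if "t \<in> {a..b}" for t
    using ReQ[OF that] by (simp add: X_def norm_mult flip: exp_add)
  have \<phi>01: "\<bar>\<phi> t\<bar> \<le> 1" if t: "t \<in> {a..b}" for t
  proof -
    have "0 \<le> integral {a..t} F"
      using t by (intro integral_nonneg integrable_continuous_real continuous_on_subset[OF Fc]) (auto simp: F_def)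
    moreover have "integral {a..t} F \<le> integral {a..b} F"
      using t by (intro integral_subset_le integrable_continuous_real continuous_on_subset[OF Fc]) (auto simp: F_def)
    moreover have "integral {a..b} F = l"
      by (simp add: l arc_length_def F_def[abs_def])
    ultimately show ?thesis
      using lpos by (simp add: \<phi>_def abs_le_iff field_simps)
  qed
  define v where "v e t = of_real (e * \<phi> t) * X t" for e t
  define C where "C e t = c t + (v e t - p (c t) * (v e t)\<^sup>2/2)" for e t
  define C' where "C' e t = c' t + (1 - p (c t) * v e t) *
       (of_real (e * (- exp (g (c t)) * norm (c' t) / l)) * X t - p (c t) * c' t * v e t)
     - (s (c t) * c' t + of_real (\<kappa> (c t)) * cnj (c' t)) * (v e t)\<^sup>2/2" for e t
  have \<phi>c: "continuous_on {a..b} \<phi>" and Xc: "continuous_on {a..b} X"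
    using d\<phi> dX has_vector_derivative_continuous continuous_on_eq_continuous_within by blast+
  have gcc: "continuous_on {a..b} (\<lambda>t. g (c t))"
    using pos by (intro continuous_on_compose2[OF g_cont cc]) auto
  have arc: "C1_arc a b (C e) (C' e)" for e
    unfolding C1_arc_def
  proof (intro conjI ballI ab)
    show "continuous_on {a..b} (C' e)"
      unfolding C'_def v_def by (intro continuous_intros c' pc sc \<kappa>c \<phi>c Xc gcc) (use lpos in auto)
    fix t assume t: "t \<in> {a..b}"
    have "((\<lambda>t. of_real (e * \<phi> t)) has_vector_derivative of_real (e * (- exp (g (c t)) * norm (c' t) / l))) (at t within {a..b})"
      using has_vector_derivative_of_real[OF has_real_derivative_iff_has_vector_derivative[THEN iffD2,
          OF has_vector_derivative_mult_right[OF d\<phi>[OF t], of e]]] by simp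
    from has_vector_derivative_mult[OF this dX[OF t]]
    have dv: "(v e has_vector_derivative
        (of_real (e * (- exp (g (c t)) * norm (c' t) / l)) * X t - p (c t) * c' t * v e t)) (at t within {a..b})"
      unfolding v_def by (rule has_vector_derivative_eq_rhs) (simp add: algebra_simps)
    have dp: "((\<lambda>t. p (c t)) has_vector_derivative s (c t) * c' t + of_real (\<kappa> (c t)) * cnj (c' t)) (at t within {a..b})"
      using has_derivative_compose[OF dc[OF t, unfolded has_vector_derivative_def] p_deriv[OF pos[OF t]]]
      unfolding has_vector_derivative_def
      by (rule has_derivative_eq_rhs) (simp add: fun_eq_iff scaleR_conv_of_real algebra_simps)
    define y where "y = of_real (e * (- exp (g (c t)) * norm (c' t) / l)) * X t"
    have C'y: "C' e t = c' t + (1 - p (c t) * v e t) * (y - p (c t) * c' t * v e t)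
        - (s (c t) * c' t + of_real (\<kappa> (c t)) * cnj (c' t)) * (v e t)\<^sup>2/2"
      by (simp add: C'_def y_def)
    have "((\<lambda>t. c t + (v e t - (1/2) * (p (c t) * (v e t * v e t)))) has_vector_derivative C' e t) (at t within {a..b})"
      by (rule has_vector_derivative_eq_rhs,
          rule has_vector_derivative_add[OF dc[OF t] has_vector_derivative_diff[OF dv[folded y_def]
            has_vector_derivative_mult_right[OF has_vector_derivative_mult[OF dp
              has_vector_derivative_mult[OF dv[folded y_def] dv[folded y_def]]]]]])
         (simp add: C'y power2_eq_square field_simps)
    then show "(C e has_vector_derivative C' e t) (at t within {a..b})"
      by (simp add: C_def[abs_def] power2_eq_square)
  qed
  have ptw: "norm (v e t - p (c t) * (v e t)\<^sup>2/2) \<le> r/2"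
      "exp (g (C e t)) * norm (C' e t) \<le>
        F t * (1 + e * Re (of_real (- exp (g (c t)) * norm (c' t) / l) * X t / c' t) + e\<^sup>2/(2 * l\<^sup>2) + \<epsilon> * e\<^sup>2)"
    if "t \<in> {a..b}" "\<bar>e\<bar> \<le> \<bar>d\<bar>" for e t
    using d(1)[unfolded variation_estimate_def, rule_format, of e "c t" "X t" "\<phi> t" l "v e t" "c' t"]
      im[OF that(1)] nX[OF that(1)] \<phi>01[OF that(1)] l(2) that(2) d(2)
    unfolding C_def C'_def F_def by (simp_all add: v_def)
  have imC: "r/2 \<le> Im (C e t)" if "t \<in> {a..b}" "\<bar>e\<bar> \<le> \<bar>d\<bar>" for e t
    using abs_Im_le_cmod[of "v e t - p (c t) * (v e t)\<^sup>2/2"] ptw(1)[OF that] im[OF that(1)]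
    unfolding C_def plus_complex.sel by linarith
  \<comment> \<open>At the lower end \<open>v\<close> is real, so the height changes only through
    the quadratic term, by the same amount for both signs of \<open>e\<close>.\<close>
  have Ca: "Im (C e a) = Im (c a) - e\<^sup>2 * (exp (- 2 * g (c a)) * Im (p (c a)))/2" for e
  proof -
    have "exp (- 2 * g (c a)) = exp (- g (c a)) * exp (- g (c a))"
      by (simp flip: exp_add)
    moreover have "v e a = of_real (e * exp (- g (c a)))"
      by (simp add: v_def \<phi>_def X_def Q_def)
    ultimately show ?thesis
      by (simp add: C_def power2_eq_square algebra_simps del: of_real_mult flip: of_real_mult)
  qed
  have Cb: "C e b = c b" for e
  proof -
    have "integral {a..b} F = l"
      by (simp add: l arc_length_def F_def[abs_def])
    then show ?thesis using lpos by (simp add: C_def v_def \<phi>_def)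
  qed
  have imC': "0 < Im (C e t)" if "t \<in> {a..b}" "\<bar>e\<bar> \<le> \<bar>d\<bar>" for e t
    using imC[OF that] r by linarith
  have "arc_length g a b (C d) (C' d) + arc_length g a b (C (- d)) (C' (- d)) =
      integral {a..b} (\<lambda>t. exp (g (C d t)) * norm (C' d t) + exp (g (C (- d) t)) * norm (C' (- d) t))"
    unfolding arc_length_def
    by (rule integral_add[symmetric]; intro integrable_continuous_real arc_integrand_continuous arc imC') auto
  also have "\<dots> \<le> integral {a..b} (\<lambda>t. F t * (2 + d\<^sup>2/l\<^sup>2 + 2 * \<epsilon> * d\<^sup>2))"
  proof (rule Henstock_Kurzweil_Integration.integral_le)
    show "(\<lambda>t. exp (g (C d t)) * norm (C' d t) + exp (g (C (- d) t)) * norm (C' (- d) t)) integrable_on {a..b}"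
      by (intro integrable_add integrable_continuous_real arc_integrand_continuous arc imC') auto
    show "(\<lambda>t. F t * (2 + d\<^sup>2/l\<^sup>2 + 2 * \<epsilon> * d\<^sup>2)) integrable_on {a..b}"
      by (intro integrable_continuous_real continuous_intros Fc)
    fix t assume t: "t \<in> {a..b}"
    \<comment> \<open>The first-order terms are odd in the parameter and cancel pointwise.\<close>
    show "exp (g (C d t)) * norm (C' d t) + exp (g (C (- d) t)) * norm (C' (- d) t) \<le> F t * (2 + d\<^sup>2/l\<^sup>2 + 2 * \<epsilon> * d\<^sup>2)"
      using ptw(2)[OF t, of d] ptw(2)[OF t, of "- d"] by (simp add: algebra_simps add_divide_distrib)
  qed
  also have "\<dots> = l * (2 + d\<^sup>2/l\<^sup>2 + 2 * \<epsilon> * d\<^sup>2)"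
    by (simp add: l arc_length_def F_def[abs_def])
  finally show thesis
    using that[of "C d" "C' d" "C (- d)" "C' (- d)"] arc imC Ca Cb by auto
qed

text \<open>As \<open>Im p\<close> is minus the vertical derivative of \<open>g\<close>, the circle
  shrinks when moved upwards. Both displaced curves start lower by at least
  \<open>d\<^sup>2 * k0/2\<close> and must climb back before crossing, whereas the displacement adds
  only about \<open>d\<^sup>2 / l\<close> to the sum of their lengths. A width above
  \<open>1/(\<mu> * k0)\<close> would make the gain exceed this price.\<close>

lemma width_bounded:
  assumes r: "0 < r" and convex: "\<And>w. Im w = r \<Longrightarrow> 0 < Im (p w)"
  obtains K where "\<And>R. r < R \<Longrightarrow> width r R \<le> K"
proof -
  let ?k = "\<lambda>w. exp (- 2 * g w) * Im (p w)"
  let ?K = "cbox (Complex 0 r) (Complex L r)"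
  have sub: "?K \<subseteq> {w. 0 < Im w}"
    using r by (auto simp: in_cbox_complex_iff)
  have "continuous_on ?K g" "continuous_on ?K p"
    using continuous_on_subset[OF g_cont sub] continuous_on_subset[OF p_cont sub] by auto
  then have "continuous_on ?K ?k"
    by (intro continuous_intros)
  moreover have "Complex 0 r \<in> ?K"
    using L_pos by (simp add: in_cbox_complex_iff)
  then have "?K \<noteq> {}" by blast
  ultimately have "\<exists>w0\<in>?K. \<forall>w\<in>?K. ?k w0 \<le> ?k w"
    by (intro continuous_attains_inf compact_cbox)
  then obtain w0 where w0: "w0 \<in> ?K" "\<And>w. w \<in> ?K \<Longrightarrow> ?k w0 \<le> ?k w"
    by metis
  define k0 where "k0 = ?k w0"
  have k0: "0 < k0"
    using convex[of w0] w0(1) by (auto simp: k0_def in_cbox_complex_iff)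
  have k0_le: "k0 \<le> ?k w" if "Im w = r" for w
  proof -
    obtain j :: int where j: "0 \<le> Re w + of_int j * L" "Re w + of_int j * L \<le> L"
      using ex_shift_to_fundamental_domain[OF L_pos] .
    have "k0 \<le> ?k (w + of_real (of_int j * L))"
      unfolding k0_def by (rule w0(2)) (use j that in \<open>auto simp: in_cbox_complex_iff\<close>)
    moreover have "g (w + of_real (of_int j * L)) = g w" "p (w + of_real (of_int j * L)) = p w"
      by (rule periodic_of_int[of r]; use g_per p_per r that in force)+
    ultimately show ?thesis by simp
  qed
  obtain B where B: "0 < B" "\<And>w. r/2 \<le> Im w \<Longrightarrow> Im w \<le> r \<Longrightarrow> norm (g w) \<le> B"
    by (rule periodic_strip_bounded[OF L_pos continuous_on_subset[OF g_cont], of "r/2" r]) (use g_per r in auto)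
  define \<mu> where "\<mu> = exp (- B)"
  have \<mu>: "0 < \<mu>" "\<And>w. r/2 \<le> Im w \<Longrightarrow> Im w \<le> r \<Longrightarrow> \<mu> \<le> exp (g w)"
    unfolding \<mu>_def using B by (auto simp: abs_le_iff) (smt (verit))
  have "width r R \<le> 1/(\<mu> * k0)" if R: "r < R" for R
  proof (rule ccontr)
    define W where "W = width r R"
    assume "\<not> width r R \<le> 1/(\<mu> * k0)"
    then have "1/(\<mu> * k0) < W" by (simp add: W_def)
    moreover have W: "0 < W"
      unfolding W_def using width_pos r R by blast
    ultimately have \<theta>: "0 < \<mu> * k0 - 1/W"
      using \<mu>(1) k0 by (simp add: field_simps)
    \<comment> \<open>The surplus of gain over price in units of \<open>d\<^sup>2\<close>;
      \<epsilon> and \<delta> are chosen so that all errors together use at most three quarters of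
      it.\<close>
    define \<theta> where "\<theta> = \<mu> * k0 - 1/W"
    define \<epsilon> where "\<epsilon> = \<theta>/4/(W + 1)"
    have \<epsilon>: "0 < \<epsilon>" "\<epsilon> * (W + 1) = \<theta>/4"
    proof -
      show "0 < \<epsilon>"
        using \<theta>[folded \<theta>_def] W by (simp add: \<epsilon>_def)
      have "W + 1 \<noteq> 0" using W by linarith
      then show "\<epsilon> * (W + 1) = \<theta>/4"
        by (rule iffD1[OF nonzero_eq_divide_eq \<epsilon>_def])
    qed
    have r2: "0 < r/2" using r by simp
    \<comment> \<open>\<open>d\<close>, \<epsilon> and \<delta> may depend on \<open>R\<close>; the
      bound \<open>1/(\<mu> * k0)\<close> does not.\<close>
    obtain d where d: "0 < d" "variation_estimate r R W \<epsilon> (r/2) d"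
      using ex_variation_estimate[OF r W \<epsilon>(1) r2] .
    define \<delta> where "\<delta> = min 1 (\<theta> * d\<^sup>2/8)"
    have \<delta>: "0 < \<delta>" "\<delta> \<le> 1" "\<delta> \<le> \<theta> * d\<^sup>2/8"
      using \<theta>[folded \<theta>_def] d(1) by (simp_all add: \<delta>_def)
    obtain l where l: "l \<in> crossing_lengths r R" "l < W + \<delta>"
      using cInf_lessD[OF crossing_lengths_nonempty[OF r R], of "W + \<delta>"] \<delta>(1) unfolding W_def width_def by auto
    then obtain a b c c' where c: "C1_arc a b c c'" "\<forall>t\<in>{a..b}. r \<le> Im (c t) \<and> Im (c t) \<le> R"
      "Im (c a) = r" "Im (c b) = R" "l = arc_length g a b c c'"
      unfolding crossing_lengths_def by blast
    have Wl: "W \<le> l"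
      unfolding W_def using width_le[OF r R l(1)] .
    obtain c1 c1' c2 c2' where v: "C1_arc a b c1 c1'" "C1_arc a b c2 c2'"
      "\<And>t. t \<in> {a..b} \<Longrightarrow> r/2 \<le> Im (c1 t)" "\<And>t. t \<in> {a..b} \<Longrightarrow> r/2 \<le> Im (c2 t)"
      "Im (c1 a) = Im (c a) - d\<^sup>2 * (exp (- 2 * g (c a)) * Im (p (c a)))/2"
      "Im (c2 a) = Im (c a) - d\<^sup>2 * (exp (- 2 * g (c a)) * Im (p (c a)))/2"
      "c1 b = c b" "c2 b = c b"
      "arc_length g a b c1 c1' + arc_length g a b c2 c2' \<le> l * (2 + d\<^sup>2/l\<^sup>2 + 2 * \<epsilon> * d\<^sup>2)"
      by (rule variation_arcs[OF r R c(1) _ c(5) Wl W d(2)]) (use c(2) d(1) in auto)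
    have dip: "d\<^sup>2 * k0 \<le> d\<^sup>2 * ?k (c a)"
      using k0_le[OF c(3)] by (intro mult_left_mono) auto
    have h: "0 \<le> d\<^sup>2 * k0/2" using k0 by simp
    have "W + \<mu> * (d\<^sup>2 * k0/2) \<le> arc_length g a b c1 c1'"
      unfolding W_def
      by (rule arc_length_dip[of "r/2"]) (use r R v c(3,4) dip h \<mu> in auto)
    moreover have "W + \<mu> * (d\<^sup>2 * k0/2) \<le> arc_length g a b c2 c2'"
      unfolding W_def
      by (rule arc_length_dip[of "r/2"]) (use r R v c(3,4) dip h \<mu> in auto)
    ultimately have "2 * W + \<mu> * k0 * d\<^sup>2 \<le> l * (2 + d\<^sup>2/l\<^sup>2 + 2 * \<epsilon> * d\<^sup>2)"
      using v(9) by (simp add: algebra_simps)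
    also have "\<dots> = 2 * l + d\<^sup>2 * (1/l) + 2 * d\<^sup>2 * (\<epsilon> * l)"
      using W Wl by (simp add: algebra_simps power2_eq_square)
    also have "\<dots> \<le> 2 * (W + \<delta>) + d\<^sup>2 * (1/W) + 2 * d\<^sup>2 * (\<epsilon> * (W + 1))"
      using l(2) W Wl \<epsilon> \<delta> by (intro add_mono mult_left_mono) (auto intro: divide_left_mono)
    also have "\<dots> \<le> 2 * W + \<theta> * d\<^sup>2/4 + d\<^sup>2 * (1/W) + d\<^sup>2 * \<theta>/2"
      unfolding \<epsilon>(2) using \<delta>(3) by simp
    finally have "\<theta> * d\<^sup>2 \<le> (3/4) * \<theta> * d\<^sup>2"
      by (simp add: \<theta>_def algebra_simps)
    moreover have "0 < \<theta> * d\<^sup>2"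
      using \<theta> d(1) by (simp add: \<theta>_def)
    ultimately show False by linarith
  qed
  then show thesis using that by blast
qed

end

section \<open>Trigonometric approximation\<close>

text \<open>On the circle \<open>u * cnj u = 1\<close>, so one factor \<open>u\<close> can be peeled
  off both polynomials; what is split off is the real part of a polynomial, since conjugation does
  not change real parts.\<close>

lemma Re_poly_mult_cnj_on_circle:
  fixes P Q :: "complex poly"
  shows "\<exists>S. \<forall>u\<in>sphere 0 1. Re (poly P u * cnj (poly Q u)) = Re (poly S u)"
proof (induction P arbitrary: Q rule: pCons_induct)
  case 0
  then show ?case by (intro exI[of _ 0]) simp
next
  case (pCons a P)
  obtain b Q' where Q: "Q = pCons b Q'" by (cases Q)
  obtain S where S: "\<And>u. u \<in> sphere 0 1 \<Longrightarrow> Re (poly P u * cnj (poly Q' u)) = Re (poly S u)"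
    using pCons.IH by blast
  let ?S = "[:a * cnj b:] + smult (cnj a) (pCons 0 Q') + smult (cnj b) (pCons 0 P) + S"
  have "Re (poly (pCons a P) u * cnj (poly Q u)) = Re (poly ?S u)" if u: "u \<in> sphere 0 1" for u
  proof -
    have uu: "u * cnj u = 1"
      using u by (simp add: complex_norm_square[symmetric])
    have "poly (pCons a P) u * cnj (poly Q u) =
        a * cnj b + a * cnj (u * poly Q' u) + cnj b * (u * poly P u) + (u * cnj u) * (poly P u * cnj (poly Q' u))"
      by (simp add: Q algebra_simps)
    moreover have "Re (a * cnj z) = Re (cnj a * z)" for z
      by simp
    note this[of "u * poly Q' u"]
    ultimately show ?thesis
      by (simp only: uu mult_1_left plus_complex.sel S[OF u] poly_add poly_smult poly_pCons poly_0 mult_zero_right add_0_left add_0_right)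
  qed
  then show ?case by blast
qed

text \<open>Real parts of polynomials on the circle are the real trigonometric polynomials; they
  form an algebra that separates points, so Stone-Weierstrass applies.\<close>

lemma real_trigonometric_approximation:
  assumes f: "continuous_on (sphere 0 1) f" and \<epsilon>: "0 < \<epsilon>"
  obtains P :: "complex poly" where "\<And>u. u \<in> sphere 0 1 \<Longrightarrow> \<bar>f u - Re (poly P u)\<bar> < \<epsilon>"
proof -
  define R where "R = {h. \<exists>P :: complex poly. \<forall>u\<in>sphere 0 1. h u = Re (poly P u)}"
  interpret function_ring_on R "sphere 0 1 :: complex set"
  proof
    fix h assume "h \<in> R"
    then obtain P where "\<And>u. u \<in> sphere 0 1 \<Longrightarrow> h u = Re (poly P u)"
      unfolding R_def by blast
    then show "continuous_on (sphere 0 1) h"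
      by (subst continuous_on_cong[OF refl]) (auto intro!: continuous_intros)
  next
    fix h k assume "h \<in> R" "k \<in> R"
    then obtain P Q where PQ: "\<And>u. u \<in> sphere 0 1 \<Longrightarrow> h u = Re (poly P u)" "\<And>u. u \<in> sphere 0 1 \<Longrightarrow> k u = Re (poly Q u)"
      unfolding R_def by blast
    show "(\<lambda>x. h x + k x) \<in> R"
      unfolding R_def using PQ by (intro CollectI exI[of _ "P + Q"]) simp
    obtain S where S: "\<And>u. u \<in> sphere 0 1 \<Longrightarrow> Re (poly P u * cnj (poly Q u)) = Re (poly S u)"
      using Re_poly_mult_cnj_on_circle by blast
    \<comment> \<open>\<open>Re x * Re y\<close> is half of
      \<open>Re (x * y) + Re (x * cnj y)\<close>.\<close>
    have "h u * k u = Re (poly (smult (1/2) (P * Q + S)) u)" if u: "u \<in> sphere 0 1" for u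
    proof -
      have "Re (poly (smult (1/2) (P * Q + S)) u) = (Re (poly P u * poly Q u) + Re (poly P u * cnj (poly Q u)))/2"
        by (simp only: S[OF u]) simp
      then show ?thesis using PQ[OF u] by simp
    qed
    then show "(\<lambda>x. h x * k x) \<in> R"
      unfolding R_def by blast
  next
    fix c :: real
    show "(\<lambda>_. c) \<in> R"
      unfolding R_def by (intro CollectI exI[of _ "[:of_real c:]"]) simp
  next
    fix x y :: complex assume "x \<noteq> y"
    have 1: "(\<lambda>u. Re u) \<in> R"
      unfolding R_def by (intro CollectI exI[of _ "[:0, 1:]"]) simp
    have 2: "(\<lambda>u. Im u) \<in> R"
      unfolding R_def by (intro CollectI exI[of _ "[:0, - \<i>:]"]) simp
    show "\<exists>f\<in>R. f x \<noteq> f y"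
      using bexI[OF _ 1, of "\<lambda>f. f x \<noteq> f y"] bexI[OF _ 2, of "\<lambda>f. f x \<noteq> f y"] \<open>x \<noteq> y\<close>
      by (auto simp: complex_eq_iff)
  qed (rule compact_sphere)
  obtain h where h: "h \<in> R" "\<And>u. u \<in> sphere 0 1 \<Longrightarrow> \<bar>f u - h u\<bar> < \<epsilon>"
    using Stone_Weierstrass_basic[OF f \<epsilon>] by blast
  obtain P where P: "\<And>u. u \<in> sphere 0 1 \<Longrightarrow> h u = Re (poly P u)"
    using h(1) unfolding R_def by blast
  show thesis
  proof (rule that[of P])
    fix u :: complex assume u: "u \<in> sphere 0 1"
    show "\<bar>f u - Re (poly P u)\<bar> < \<epsilon>"
      using h(2)[OF u] P[OF u] by simp
  qed
qed

text \<open>The function is \<open>F\<close> composed with \<open>Arg\<close>. Near the branch cut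
  it equals \<open>F (Arg (- u) + pi)\<close> by periodicity, and there \<open>Arg (- u)\<close> is
  continuous.\<close>

lemma periodic_imp_continuous_on_circle:
  fixes F :: "real \<Rightarrow> real"
  assumes F: "continuous_on UNIV F" and per: "\<And>x. F (x + 2 * pi) = F x"
  obtains f where "continuous_on (sphere 0 1) f" "\<And>x. f (cis x) = F x"
proof
  have perk: "F (x + of_int k * (2 * pi)) = F x" for x k
    using periodic_of_int[of 0 "\<lambda>w. F (Re w)" "2 * pi" "of_real x" k] per by simp
  have Arg_cis: "\<exists>k::int. Arg (cis x) = x + of_int k * (2 * pi)" for x
  proof -
    have "cis (Arg (cis x)) = cis x"
      by (simp add: cis_Arg)
    then have "cis (Arg (cis x) - x) = 1"
      by (simp add: cis_divide[symmetric])
    then have "cos (Arg (cis x) - x) = 1"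
      by (simp add: complex_eq_iff)
    then obtain k :: int where "Arg (cis x) - x = of_int k * 2 * pi"
      using cos_one_2pi_int by blast
    then show ?thesis by (intro exI[of _ k]) (simp add: algebra_simps)
  qed
  show eq: "F (Arg (cis x)) = F x" for x
    using Arg_cis[of x] perk by metis
  have rep: "\<exists>x. u = cis x" if "u \<in> sphere 0 1" for u
  proof -
    have "u \<noteq> 0" "norm u = 1" using that by auto
    then have "cis (Arg u) = u"
      by (simp add: cis_Arg sgn_div_norm)
    then show ?thesis by (intro exI[of _ "Arg u"]) simp
  qed
  have eq2: "F (Arg u) = F (Arg (- u) + pi)" if u: "u \<in> sphere 0 1" for u
  proof -
    obtain x where x: "u = cis x" using rep[OF u] by blast
    have "- u = cis (x - pi)" by (simp add: x complex_eq_iff)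
    then obtain k :: int where "Arg (- u) = x - pi + of_int k * (2 * pi)"
      using Arg_cis by metis
    then have "F (Arg (- u) + pi) = F x"
      using perk[of x k] by simp
    then show ?thesis using eq by (simp add: x)
  qed
  have FA: "continuous (at v) (\<lambda>u. F (Arg u + c))" if "v \<notin> \<real>\<^sub>\<le>\<^sub>0" for v c
  proof -
    have "isCont F y" for y
      using F by (simp add: continuous_on_eq_continuous_at)
    then show ?thesis
      using continuous_at_Arg[OF that] by (intro continuous_at_compose[of v "\<lambda>u. Arg u + c" F, unfolded o_def] continuous_intros) auto
  qed
  show "continuous_on (sphere 0 1) (\<lambda>u. F (Arg u))"
    unfolding continuous_on_eq_continuous_within
  proof
    fix v :: complex assume v: "v \<in> sphere 0 1"
    show "continuous (at v within sphere 0 1) (\<lambda>u. F (Arg u))"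
    proof (cases "v \<in> \<real>\<^sub>\<le>\<^sub>0")
      case False
      then show ?thesis
        using FA[of v 0] by (auto intro: continuous_at_imp_continuous_at_within)
    next
      case True
      then have "- v \<notin> \<real>\<^sub>\<le>\<^sub>0"
      proof -
        have "v \<noteq> 0" using v by auto
        then show ?thesis
          using True by (auto simp: complex_nonpos_Reals_iff complex_eq_iff)
      qed
      then have "continuous (at v) (\<lambda>u. F (Arg (- u) + pi))"
        using continuous_at_compose[of v uminus "\<lambda>u. F (Arg u + pi)"] FA[of "- v" pi]
        by (auto simp: o_def intro: continuous_intros)
      then have "continuous (at v within sphere 0 1) (\<lambda>u. F (Arg (- u) + pi))"
        by (rule continuous_at_imp_continuous_at_within)
      then show ?thesis
        by (rule continuous_transform_within[OF _ zero_less_one v]) (use eq2 in auto)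
    qed
  qed
qed

lemma ex_poly_antiderivative: "\<exists>G. pderiv G = (P :: complex poly)"
proof -
  have "\<exists>G. pderiv G = (\<Sum>i\<le>n. monom (coeff P i) i)" for n
  proof (induction n)
    case 0
    show ?case
      by (intro exI[of _ "monom (coeff P 0) 1"]) (simp add: pderiv_monom)
  next
    case (Suc n)
    then obtain G where "pderiv G = (\<Sum>i\<le>n. monom (coeff P i) i)" by blast
    then show ?case
      by (intro exI[of _ "G + monom (coeff P (Suc n) / of_nat (Suc (Suc n))) (Suc (Suc n))"])
         (simp add: pderiv_add pderiv_monom del: of_nat_Suc)
  qed
  then show ?thesis
    using poly_as_sum_of_monoms[of P] by metis
qed

text \<open>A bounded harmonic function \<open>Re G(e\<^sup>i\<^sup>\<omega>\<^sup>(\<^sup>w\<^sup>-\<^sup>i\<^sup>r\<^sup>))\<close> whose normal derivative on the circle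
  \<open>Im w = r\<close> compensates the oscillation of \<open>F\<close>.\<close>

lemma harmonic_neumann_correction:
  fixes F :: "real \<Rightarrow> real"
  assumes L: "0 < L" and F: "continuous_on UNIV F" and per: "\<And>x. F (x + L) = F x"
    and neg: "integral {-L/2..L/2} F < 0"
  obtains G :: "complex poly" where
    "\<And>x. F x < 2 * pi/L * Re (cis (2 * pi/L * x) * poly (pderiv G) (cis (2 * pi/L * x)))"
proof -
  define \<omega> where "\<omega> = 2 * pi/L"
  have \<omega>: "0 < \<omega>" "\<omega> * L = 2 * pi" using L by (auto simp: \<omega>_def)
  define A where "A = integral {-L/2..L/2} F / L"
  have A: "A < 0" using neg L by (simp add: A_def divide_neg_pos)
  have "continuous_on UNIV (\<lambda>x. F (x / \<omega>))"
    by (intro continuous_on_compose2[OF F] continuous_intros) (use \<omega> in auto)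
  moreover have "F ((x + 2 * pi)/\<omega>) = F (x/\<omega>)" for x
    using per[of "x/\<omega>"] \<omega> by (simp add: add_divide_distrib \<omega>(2)[symmetric])
  ultimately obtain f where f: "continuous_on (sphere 0 1) f" "\<And>x. f (cis x) = F (x/\<omega>)"
    using periodic_imp_continuous_on_circle[of "\<lambda>x. F (x / \<omega>)"] by metis
  \<comment> \<open>With \<open>A\<close> the negative mean of \<open>F\<close>, this error forces
    \<open>Re a \<le> 2 * A/3\<close>, so that \<open>F - T\<close> stays below \<open>A/3\<close>
    and hence negative.\<close>
  have "0 < - A/3" using A by simp
  then obtain P where P: "\<And>u. u \<in> sphere 0 1 \<Longrightarrow> \<bar>f u - Re (poly P u)\<bar> < - A/3"
    using real_trigonometric_approximation[OF f(1)] by metis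
  \<comment> \<open>The constant coefficient carries the mean. The rest, \<open>u * P1(u)\<close>,
    is \<omega> times \<open>u * G'(u)\<close>, up to sign the normal derivative of a harmonic
    function.\<close>
  obtain a P1 where P1: "P = pCons a P1" by (cases P)
  obtain G where G: "pderiv G = smult (of_real (1/\<omega>)) P1"
    using ex_poly_antiderivative by blast
  define T where "T x = \<omega> * Re (cis (\<omega> * x) * poly (pderiv G) (cis (\<omega> * x)))" for x
  have T: "Re (poly P (cis (\<omega> * x))) = Re a + T x" for x
    using \<omega>(1) by (simp add: P1 T_def G mult.left_commute)
  have approx: "\<bar>F x - (Re a + T x)\<bar> < - A/3" for x
    using P[of "cis (\<omega> * x)"] f(2)[of "\<omega> * x"] \<omega>(1) by (simp add: T)
  \<comment> \<open>\<open>T\<close> is the derivative of a function with equal values at both ends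
    of the period, so its mean vanishes.\<close>
  have "((\<lambda>x. Im (poly G (cis (\<omega> * x)))) has_real_derivative T x) (at x)" for x
  proof -
    have "((\<lambda>x. cis (\<omega> * x)) has_vector_derivative \<i> * of_real \<omega> * cis (\<omega> * x)) (at x)"
    proof -
      have "((\<lambda>z. exp (\<i> * (of_real \<omega> * z))) has_field_derivative \<i> * of_real \<omega> * exp (\<i> * (of_real \<omega> * of_real x)))
          (at (of_real x))"
        by (auto intro!: derivative_eq_intros)
      from has_vector_derivative_real_field[OF this] show ?thesis
        by (simp add: cis_conv_exp)
    qed
    then have "((\<lambda>x. poly G (cis (\<omega> * x))) has_vector_derivative (\<i> * of_real \<omega> * cis (\<omega> * x)) * poly (pderiv G) (cis (\<omega> * x))) (at x)"
      using field_vector_diff_chain_at[OF _ poly_DERIV, of "\<lambda>x. cis (\<omega> * x)"] by (simp add: o_def)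
    from bounded_linear.has_vector_derivative[OF bounded_linear_Im this]
    show ?thesis
      unfolding has_real_derivative_iff_has_vector_derivative
      by (rule has_vector_derivative_eq_rhs) (simp add: T_def algebra_simps)
  qed
  then have "(T has_integral Im (poly G (cis (\<omega> * (L/2)))) - Im (poly G (cis (\<omega> * (-L/2))))) {-L/2..L/2}"
    using L by (intro fundamental_theorem_of_calculus)
      (auto simp: has_real_derivative_iff_has_vector_derivative intro: has_vector_derivative_at_within)
  moreover have "cis (\<omega> * (L/2)) = cis (\<omega> * (-L/2))"
  proof -
    have "\<omega> * (L/2) = pi" "\<omega> * (-L/2) = - pi" using \<omega>(2) by auto
    then show ?thesis by (simp add: complex_eq_iff)
  qed
  ultimately have T0: "(T has_integral 0) {-L/2..L/2}"
    by simp
  have I1: "((\<lambda>x. F x - (Re a + T x)) has_integral (L * A - (L * Re a + 0))) {-L/2..L/2}"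
  proof (intro has_integral_diff has_integral_add T0)
    show "(F has_integral L * A) {-L/2..L/2}"
    proof -
      have "F integrable_on {-L/2..L/2}"
        by (intro integrable_continuous_real continuous_on_subset[OF F]) auto
      then show ?thesis
        using L by (simp add: A_def has_integral_integral)
    qed
    show "((\<lambda>x. Re a) has_integral L * Re a) {-L/2..L/2}"
      using has_integral_const_real[of "Re a" "-L/2" "L/2"] L by simp
  qed
  have I2: "((\<lambda>x. A/3) has_integral L * (A/3)) {-L/2..L/2}"
    using has_integral_const_real[of "A/3" "-L/2" "L/2"] L by simp
  have I3: "A/3 \<le> F x - (Re a + T x)" for x
    using approx[of x] by (simp add: abs_less_iff)
  have "L * (A/3) \<le> L * A - (L * Re a + 0)"
    by (rule has_integral_le[OF I2 I1 I3])
  then have "L * (A/3) \<le> L * (A - Re a)" by (simp add: algebra_simps)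
  then have "Re a \<le> 2 * A/3"
    using L by (simp add: mult_le_cancel_left_pos)
  then have "F x < T x" for x
    using approx[of x] A by linarith
  then show thesis
    by (intro that[of G]) (simp add: T_def \<omega>_def)
qed

section \<open>Partial derivatives on the half-plane\<close>

definition Dz :: "(real \<times> real \<Rightarrow> real) \<Rightarrow> real \<times> real \<Rightarrow> real" where
  "Dz f q = frechet_derivative f (at q) (1, 0)"

definition Dr :: "(real \<times> real \<Rightarrow> real) \<Rightarrow> real \<times> real \<Rightarrow> real" where
  "Dr f q = frechet_derivative f (at q) (0, 1)"

lemma smooth_on_imp_differentiable:
  assumes "smooth_on U f" "x \<in> U"
  shows "f differentiable (at x)"
proof -
  have "Ck_on (Suc 0) U f" using assms(1) unfolding smooth_on_def by blast
  then show ?thesis using assms(2) by simp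
qed

lemma smooth_on_continuous:
  assumes "smooth_on U f"
  shows "continuous_on U f"
proof -
  have "Ck_on 0 U f" using assms unfolding smooth_on_def by blast
  then show ?thesis by simp
qed

lemma smooth_on_frechet_derivative:
  assumes "smooth_on U f"
  shows "smooth_on U (\<lambda>x. frechet_derivative f (at x) v)"
  unfolding smooth_on_def
proof
  fix k
  have "Ck_on (Suc k) U f" using assms unfolding smooth_on_def by blast
  then show "Ck_on k U (\<lambda>x. frechet_derivative f (at x) v)" by simp
qed

lemma smooth_on_Dz: "smooth_on U f \<Longrightarrow> smooth_on U (Dz f)"
  and smooth_on_Dr: "smooth_on U f \<Longrightarrow> smooth_on U (Dr f)"
  unfolding Dz_def[abs_def] Dr_def[abs_def] by (simp_all add: smooth_on_frechet_derivative)

abbreviation half_plane :: "(real \<times> real) set" where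
  "half_plane \<equiv> {p. snd p > 0}"

lemma open_half_plane: "open half_plane"
  by (intro open_Collect_less continuous_intros)

lemma differentiable_has_derivative:
  assumes "f differentiable (at q)"
  shows "(f has_derivative (\<lambda>h. Dz f q * fst h + Dr f q * snd h)) (at q)"
proof -
  have d: "(f has_derivative frechet_derivative f (at q)) (at q)"
    using assms by (simp add: frechet_derivative_works)
  have lin: "linear (frechet_derivative f (at q))"
    using has_derivative_linear[OF d] .
  have "frechet_derivative f (at q) h = Dz f q * fst h + Dr f q * snd h" for h
  proof -
    have "h = fst h *\<^sub>R (1, 0) + snd h *\<^sub>R (0, 1)"
      by (simp add: prod_eq_iff)
    then have "frechet_derivative f (at q) h = fst h *\<^sub>R Dz f q + snd h *\<^sub>R Dr f q"
      unfolding Dz_def Dr_def by (metis linear_add[OF lin] linear_scale[OF lin])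
    then show ?thesis by simp
  qed
  then show ?thesis
    using d by (simp add: has_derivative_eq_rhs fun_eq_iff)
qed

lemma smooth_has_derivative:
  assumes "smooth_on U f" "q \<in> U"
  shows "(f has_derivative (\<lambda>h. Dz f q * fst h + Dr f q * snd h)) (at q)"
  using differentiable_has_derivative[OF smooth_on_imp_differentiable[OF assms]] .

lemma has_derivative_Dz_Dr_unique:
  assumes "(f has_derivative (\<lambda>h. a * fst h + b * snd h)) (at q)"
  shows "Dz f q = a" "Dr f q = b"
  by (simp_all add: Dz_def Dr_def frechet_derivative_at[OF assms, symmetric])

lemma smooth_has_real_derivative:
  assumes "smooth_on half_plane f" "0 < r"
  shows "((\<lambda>z. f (z, r)) has_real_derivative Dz f (z, r)) (at z)"
    and "((\<lambda>r. f (z, r)) has_real_derivative Dr f (z, r)) (at r)"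
proof -
  have d: "(f has_derivative (\<lambda>h. Dz f (z, r) * fst h + Dr f (z, r) * snd h)) (at (z, r))"
    using assms by (intro smooth_has_derivative) auto
  have "((\<lambda>z. f (z, r)) has_derivative (\<lambda>h. Dz f (z, r) * fst (h, 0::real) + Dr f (z, r) * snd (h, 0::real))) (at z)"
    by (rule has_derivative_compose[of "\<lambda>z. (z, r)" "\<lambda>h. (h, 0)", OF _ d]) (auto intro!: derivative_eq_intros)
  then show "((\<lambda>z. f (z, r)) has_real_derivative Dz f (z, r)) (at z)"
    by (simp add: has_field_derivative_def mult_commute_abs)
  have "((\<lambda>r. f (z, r)) has_derivative (\<lambda>h. Dz f (z, r) * fst (0::real, h) + Dr f (z, r) * snd (0::real, h))) (at r)"
    by (rule has_derivative_compose[of "\<lambda>r. (z, r)" "\<lambda>h. (0, h)", OF _ d]) (auto intro!: derivative_eq_intros)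
  then show "((\<lambda>r. f (z, r)) has_real_derivative Dr f (z, r)) (at r)"
    by (simp add: has_field_derivative_def mult_commute_abs)
qed

lemma smooth_periodic_D:
  assumes f: "smooth_on half_plane f" and per: "\<And>z r. 0 < r \<Longrightarrow> f (z + L, r) = f (z, r)" and r: "0 < r"
  shows "Dz f (z + L, r) = Dz f (z, r)" "Dr f (z + L, r) = Dr f (z, r)"
proof -
  have "(f has_derivative (\<lambda>h. Dz f (z + L, r) * fst h + Dr f (z + L, r) * snd h)) (at ((z, r) + (L, 0)))"
    using f r by (simp add: smooth_has_derivative)
  moreover have "((\<lambda>q. q + (L, 0)) has_derivative (\<lambda>h. h)) (at (z, r))"
    by (auto intro!: derivative_eq_intros)
  ultimately have "((\<lambda>q. f (q + (L, 0))) has_derivative (\<lambda>h. Dz f (z + L, r) * fst h + Dr f (z + L, r) * snd h)) (at (z, r))"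
    by (rule has_derivative_compose[rotated])
  then have "(f has_derivative (\<lambda>h. Dz f (z + L, r) * fst h + Dr f (z + L, r) * snd h)) (at (z, r))"
    by (rule has_derivative_transform_within_open[OF _ open_half_plane]) (use r per in \<open>auto simp: split_beta\<close>)
  from has_derivative_Dz_Dr_unique[OF this] show "Dz f (z + L, r) = Dz f (z, r)" "Dr f (z + L, r) = Dr f (z, r)"
    by simp_all
qed

lemma second_difference_mean_value:
  assumes f: "smooth_on half_plane f" and h: "0 < h" and r: "0 < r"
  obtains z' r' where "z < z'" "z' < z + h" "r < r'" "r' < r + h"
    "f (z + h, r + h) - f (z + h, r) - f (z, r + h) + f (z, r) = h * h * Dr (Dz f) (z', r')"
proof -
  let ?\<phi> = "\<lambda>t. f (t, r + h) - f (t, r)"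
  have "DERIV ?\<phi> t :> Dz f (t, r + h) - Dz f (t, r)" for t
    using h r by (intro DERIV_diff smooth_has_real_derivative f) auto
  then obtain z' where z': "z < z'" "z' < z + h" "?\<phi> (z + h) - ?\<phi> z = (z + h - z) * (Dz f (z', r + h) - Dz f (z', r))"
    using MVT2[of z "z + h" ?\<phi> "\<lambda>t. Dz f (t, r + h) - Dz f (t, r)"] h by auto
  have "DERIV (\<lambda>t. Dz f (z', t)) t :> Dr (Dz f) (z', t)" if "r \<le> t" for t
    using that r by (intro smooth_has_real_derivative smooth_on_Dz f) auto
  then obtain r' where r': "r < r'" "r' < r + h" "Dz f (z', r + h) - Dz f (z', r) = (r + h - r) * Dr (Dz f) (z', r')"
    using MVT2[of r "r + h" "\<lambda>t. Dz f (z', t)" "\<lambda>t. Dr (Dz f) (z', t)"] h by auto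
  show thesis
    using that[OF z'(1,2) r'(1,2)] z'(3) r'(3) by (simp add: algebra_simps)
qed

lemma second_difference_mean_value':
  assumes f: "smooth_on half_plane f" and h: "0 < h" and r: "0 < r"
  obtains z' r' where "z < z'" "z' < z + h" "r < r'" "r' < r + h"
    "f (z + h, r + h) - f (z + h, r) - f (z, r + h) + f (z, r) = h * h * Dz (Dr f) (z', r')"
proof -
  let ?\<phi> = "\<lambda>t. f (z + h, t) - f (z, t)"
  have "DERIV ?\<phi> t :> Dr f (z + h, t) - Dr f (z, t)" if "r \<le> t" for t
    using h r that by (intro DERIV_diff smooth_has_real_derivative f) auto
  then obtain r' where r': "r < r'" "r' < r + h" "?\<phi> (r + h) - ?\<phi> r = (r + h - r) * (Dr f (z + h, r') - Dr f (z, r'))"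
    using MVT2[of r "r + h" ?\<phi> "\<lambda>t. Dr f (z + h, t) - Dr f (z, t)"] h by auto
  have "DERIV (\<lambda>t. Dr f (t, r')) t :> Dz (Dr f) (t, r')" for t
    using r' r by (intro smooth_has_real_derivative smooth_on_Dr f) auto
  then obtain z' where z': "z < z'" "z' < z + h" "Dr f (z + h, r') - Dr f (z, r') = (z + h - z) * Dz (Dr f) (z', r')"
    using MVT2[of z "z + h" "\<lambda>t. Dr f (t, r')" "\<lambda>t. Dz (Dr f) (t, r')"] h by auto
  show thesis
    using that[OF z'(1,2) r'(1,2)] z'(3) r'(3) by (simp add: algebra_simps)
qed

text \<open>Both mixed derivatives, taken at suitable points of a small square, equal the same
  second difference divided by \<open>h * h\<close>; continuity then forbids different values at the
  corner.\<close>

lemma mixed_partials_commute: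
  assumes f: "smooth_on half_plane f" and r: "0 < r"
  shows "Dr (Dz f) (z, r) = Dz (Dr f) (z, r)"
proof (rule ccontr)
  assume ne: "Dr (Dz f) (z, r) \<noteq> Dz (Dr f) (z, r)"
  define e where "e = dist (Dr (Dz f) (z, r)) (Dz (Dr f) (z, r))/2"
  have e: "0 < e" using ne by (simp add: e_def)
  have "isCont (Dr (Dz f)) (z, r)" "isCont (Dz (Dr f)) (z, r)"
    using smooth_on_continuous[OF smooth_on_Dr[OF smooth_on_Dz[OF f]]]
      smooth_on_continuous[OF smooth_on_Dz[OF smooth_on_Dr[OF f]]] r
    by (simp_all add: continuous_on_eq_continuous_at[OF open_half_plane])
  then obtain d1 d2 where d: "0 < d1" "\<And>q. dist q (z, r) < d1 \<Longrightarrow> dist (Dr (Dz f) q) (Dr (Dz f) (z, r)) < e"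
     "0 < d2" "\<And>q. dist q (z, r) < d2 \<Longrightarrow> dist (Dz (Dr f) q) (Dz (Dr f) (z, r)) < e"
    using e unfolding continuous_at_eps_delta by metis
  define h where "h = min d1 d2/2"
  have h: "0 < h" using d by (simp add: h_def)
  have near: "dist (z', r') (z, r) < min d1 d2" if "z < z'" "z' < z + h" "r < r'" "r' < r + h" for z' r'
  proof -
    have "dist (z', r') (z, r) \<le> dist z' z + dist r' r"
      unfolding dist_Pair_Pair by (rule sqrt_sum_squares_le_sum) auto
    also have "\<dots> < h + h"
      using that by (simp add: dist_real_def)
    finally show ?thesis by (simp add: h_def)
  qed
  obtain z1 r1 where 1: "z < z1" "z1 < z + h" "r < r1" "r1 < r + h"
    "f (z + h, r + h) - f (z + h, r) - f (z, r + h) + f (z, r) = h * h * Dr (Dz f) (z1, r1)"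
    using second_difference_mean_value[OF f h r] .
  obtain z2 r2 where 2: "z < z2" "z2 < z + h" "r < r2" "r2 < r + h"
    "f (z + h, r + h) - f (z + h, r) - f (z, r + h) + f (z, r) = h * h * Dz (Dr f) (z2, r2)"
    using second_difference_mean_value'[OF f h r] .
  have "Dr (Dz f) (z1, r1) = Dz (Dr f) (z2, r2)"
    using 1(5) 2(5) h by simp
  moreover have "dist (Dr (Dz f) (z1, r1)) (Dr (Dz f) (z, r)) < e"
    using near[OF 1(1-4)] by (intro d(2)) auto
  moreover have "dist (Dz (Dr f) (z2, r2)) (Dz (Dr f) (z, r)) < e"
    using near[OF 2(1-4)] by (intro d(4)) auto
  ultimately show False
    unfolding e_def using dist_triangle_half_r less_irrefl by metis
qed

section \<open>Completeness forces a nonnegative flux\<close>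

lemma has_derivative_half_plane_complex:
  assumes "smooth_on half_plane f" "0 < Im w"
  shows "((\<lambda>w. f (Re w, Im w)) has_derivative (\<lambda>v. Dz f (Re w, Im w) * Re v + Dr f (Re w, Im w) * Im v)) (at w)"
proof -
  have "((\<lambda>w. (Re w, Im w)) has_derivative (\<lambda>v. (Re v, Im v))) (at w)"
    by (auto intro!: derivative_eq_intros)
  from has_derivative_compose[OF this smooth_has_derivative[OF assms(1)]] assms(2)
  show ?thesis by simp
qed

lemma continuous_half_plane_complex:
  assumes "smooth_on half_plane f"
  shows "continuous_on {w. 0 < Im w} (\<lambda>w. f (Re w, Im w))"
  by (rule continuous_on_compose2[OF smooth_on_continuous[OF assms]]) (auto intro!: continuous_intros)

lemma complete_imp_flux_nonneg:
  fixes \<gamma> :: "real \<times> real \<Rightarrow> real"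
  assumes L: "0 < L" and \<gamma>: "smooth_on half_plane \<gamma>"
    and per: "\<And>z r. 0 < r \<Longrightarrow> \<gamma> (z + L, r) = \<gamma> (z, r)"
    and superharmonic: "\<And>z r. 0 < r \<Longrightarrow> Dz (Dz \<gamma>) (z, r) + Dr (Dr \<gamma>) (z, r) \<le> 0"
    and complete: "q_complete_at_infinity L \<gamma>" and r: "0 < r"
  shows "0 \<le> integral {-L/2..L/2} (\<lambda>z. Dr \<gamma> (z, r))"
proof (rule ccontr)
  assume "\<not> ?thesis"
  then have neg: "integral {-L/2..L/2} (\<lambda>z. Dr \<gamma> (z, r)) < 0" by simp
  note sz = smooth_on_Dz[OF \<gamma>] and sr = smooth_on_Dr[OF \<gamma>]
  note szz = smooth_on_Dz[OF sz] and szr = smooth_on_Dr[OF sz] and srr = smooth_on_Dr[OF sr]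
  have perz: "Dz \<gamma> (z + L, y) = Dz \<gamma> (z, y)" and perr: "Dr \<gamma> (z + L, y) = Dr \<gamma> (z, y)" if "0 < y" for z y
    using smooth_periodic_D[of \<gamma> L y z] \<gamma> per that by blast+
  have perzz: "Dz (Dz \<gamma>) (z + L, y) = Dz (Dz \<gamma>) (z, y)" and perzr: "Dr (Dz \<gamma>) (z + L, y) = Dr (Dz \<gamma>) (z, y)"
    and perrr: "Dr (Dr \<gamma>) (z + L, y) = Dr (Dr \<gamma>) (z, y)" if "0 < y" for z y
    using smooth_periodic_D[of "Dz \<gamma>" L y z] smooth_periodic_D[of "Dr \<gamma>" L y z] sz sr perz perr that by blast+
  have "continuous_on UNIV (\<lambda>z. Dr \<gamma> (z, r))"
    by (rule continuous_on_compose2[OF smooth_on_continuous[OF sr]]) (use r in \<open>auto intro!: continuous_intros\<close>)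
  then obtain G :: "complex poly" where G:
    "\<And>x. Dr \<gamma> (x, r) < 2 * pi/L * Re (cis (2 * pi/L * x) * poly (pderiv G) (cis (2 * pi/L * x)))"
    using harmonic_neumann_correction[OF L _ perr[OF r] neg] by blast
  define \<omega> where "\<omega> = 2 * pi/L"
  have \<omega>: "0 < \<omega>" "\<omega> * L = 2 * pi" using L by (auto simp: \<omega>_def)
  \<comment> \<open>Holomorphic and \<open>L\<close>-periodic, of modulus one on the circle at
    height \<open>r\<close>, where it equals \<open>cis (\<omega> * Re w)\<close>, and at most one
    above it.\<close>
  define E where "E w = exp (\<i> * (of_real \<omega> * (w - \<i> * of_real r)))" for w
  \<comment> \<open>The chain rule: differentiating a polynomial in \<open>E\<close> with respect to
    \<open>w\<close> acts as \<open>D\<close> on the polynomial.\<close>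
  define D where "D Q = smult (\<i> * of_real \<omega>) (pCons 0 (pderiv Q))" for Q
  have dE: "(E has_field_derivative \<i> * of_real \<omega> * E w) (at w)" for w
    unfolding E_def[abs_def] by (auto intro!: derivative_eq_intros)
  have dQ: "((\<lambda>w. poly Q (E w)) has_field_derivative poly (D Q) (E w)) (at w)" for Q w
    using DERIV_chain2[OF poly_DERIV dE, of Q w] by (simp add: D_def algebra_simps)
  have EL: "E (w + of_real L) = E w" for w
  proof -
    have "\<i> * (of_real \<omega> * (w + of_real L - \<i> * of_real r)) = \<i> * (of_real \<omega> * (w - \<i> * of_real r)) + of_real (\<omega> * L) * \<i>"
      by (simp add: algebra_simps)
    then show ?thesis
      unfolding E_def \<omega>(2) by (simp add: exp_add)
  qed
  have nE: "norm (E w) \<le> 1" if "r \<le> Im w" for w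
    using that \<omega> by (simp add: E_def)
  have cE: "continuous_on S (\<lambda>w. poly Q (E w))" for S Q
    using DERIV_isCont[OF dQ] by (simp add: continuous_at_imp_continuous_on)
  define H where "H w = poly G (E w)" for w
  define g where "g w = \<gamma> (Re w, Im w) + Re (H w)" for w
  define p where "p w = of_real (Dz \<gamma> (Re w, Im w)) - \<i> * of_real (Dr \<gamma> (Re w, Im w)) + poly (D G) (E w)" for w
  define s where "s w = of_real ((Dz (Dz \<gamma>) (Re w, Im w) - Dr (Dr \<gamma>) (Re w, Im w))/2)
      - \<i> * of_real (Dr (Dz \<gamma>) (Re w, Im w)) + poly (D (D G)) (E w)" for w
  \<comment> \<open>\<open>Re H\<close> is harmonic and contributes nothing here.\<close>
  define \<kappa> where "\<kappa> w = (Dz (Dz \<gamma>) (Re w, Im w) + Dr (Dr \<gamma>) (Re w, Im w))/2" for w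
  note intro_cont = continuous_half_plane_complex[OF \<gamma>] continuous_half_plane_complex[OF szz]
    continuous_half_plane_complex[OF szr] continuous_half_plane_complex[OF srr]
  interpret conformal_superharmonic L g p s \<kappa>
  proof
    fix w assume w: "0 < Im w"
    have "(H has_derivative (\<lambda>v. poly (D G) (E w) * v)) (at w)"
      using dQ[of G w] by (simp add: H_def[abs_def] has_field_derivative_def)
    from has_derivative_add[OF has_derivative_half_plane_complex[OF \<gamma> w] has_derivative_Re[OF this]]
    show "(g has_derivative (\<lambda>v. Re (p w * v))) (at w)"
      unfolding g_def[abs_def] by (rule has_derivative_eq_rhs) (simp add: p_def fun_eq_iff algebra_simps)
    have "((\<lambda>w. of_real (Dz \<gamma> (Re w, Im w)) - \<i> * of_real (Dr \<gamma> (Re w, Im w)) + poly (D G) (E w)) has_derivative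
        (\<lambda>v. of_real (Dz (Dz \<gamma>) (Re w, Im w) * Re v + Dr (Dz \<gamma>) (Re w, Im w) * Im v)
         - \<i> * of_real (Dz (Dr \<gamma>) (Re w, Im w) * Re v + Dr (Dr \<gamma>) (Re w, Im w) * Im v) + poly (D (D G)) (E w) * v)) (at w)"
      using dQ[of "D G" w] unfolding has_field_derivative_def
      by (intro has_derivative_add has_derivative_diff has_derivative_mult_right has_derivative_of_real
           has_derivative_half_plane_complex sz sr w)
    then show "(p has_derivative (\<lambda>v. s w * v + of_real (\<kappa> w) * cnj v)) (at w)"
      unfolding p_def[abs_def]
      by (rule has_derivative_eq_rhs)
         (simp add: s_def \<kappa>_def fun_eq_iff complex_eq_iff mixed_partials_commute[OF \<gamma> w] field_simps)
    show "g (w + of_real L) = g w" "p (w + of_real L) = p w" "s (w + of_real L) = s w" "\<kappa> (w + of_real L) = \<kappa> w"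
      using w by (simp_all add: g_def p_def s_def \<kappa>_def H_def EL per perz perr perzz perzr perrr)
    show "\<kappa> w \<le> 0"
      using superharmonic[OF w, of "Re w"] by (simp add: \<kappa>_def)
  next
    show "continuous_on {w. 0 < Im w} s" "continuous_on {w. 0 < Im w} \<kappa>"
      unfolding s_def[abs_def] \<kappa>_def[abs_def] by (intro continuous_intros intro_cont cE; simp)+
  qed (rule L)
  have "0 < Im (p w)" if w: "Im w = r" for w
  proof -
    have "w - \<i> * of_real r = of_real (Re w)"
      using w by (simp add: complex_eq_iff)
    then have "E w = cis (\<omega> * Re w)"
      by (simp add: E_def cis_conv_exp)
    then have "Im (poly (D G) (E w)) = \<omega> * Re (cis (\<omega> * Re w) * poly (pderiv G) (cis (\<omega> * Re w)))"
      by (simp add: D_def algebra_simps)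
    then show ?thesis
      using G[of "Re w"] w by (simp add: p_def \<omega>_def)
  qed
  then obtain K where K: "\<And>R. r < R \<Longrightarrow> width r R \<le> K"
    using width_bounded[OF r] by blast
  \<comment> \<open>Boundedness of \<open>H\<close> above the circle makes lengths for
    \<open>g\<close> and for \<gamma> comparable; completeness is assumed for the latter
    metric.\<close>
  obtain B where B: "\<And>w. r \<le> Im w \<Longrightarrow> norm (H w) \<le> B"
  proof -
    have "compact (poly G ` cball 0 1)"
      by (intro compact_continuous_image continuous_intros compact_cball)
    then obtain B where "\<And>u. norm u \<le> 1 \<Longrightarrow> norm (poly G u) \<le> B"
      by (force dest!: compact_imp_bounded simp: bounded_iff)
    then show thesis using that nE unfolding H_def by blast
  qed
  let ?\<gamma> = "\<lambda>w. \<gamma> (Re w, Im w)"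
  have sub: "{w. r \<le> Im w} \<subseteq> {w. 0 < Im w}" using r by auto
  note \<gamma>c = continuous_on_subset[OF continuous_half_plane_complex[OF \<gamma>] sub]
  have \<gamma>per: "?\<gamma> (w + of_real L) = ?\<gamma> w" if "r \<le> Im w" for w
    using per[of "Im w" "Re w"] that r by simp
  obtain M where M: "0 < M" "\<And>w. r \<le> Im w \<Longrightarrow> Im w \<le> r \<Longrightarrow> norm (exp (?\<gamma> w)) \<le> M"
    by (rule periodic_strip_bounded[OF L continuous_on_exp[OF \<gamma>c], of r]) (use \<gamma>per in auto)
  define x0 where "x0 = Complex 0 r"
  \<comment> \<open>Crossings may start anywhere on the circle. Translation by a multiple of
    \<open>L\<close> and a horizontal segment of cost at most \<open>M * L\<close> let all of them
    start at \<open>x0\<close>.\<close>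
  have esc: "\<exists>y l. real n \<le> Im y \<and> conformal_connected ?\<gamma> r x0 y l \<and> l \<le> M * L + exp B * (K + 1)" for n :: nat
  proof -
    define R where "R = max (real n) (r + 1)"
    have R: "r < R" "real n \<le> R" by (auto simp: R_def)
    have "width r R < K + 1"
      using K[OF R(1)] by simp
    then obtain l where l: "l \<in> crossing_lengths r R" "l < K + 1"
      using cInf_lessD[OF crossing_lengths_nonempty[OF r R(1)]] unfolding width_def by blast
    then obtain a b c c' where c: "C1_arc a b c c'" "\<forall>t\<in>{a..b}. r \<le> Im (c t) \<and> Im (c t) \<le> R"
      "Im (c a) = r" "Im (c b) = R" "l = arc_length g a b c c'"
      unfolding crossing_lengths_def by blast
    have "a \<noteq> b" using c(3,4) R(1) by auto
    then have ab: "a < b" using c(1) by (simp add: C1_arc_def)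
    let ?l = "integral {a..b} (\<lambda>t. exp (?\<gamma> (c t)) * norm (c' t))"
    have conn: "conformal_connected ?\<gamma> r (c a) (c b) ?l"
      by (rule conformal_connected_C1[OF ab _ _ _ \<gamma>c]) (use c(1,2) in \<open>auto simp: C1_arc_def\<close>)
    have "?l \<le> integral {a..b} (\<lambda>t. exp B * (exp (g (c t)) * norm (c' t)))"
    proof (rule Henstock_Kurzweil_Integration.integral_le)
      have cc: "continuous_on {a..b} c" "continuous_on {a..b} c'"
        using C1_arc_continuous[OF c(1)] c(1) by (auto simp: C1_arc_def)
      have pos: "c t \<in> {w. r \<le> Im w}" "c t \<in> {w. 0 < Im w}" if "t \<in> {a..b}" for t
        using c(2) that r by force+
      show "(\<lambda>t. exp (?\<gamma> (c t)) * norm (c' t)) integrable_on {a..b}"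
        using pos by (intro integrable_continuous_real continuous_intros continuous_on_compose2[OF \<gamma>c cc(1)] cc(2)) auto
      show "(\<lambda>t. exp B * (exp (g (c t)) * norm (c' t))) integrable_on {a..b}"
        using pos by (intro integrable_continuous_real continuous_intros continuous_on_compose2[OF g_cont cc(1)] cc(2)) auto
      fix t assume t: "t \<in> {a..b}"
      have "\<bar>Re (H (c t))\<bar> \<le> B"
        using abs_Re_le_cmod[of "H (c t)"] B[of "c t"] c(2) t by force
      then have "exp (?\<gamma> (c t)) \<le> exp B * exp (g (c t))"
        by (simp add: g_def flip: exp_add)
      then show "exp (?\<gamma> (c t)) * norm (c' t) \<le> exp B * (exp (g (c t)) * norm (c' t))"
        by (simp only: mult.assoc[symmetric]) (rule mult_right_mono, auto)
    qed
    also have "\<dots> = exp B * l"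
      by (simp add: c(5) arc_length_def)
    also have "\<dots> \<le> exp B * (K + 1)"
      using l(2) by (intro mult_left_mono) auto
    finally have l': "?l \<le> exp B * (K + 1)" .
    obtain k :: int where k: "0 \<le> Re (c a) + of_int k * L" "Re (c a) + of_int k * L \<le> L"
      using ex_shift_to_fundamental_domain[OF L] .
    let ?T = "of_int k * L"
    have perk: "?\<gamma> (w + of_real ?T) = ?\<gamma> w" if "r \<le> Im w" for w
      using periodic_of_int[of r ?\<gamma> L w k] \<gamma>per that by blast
    have c0: "Im (c a + of_real ?T) = r" using c(3) by simp
    obtain h where h: "conformal_connected ?\<gamma> r x0 (c a + of_real ?T) h" "h \<le> M * dist x0 (c a + of_real ?T)"
    proof (rule conformal_connected_line[OF \<gamma>c])
      have seg: "closed_segment x0 (c a + of_real ?T) \<subseteq> {w. r \<le> Im w} \<inter> {w. Im w \<le> r}"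
        by (rule closed_segment_subset)
           (use c0 in \<open>auto simp: x0_def intro!: convex_Int convex_halfspace_Im_ge convex_halfspace_Im_le\<close>)
      fix w assume "w \<in> closed_segment x0 (c a + of_real ?T)"
      with seg have "r \<le> Im w" "Im w \<le> r" by blast+
      then show "exp (?\<gamma> w) \<le> M"
        using M(2)[of w] by simp
    qed (use c0 in \<open>auto simp: x0_def\<close>)
    have "dist x0 (c a + of_real ?T) \<le> L"
    proof -
      have "x0 - (c a + of_real ?T) = of_real (- (Re (c a) + ?T))"
        using c0 by (simp add: x0_def complex_eq_iff)
      then have "dist x0 (c a + of_real ?T) = \<bar>Re (c a) + ?T\<bar>"
        unfolding dist_norm by (simp only: norm_of_real abs_minus_cancel)
      then show ?thesis using k by simp
    qed
    then have "h \<le> M * L"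
      using h(2) M(1) mult_left_mono[of "dist x0 (c a + of_real ?T)" L M] by linarith
    then show ?thesis
      using conformal_connected_trans[OF h(1) conformal_connected_shift[OF conn perk]] l' c(4) R(2)
      by (intro exI[of _ "c b + of_real ?T"] exI[of _ "h + ?l"]) auto
  qed
  obtain x l where x: "\<And>n::nat. Im (x n) = Im x0 + real n"
    "\<And>n. conformal_connected ?\<gamma> r (x n) (x (Suc n)) (l n)" "summable l"
    using bounded_escape_imp_ray[OF L \<gamma>c \<gamma>per esc] by metis
  show False
    by (rule q_complete_imp_no_finite_ray[OF complete r L continuous_half_plane_complex[OF \<gamma>] per x])
qed

section \<open>The vacuum equations\<close>

lemma vec4_component_has_derivative:
  assumes "(f has_derivative (\<lambda>h. a * fst h + b * snd h)) (at (x $ 3, x $ 4))"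
  shows "((\<lambda>y :: real ^ 4. f (y $ 3, y $ 4)) has_derivative (\<lambda>h. a * h $ 3 + b * h $ 4)) (at x)"
proof -
  have "((\<lambda>y :: real ^ 4. (y $ 3, y $ 4)) has_derivative (\<lambda>h. (h $ 3, h $ 4))) (at x)"
    by (intro has_derivative_Pair bounded_linear.has_derivative[OF bounded_linear_vec_nth] has_derivative_ident)
  from has_derivative_compose[OF this assms] show ?thesis by simp
qed

lemma open_upper_half_4: "open {y :: real ^ 4. 0 < y $ 4}"
  by (intro open_Collect_less continuous_intros)

lemma pd_of_half_plane_function:
  assumes F: "\<And>y :: real ^ 4. 0 < y $ 4 \<Longrightarrow> F y = f (y $ 3, y $ 4)"
    and f: "(f has_derivative (\<lambda>h. a * fst h + b * snd h)) (at (x $ 3, x $ 4))" and x: "0 < x $ 4"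
  shows "pd 1 F x = 0" "pd 2 F x = 0" "pd 3 F x = a" "pd 4 F x = b"
proof -
  have "(F has_derivative (\<lambda>h. a * h $ 3 + b * h $ 4)) (at x)"
    by (rule has_derivative_transform_within_open[OF vec4_component_has_derivative[OF f] open_upper_half_4])
       (use x F in auto)
  from frechet_derivative_at[OF this, symmetric]
  show "pd 1 F x = 0" "pd 2 F x = 0" "pd 3 F x = a" "pd 4 F x = b"
    by (simp_all add: pd_def axis_def)
qed

lemma pd_zero: "(\<And>y :: real ^ 4. 0 < y $ 4 \<Longrightarrow> F y = 0) \<Longrightarrow> 0 < x $ 4 \<Longrightarrow> pd i F x = 0"
  using pd_of_half_plane_function[of F "\<lambda>_. 0" 0 0 x] exhaust_4[of i] by auto

locale weyl_papapetrou =
  fixes V W \<eta> \<gamma> :: "real \<times> real \<Rightarrow> real"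
  assumes smooth: "smooth_on half_plane V" "smooth_on half_plane W" "smooth_on half_plane \<eta>" "smooth_on half_plane \<gamma>"
    and eta_pos: "\<And>z r. 0 < r \<Longrightarrow> 0 < \<eta> (z, r)"
    and gram: "\<And>z r. 0 < r \<Longrightarrow> V (z, r) * \<eta> (z, r) + (W (z, r))\<^sup>2 = r\<^sup>2"
begin

abbreviation "g \<equiv> spacetime_metric V W \<eta> \<gamma>"

definition A :: "real \<times> real \<Rightarrow> real" where "A q = exp (2 * \<gamma> q) / \<eta> q"

text \<open>The block of the two Killing directions has determinant \<open>- \<rho>\<^sup>2\<close>
  by the Gram relation, hence the denominators.\<close>

definition ginv :: "real ^ 4 \<Rightarrow> real ^ 4 ^ 4" where
  "ginv x = (let q = (x $ 3, x $ 4) in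
     vector [vector [- \<eta> q / (x $ 4)\<^sup>2, W q / (x $ 4)\<^sup>2, 0, 0],
             vector [W q / (x $ 4)\<^sup>2, V q / (x $ 4)\<^sup>2, 0, 0],
             vector [0, 0, 1 / A q, 0],
             vector [0, 0, 0, 1 / A q]])"

lemma A_pos: "0 < r \<Longrightarrow> 0 < A (z, r)"
  using eta_pos by (simp add: A_def)

lemma g_components:
  "g x $ 1 $ 1 = - V (x $ 3, x $ 4)" "g x $ 1 $ 2 = W (x $ 3, x $ 4)" "g x $ 1 $ 3 = 0" "g x $ 1 $ 4 = 0"
  "g x $ 2 $ 1 = W (x $ 3, x $ 4)" "g x $ 2 $ 2 = \<eta> (x $ 3, x $ 4)" "g x $ 2 $ 3 = 0" "g x $ 2 $ 4 = 0"
  "g x $ 3 $ 1 = 0" "g x $ 3 $ 2 = 0" "g x $ 3 $ 3 = A (x $ 3, x $ 4)" "g x $ 3 $ 4 = 0"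
  "g x $ 4 $ 1 = 0" "g x $ 4 $ 2 = 0" "g x $ 4 $ 3 = 0" "g x $ 4 $ 4 = A (x $ 3, x $ 4)"
  by (simp_all add: spacetime_metric_def A_def Let_def)

lemma ginv_components [simp]:
  "ginv x $ 1 $ 1 = - \<eta> (x $ 3, x $ 4) / (x $ 4)\<^sup>2" "ginv x $ 1 $ 2 = W (x $ 3, x $ 4) / (x $ 4)\<^sup>2" "ginv x $ 1 $ 3 = 0" "ginv x $ 1 $ 4 = 0"
  "ginv x $ 2 $ 1 = W (x $ 3, x $ 4) / (x $ 4)\<^sup>2" "ginv x $ 2 $ 2 = V (x $ 3, x $ 4) / (x $ 4)\<^sup>2" "ginv x $ 2 $ 3 = 0" "ginv x $ 2 $ 4 = 0"
  "ginv x $ 3 $ 1 = 0" "ginv x $ 3 $ 2 = 0" "ginv x $ 3 $ 3 = 1 / A (x $ 3, x $ 4)" "ginv x $ 3 $ 4 = 0"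
  "ginv x $ 4 $ 1 = 0" "ginv x $ 4 $ 2 = 0" "ginv x $ 4 $ 3 = 0" "ginv x $ 4 $ 4 = 1 / A (x $ 3, x $ 4)"
  by (simp_all add: ginv_def Let_def)

lemma matrix_inv_g:
  assumes x: "0 < x $ 4"
  shows "matrix_inv (g x) = ginv x"
proof -
  have gr: "V (x $ 3, x $ 4) * \<eta> (x $ 3, x $ 4) + W (x $ 3, x $ 4) * W (x $ 3, x $ 4) = x $ 4 * x $ 4"
    using gram[OF x, of "x $ 3"] by (simp add: power2_eq_square)
  have 1: "g x ** ginv x = mat 1"
    using A_pos[OF x, of "x $ 3"] x gr
    by (simp add: vec_eq_iff forall_4 matrix_matrix_mult_def sum_4 mat_def g_components power2_eq_square field_simps)
  have 2: "ginv x ** g x = mat 1"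
    using 1 matrix_left_right_inverse by blast
  show ?thesis
    unfolding matrix_inv_def
  \<comment> \<open>\<open>matrix_inv\<close> is defined by choice, so uniqueness of the two-sided
    inverse has to be supplied.\<close>
  proof (rule some_equality)
    fix B assume B: "g x ** B = mat 1 \<and> B ** g x = mat 1"
    then show "B = ginv x"
      by (metis 1 matrix_mul_assoc matrix_mul_lid matrix_mul_rid)
  qed (use 1 2 in blast)
qed

text \<open>\<open>cz\<close> and \<open>cr\<close> are half the logarithmic derivatives of the
  conformal factor \<open>A\<close>; up to sign they are the Christoffel symbols with all indices in
  {3, 4}.\<close>

definition cz :: "real \<times> real \<Rightarrow> real" where "cz q = Dz \<gamma> q - Dz \<eta> q / (2 * \<eta> q)"
definition cr :: "real \<times> real \<Rightarrow> real" where "cr q = Dr \<gamma> q - Dr \<eta> q / (2 * \<eta> q)"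

lemma smooth_hd:
  assumes "smooth_on half_plane f" "0 < r"
  shows "(f has_derivative (\<lambda>h. Dz f (z, r) * fst h + Dr f (z, r) * snd h)) (at (z, r))"
  using smooth_has_derivative[OF assms(1), of "(z, r)"] assms(2) by simp

lemma A_has_derivative:
  assumes r: "0 < r"
  shows "(A has_derivative (\<lambda>h. (2 * A (z, r) * cz (z, r)) * fst h + (2 * A (z, r) * cr (z, r)) * snd h)) (at (z, r))"
  unfolding A_def[abs_def]
  by (rule has_derivative_eq_rhs, (rule derivative_intros smooth_hd[OF smooth(4) r] smooth_hd[OF smooth(3) r])+)
     (use eta_pos[OF r, of z] in \<open>auto simp: fun_eq_iff cz_def cr_def field_simps power2_eq_square\<close>)

lemma pd_g_components:
  assumes x: "0 < x $ 4"
  shows "pd 3 (\<lambda>y. g y $ 1 $ 1) x = - Dz V (x $ 3, x $ 4)" "pd 4 (\<lambda>y. g y $ 1 $ 1) x = - Dr V (x $ 3, x $ 4)"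
    "pd 3 (\<lambda>y. g y $ 1 $ 2) x = Dz W (x $ 3, x $ 4)" "pd 4 (\<lambda>y. g y $ 1 $ 2) x = Dr W (x $ 3, x $ 4)"
    "pd 3 (\<lambda>y. g y $ 2 $ 1) x = Dz W (x $ 3, x $ 4)" "pd 4 (\<lambda>y. g y $ 2 $ 1) x = Dr W (x $ 3, x $ 4)"
    "pd 3 (\<lambda>y. g y $ 2 $ 2) x = Dz \<eta> (x $ 3, x $ 4)" "pd 4 (\<lambda>y. g y $ 2 $ 2) x = Dr \<eta> (x $ 3, x $ 4)"
    "pd 3 (\<lambda>y. g y $ 3 $ 3) x = 2 * A (x $ 3, x $ 4) * cz (x $ 3, x $ 4)"
    "pd 4 (\<lambda>y. g y $ 3 $ 3) x = 2 * A (x $ 3, x $ 4) * cr (x $ 3, x $ 4)"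
    "pd 3 (\<lambda>y. g y $ 4 $ 4) x = 2 * A (x $ 3, x $ 4) * cz (x $ 3, x $ 4)"
    "pd 4 (\<lambda>y. g y $ 4 $ 4) x = 2 * A (x $ 3, x $ 4) * cr (x $ 3, x $ 4)"
    "pd 1 (\<lambda>y. g y $ i $ j) x = 0" "pd 2 (\<lambda>y. g y $ i $ j) x = 0"
    "pd k (\<lambda>y. g y $ 1 $ 3) x = 0" "pd k (\<lambda>y. g y $ 1 $ 4) x = 0" "pd k (\<lambda>y. g y $ 2 $ 3) x = 0" "pd k (\<lambda>y. g y $ 2 $ 4) x = 0"
    "pd k (\<lambda>y. g y $ 3 $ 1) x = 0" "pd k (\<lambda>y. g y $ 4 $ 1) x = 0" "pd k (\<lambda>y. g y $ 3 $ 2) x = 0" "pd k (\<lambda>y. g y $ 4 $ 2) x = 0"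
    "pd k (\<lambda>y. g y $ 3 $ 4) x = 0" "pd k (\<lambda>y. g y $ 4 $ 3) x = 0"
proof -
  have mV: "((\<lambda>q. - V q) has_derivative (\<lambda>h. (- Dz V (z, r)) * fst h + (- Dr V (z, r)) * snd h)) (at (z, r))" if "0 < r" for z r
    by (rule has_derivative_eq_rhs[OF has_derivative_minus[OF smooth_hd[OF smooth(1) that]]]) (simp add: fun_eq_iff)
  note 11 = pd_of_half_plane_function[of "\<lambda>y. g y $ 1 $ 1" "\<lambda>q. - V q", OF _ mV[OF x] x]
  note 12 = pd_of_half_plane_function[of "\<lambda>y. g y $ 1 $ 2" W, OF _ smooth_hd[OF smooth(2) x] x]
  note 21 = pd_of_half_plane_function[of "\<lambda>y. g y $ 2 $ 1" W, OF _ smooth_hd[OF smooth(2) x] x]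
  note 22 = pd_of_half_plane_function[of "\<lambda>y. g y $ 2 $ 2" \<eta>, OF _ smooth_hd[OF smooth(3) x] x]
  note 33 = pd_of_half_plane_function[of "\<lambda>y. g y $ 3 $ 3" A, OF _ A_has_derivative[OF x] x]
  note 44 = pd_of_half_plane_function[of "\<lambda>y. g y $ 4 $ 4" A, OF _ A_has_derivative[OF x] x]
  show *: "pd 3 (\<lambda>y. g y $ 1 $ 1) x = - Dz V (x $ 3, x $ 4)" "pd 4 (\<lambda>y. g y $ 1 $ 1) x = - Dr V (x $ 3, x $ 4)"
    "pd 3 (\<lambda>y. g y $ 1 $ 2) x = Dz W (x $ 3, x $ 4)" "pd 4 (\<lambda>y. g y $ 1 $ 2) x = Dr W (x $ 3, x $ 4)"
    "pd 3 (\<lambda>y. g y $ 2 $ 1) x = Dz W (x $ 3, x $ 4)" "pd 4 (\<lambda>y. g y $ 2 $ 1) x = Dr W (x $ 3, x $ 4)"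
    "pd 3 (\<lambda>y. g y $ 2 $ 2) x = Dz \<eta> (x $ 3, x $ 4)" "pd 4 (\<lambda>y. g y $ 2 $ 2) x = Dr \<eta> (x $ 3, x $ 4)"
    "pd 3 (\<lambda>y. g y $ 3 $ 3) x = 2 * A (x $ 3, x $ 4) * cz (x $ 3, x $ 4)"
    "pd 4 (\<lambda>y. g y $ 3 $ 3) x = 2 * A (x $ 3, x $ 4) * cr (x $ 3, x $ 4)"
    "pd 3 (\<lambda>y. g y $ 4 $ 4) x = 2 * A (x $ 3, x $ 4) * cz (x $ 3, x $ 4)"
    "pd 4 (\<lambda>y. g y $ 4 $ 4) x = 2 * A (x $ 3, x $ 4) * cr (x $ 3, x $ 4)"
    using 11(3,4) 12(3,4) 21(3,4) 22(3,4) 33(3,4) 44(3,4) by (simp_all add: g_components)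
  show 0: "pd k (\<lambda>y. g y $ 1 $ 3) x = 0" "pd k (\<lambda>y. g y $ 1 $ 4) x = 0" "pd k (\<lambda>y. g y $ 2 $ 3) x = 0" "pd k (\<lambda>y. g y $ 2 $ 4) x = 0"
    "pd k (\<lambda>y. g y $ 3 $ 1) x = 0" "pd k (\<lambda>y. g y $ 4 $ 1) x = 0" "pd k (\<lambda>y. g y $ 3 $ 2) x = 0" "pd k (\<lambda>y. g y $ 4 $ 2) x = 0"
    "pd k (\<lambda>y. g y $ 3 $ 4) x = 0" "pd k (\<lambda>y. g y $ 4 $ 3) x = 0" for k
    by (rule pd_zero[OF _ x], simp add: g_components)+
  show "pd 1 (\<lambda>y. g y $ i $ j) x = 0" "pd 2 (\<lambda>y. g y $ i $ j) x = 0"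
    using exhaust_4[of i] exhaust_4[of j] 0 11(1,2) 12(1,2) 21(1,2) 22(1,2) 33(1,2) 44(1,2)
    by (auto simp: g_components)
qed

lemmas christoffel_simps = christoffel_def sum_4 matrix_inv_g pd_g_components

lemma christoffel_sym: "christoffel g k i j x = christoffel g k j i x"
proof -
  have "pd l (\<lambda>y. g y $ i $ j) x = pd l (\<lambda>y. g y $ j $ i) x" for l
    using exhaust_4[of i] exhaust_4[of j] by (auto simp: g_components)
  then show ?thesis
    unfolding christoffel_def by (simp add: add.commute)
qed

lemma christoffel_killing:
  assumes x: "0 < x $ 4"
  shows "christoffel g 3 1 1 x = Dz V (x $ 3, x $ 4) / (2 * A (x $ 3, x $ 4))"
    "christoffel g 3 1 2 x = - Dz W (x $ 3, x $ 4) / (2 * A (x $ 3, x $ 4))"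
    "christoffel g 3 2 2 x = - Dz \<eta> (x $ 3, x $ 4) / (2 * A (x $ 3, x $ 4))"
    "christoffel g 4 1 1 x = Dr V (x $ 3, x $ 4) / (2 * A (x $ 3, x $ 4))"
    "christoffel g 4 1 2 x = - Dr W (x $ 3, x $ 4) / (2 * A (x $ 3, x $ 4))"
    "christoffel g 4 2 2 x = - Dr \<eta> (x $ 3, x $ 4) / (2 * A (x $ 3, x $ 4))"
  using x by (simp_all add: christoffel_simps)

lemma christoffel_mixed:
  assumes x: "0 < x $ 4"
  shows "christoffel g 1 1 3 x = (\<eta> (x$3, x$4) * Dz V (x$3, x$4) + W (x$3, x$4) * Dz W (x$3, x$4)) / (2 * (x $ 4)\<^sup>2)"
    "christoffel g 1 2 3 x = (W (x$3, x$4) * Dz \<eta> (x$3, x$4) - \<eta> (x$3, x$4) * Dz W (x$3, x$4)) / (2 * (x $ 4)\<^sup>2)"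
    "christoffel g 2 1 3 x = (V (x$3, x$4) * Dz W (x$3, x$4) - W (x$3, x$4) * Dz V (x$3, x$4)) / (2 * (x $ 4)\<^sup>2)"
    "christoffel g 2 2 3 x = (V (x$3, x$4) * Dz \<eta> (x$3, x$4) + W (x$3, x$4) * Dz W (x$3, x$4)) / (2 * (x $ 4)\<^sup>2)"
    "christoffel g 1 1 4 x = (\<eta> (x$3, x$4) * Dr V (x$3, x$4) + W (x$3, x$4) * Dr W (x$3, x$4)) / (2 * (x $ 4)\<^sup>2)"
    "christoffel g 1 2 4 x = (W (x$3, x$4) * Dr \<eta> (x$3, x$4) - \<eta> (x$3, x$4) * Dr W (x$3, x$4)) / (2 * (x $ 4)\<^sup>2)"
    "christoffel g 2 1 4 x = (V (x$3, x$4) * Dr W (x$3, x$4) - W (x$3, x$4) * Dr V (x$3, x$4)) / (2 * (x $ 4)\<^sup>2)"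
    "christoffel g 2 2 4 x = (V (x$3, x$4) * Dr \<eta> (x$3, x$4) + W (x$3, x$4) * Dr W (x$3, x$4)) / (2 * (x $ 4)\<^sup>2)"
  using x by (simp_all add: christoffel_simps divide_simps)

lemma christoffel_conformal:
  assumes x: "0 < x $ 4"
  shows "christoffel g 3 3 3 x = cz (x $ 3, x $ 4)" "christoffel g 3 3 4 x = cr (x $ 3, x $ 4)"
    "christoffel g 3 4 4 x = - cz (x $ 3, x $ 4)"
    "christoffel g 4 4 4 x = cr (x $ 3, x $ 4)" "christoffel g 4 3 4 x = cz (x $ 3, x $ 4)"
    "christoffel g 4 3 3 x = - cr (x $ 3, x $ 4)"
  using x A_pos[OF x, of "x $ 3"] by (simp_all add: christoffel_simps)

lemma christoffel_zero:
  assumes x: "0 < x $ 4"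
  shows "christoffel g 1 1 1 x = 0" "christoffel g 1 1 2 x = 0" "christoffel g 1 2 2 x = 0"
    "christoffel g 2 1 1 x = 0" "christoffel g 2 1 2 x = 0" "christoffel g 2 2 2 x = 0"
    "christoffel g 1 3 3 x = 0" "christoffel g 1 3 4 x = 0" "christoffel g 1 4 4 x = 0"
    "christoffel g 2 3 3 x = 0" "christoffel g 2 3 4 x = 0" "christoffel g 2 4 4 x = 0"
    "christoffel g 3 1 3 x = 0" "christoffel g 3 1 4 x = 0" "christoffel g 3 2 3 x = 0" "christoffel g 3 2 4 x = 0"
    "christoffel g 4 1 3 x = 0" "christoffel g 4 1 4 x = 0" "christoffel g 4 2 3 x = 0" "christoffel g 4 2 4 x = 0"
  using x by (simp_all add: christoffel_simps)

lemmas christoffel_swap = christoffel_sym[of _ 2 1] christoffel_sym[of _ 3 1] christoffel_sym[of _ 4 1]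
  christoffel_sym[of _ 3 2] christoffel_sym[of _ 4 2] christoffel_sym[of _ 4 3]

end

context weyl_papapetrou
begin

lemma quotient_A_has_derivative:
  assumes f: "smooth_on half_plane f" and r: "0 < r"
  shows "((\<lambda>q. - f q / (2 * A q)) has_derivative
     (\<lambda>h. (- Dz f (z, r) / (2 * A (z, r)) + f (z, r) * cz (z, r) / A (z, r)) * fst h +
          (- Dr f (z, r) / (2 * A (z, r)) + f (z, r) * cr (z, r) / A (z, r)) * snd h)) (at (z, r))"
proof -
  have "A (z, r) \<noteq> 0" using A_pos[OF r, of z] by simp
  then have "((\<lambda>q. - f q / (2 * A q)) has_derivative
     (\<lambda>h. ((- (Dz f (z, r) * fst h + Dr f (z, r) * snd h)) * (2 * A (z, r)) -
        (- f (z, r)) * (2 * ((2 * A (z, r) * cz (z, r)) * fst h + (2 * A (z, r) * cr (z, r)) * snd h))) /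
       ((2 * A (z, r)) * (2 * A (z, r))))) (at (z, r))"
    by (intro has_derivative_divide' has_derivative_minus smooth_hd[OF f r] has_derivative_mult_right
        A_has_derivative[OF r]) simp
  then show ?thesis
    by (rule has_derivative_eq_rhs) (use \<open>A (z, r) \<noteq> 0\<close> in \<open>simp add: fun_eq_iff field_simps\<close>)
qed

lemma log_derivative_has_derivative:
  assumes f: "smooth_on half_plane f" and k: "smooth_on half_plane k" and r: "0 < r"
  shows "((\<lambda>q. k q - f q / (2 * \<eta> q)) has_derivative
     (\<lambda>h. (Dz k (z, r) - Dz f (z, r) / (2 * \<eta> (z, r)) + f (z, r) * Dz \<eta> (z, r) / (2 * (\<eta> (z, r))\<^sup>2)) * fst h +
          (Dr k (z, r) - Dr f (z, r) / (2 * \<eta> (z, r)) + f (z, r) * Dr \<eta> (z, r) / (2 * (\<eta> (z, r))\<^sup>2)) * snd h)) (at (z, r))"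
proof -
  have n: "\<eta> (z, r) \<noteq> 0" using eta_pos[OF r, of z] by simp
  then have "((\<lambda>q. k q - f q / (2 * \<eta> q)) has_derivative
     (\<lambda>h. (Dz k (z, r) * fst h + Dr k (z, r) * snd h) -
       ((Dz f (z, r) * fst h + Dr f (z, r) * snd h) * (2 * \<eta> (z, r)) -
        f (z, r) * (2 * (Dz \<eta> (z, r) * fst h + Dr \<eta> (z, r) * snd h))) /
       ((2 * \<eta> (z, r)) * (2 * \<eta> (z, r))))) (at (z, r))"
    by (intro has_derivative_diff has_derivative_divide' smooth_hd[OF f r] smooth_hd[OF k r] has_derivative_mult_right
        smooth_hd[OF smooth(3) r]) simp
  then show ?thesis
    by (rule has_derivative_eq_rhs) (use n in \<open>simp add: fun_eq_iff field_simps power2_eq_square\<close>)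
qed

lemma pd_christoffel_killing:
  assumes x: "0 < x $ 4"
  shows "pd 3 (christoffel g 3 2 2) x = - Dz (Dz \<eta>) (x$3, x$4) / (2 * A (x$3, x$4)) + Dz \<eta> (x$3, x$4) * cz (x$3, x$4) / A (x$3, x$4)"
    "pd 4 (christoffel g 4 2 2) x = - Dr (Dr \<eta>) (x$3, x$4) / (2 * A (x$3, x$4)) + Dr \<eta> (x$3, x$4) * cr (x$3, x$4) / A (x$3, x$4)"
    "pd 3 (christoffel g 3 1 2) x = - Dz (Dz W) (x$3, x$4) / (2 * A (x$3, x$4)) + Dz W (x$3, x$4) * cz (x$3, x$4) / A (x$3, x$4)"
    "pd 4 (christoffel g 4 1 2) x = - Dr (Dr W) (x$3, x$4) / (2 * A (x$3, x$4)) + Dr W (x$3, x$4) * cr (x$3, x$4) / A (x$3, x$4)"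
  by (rule pd_of_half_plane_function(3)[OF _ quotient_A_has_derivative[OF smooth_on_Dz[OF smooth(3)] x] x] 
           pd_of_half_plane_function(4)[OF _ quotient_A_has_derivative[OF smooth_on_Dr[OF smooth(3)] x] x]
           pd_of_half_plane_function(3)[OF _ quotient_A_has_derivative[OF smooth_on_Dz[OF smooth(2)] x] x]
           pd_of_half_plane_function(4)[OF _ quotient_A_has_derivative[OF smooth_on_Dr[OF smooth(2)] x] x],
      simp add: christoffel_killing)+

text \<open>\<open>czz\<close> and \<open>crr\<close> are \<open>Dz cz\<close> and
  \<open>Dr cr\<close> written out.\<close>

definition czz :: "real \<times> real \<Rightarrow> real" where
  "czz q = Dz (Dz \<gamma>) q - Dz (Dz \<eta>) q / (2 * \<eta> q) + (Dz \<eta> q)\<^sup>2 / (2 * (\<eta> q)\<^sup>2)"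
definition crr :: "real \<times> real \<Rightarrow> real" where
  "crr q = Dr (Dr \<gamma>) q - Dr (Dr \<eta>) q / (2 * \<eta> q) + (Dr \<eta> q)\<^sup>2 / (2 * (\<eta> q)\<^sup>2)"

lemma pd_christoffel_conformal:
  assumes x: "0 < x $ 4"
  shows "pd 3 (christoffel g 3 3 3) x = czz (x$3, x$4)" "pd 3 (christoffel g 4 3 4) x = czz (x$3, x$4)"
    "pd 3 (christoffel g 3 4 4) x = - czz (x$3, x$4)"
    "pd 4 (christoffel g 4 4 4) x = crr (x$3, x$4)" "pd 4 (christoffel g 3 4 3) x = crr (x$3, x$4)"
    "pd 4 (christoffel g 4 3 3) x = - crr (x$3, x$4)"
proof -
  note dz = log_derivative_has_derivative[OF smooth_on_Dz[OF smooth(3)] smooth_on_Dz[OF smooth(4)] x, of "x $ 3"]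
  note dr = log_derivative_has_derivative[OF smooth_on_Dr[OF smooth(3)] smooth_on_Dr[OF smooth(4)] x, of "x $ 3"]
  have dmz: "((\<lambda>q. - (Dz \<gamma> q - Dz \<eta> q / (2 * \<eta> q))) has_derivative
      (\<lambda>h. (- czz (x$3, x$4)) * fst h + (- (Dr (Dz \<gamma>) (x$3, x$4) - Dr (Dz \<eta>) (x$3, x$4) / (2 * \<eta> (x$3, x$4))
         + Dz \<eta> (x$3, x$4) * Dr \<eta> (x$3, x$4) / (2 * (\<eta> (x$3, x$4))\<^sup>2))) * snd h)) (at (x$3, x$4))"
    by (rule has_derivative_eq_rhs[OF has_derivative_minus[OF dz]]) (simp add: fun_eq_iff czz_def power2_eq_square algebra_simps)
  have dmr: "((\<lambda>q. - (Dr \<gamma> q - Dr \<eta> q / (2 * \<eta> q))) has_derivative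
      (\<lambda>h. (- (Dz (Dr \<gamma>) (x$3, x$4) - Dz (Dr \<eta>) (x$3, x$4) / (2 * \<eta> (x$3, x$4))
         + Dr \<eta> (x$3, x$4) * Dz \<eta> (x$3, x$4) / (2 * (\<eta> (x$3, x$4))\<^sup>2))) * fst h + (- crr (x$3, x$4)) * snd h)) (at (x$3, x$4))"
    by (rule has_derivative_eq_rhs[OF has_derivative_minus[OF dr]]) (simp add: fun_eq_iff crr_def power2_eq_square algebra_simps)
  show "pd 3 (christoffel g 3 3 3) x = czz (x$3, x$4)" "pd 3 (christoffel g 4 3 4) x = czz (x$3, x$4)"
    using pd_of_half_plane_function(3)[OF _ dz x, of "christoffel g 3 3 3"] pd_of_half_plane_function(3)[OF _ dz x, of "christoffel g 4 3 4"]
    by (simp_all add: christoffel_conformal cz_def czz_def power2_eq_square)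
  show "pd 4 (christoffel g 4 4 4) x = crr (x$3, x$4)" "pd 4 (christoffel g 3 4 3) x = crr (x$3, x$4)"
    using pd_of_half_plane_function(4)[OF _ dr x, of "christoffel g 4 4 4"] pd_of_half_plane_function(4)[OF _ dr x, of "christoffel g 3 4 3"]
    by (simp_all add: christoffel_conformal christoffel_swap cr_def crr_def power2_eq_square)
  show "pd 3 (christoffel g 3 4 4) x = - czz (x$3, x$4)" "pd 4 (christoffel g 4 3 3) x = - crr (x$3, x$4)"
    using pd_of_half_plane_function(3)[OF _ dmz x, of "christoffel g 3 4 4"] pd_of_half_plane_function(4)[OF _ dmr x, of "christoffel g 4 3 3"]
    by (simp_all add: christoffel_conformal cz_def cr_def)
qed

section \<open>The differentiated Gram relation and the Ricci components\<close>

lemma gram_z: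
  assumes r: "0 < r"
  shows "Dz V (z, r) * \<eta> (z, r) + V (z, r) * Dz \<eta> (z, r) + 2 * W (z, r) * Dz W (z, r) = 0"
proof -
  have "((\<lambda>z. V (z, r) * \<eta> (z, r) + (W (z, r))\<^sup>2) has_real_derivative
      (Dz V (z, r) * \<eta> (z, r) + V (z, r) * Dz \<eta> (z, r) + 2 * W (z, r) * Dz W (z, r))) (at z)"
    by (rule derivative_eq_intros smooth_has_real_derivative(1)[OF smooth(1) r] smooth_has_real_derivative(1)[OF smooth(2) r]
       smooth_has_real_derivative(1)[OF smooth(3) r] refl)+ (simp add: algebra_simps)
  moreover have "((\<lambda>z. V (z, r) * \<eta> (z, r) + (W (z, r))\<^sup>2) has_real_derivative 0) (at z)"
    using gram[OF r] by simp
  ultimately show ?thesis by (rule DERIV_unique)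
qed

lemma gram_r:
  assumes r: "0 < r"
  shows "Dr V (z, r) * \<eta> (z, r) + V (z, r) * Dr \<eta> (z, r) + 2 * W (z, r) * Dr W (z, r) = 2 * r"
proof -
  have "((\<lambda>r. V (z, r) * \<eta> (z, r) + (W (z, r))\<^sup>2) has_real_derivative
      (Dr V (z, r) * \<eta> (z, r) + V (z, r) * Dr \<eta> (z, r) + 2 * W (z, r) * Dr W (z, r))) (at r)"
    by (rule derivative_eq_intros smooth_has_real_derivative(2)[OF smooth(1) r] smooth_has_real_derivative(2)[OF smooth(2) r]
       smooth_has_real_derivative(2)[OF smooth(3) r] refl)+ (simp add: algebra_simps)
  moreover have "((\<lambda>r. V (z, r) * \<eta> (z, r) + (W (z, r))\<^sup>2) has_real_derivative 2 * r) (at r)"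
    by (rule has_field_derivative_transform_within_open[of "\<lambda>r. r\<^sup>2" _ _ "{0<..}"])
       (use r gram in \<open>auto intro!: derivative_eq_intros\<close>)
  ultimately show ?thesis by (rule DERIV_unique)
qed

text \<open>The trace over the Killing block is half the logarithmic derivative of its determinant,
  that is, the derivative of ln \<rho>.\<close>

lemma christoffel_trace:
  assumes x: "0 < x $ 4"
  shows "christoffel g 2 2 3 x = - christoffel g 1 1 3 x" "christoffel g 2 2 4 x = 1 / x $ 4 - christoffel g 1 1 4 x"
proof -
  note gz = gram_z[OF x, of "x $ 3"] and gr = gram_r[OF x, of "x $ 3"]
  have "christoffel g 1 1 3 x + christoffel g 2 2 3 x =
     (Dz V (x$3, x$4) * \<eta> (x$3, x$4) + V (x$3, x$4) * Dz \<eta> (x$3, x$4) + 2 * W (x$3, x$4) * Dz W (x$3, x$4)) / (2 * (x $ 4)\<^sup>2)"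
    unfolding christoffel_mixed[OF x] add_divide_distrib[symmetric] by (simp add: algebra_simps)
  then show "christoffel g 2 2 3 x = - christoffel g 1 1 3 x"
    unfolding gz by simp
  have "christoffel g 1 1 4 x + christoffel g 2 2 4 x =
     (Dr V (x$3, x$4) * \<eta> (x$3, x$4) + V (x$3, x$4) * Dr \<eta> (x$3, x$4) + 2 * W (x$3, x$4) * Dr W (x$3, x$4)) / (2 * (x $ 4)\<^sup>2)"
    unfolding christoffel_mixed[OF x] add_divide_distrib[symmetric] by (simp add: algebra_simps)
  then show "christoffel g 2 2 4 x = 1 / x $ 4 - christoffel g 1 1 4 x"
    unfolding gr using x by (simp add: power2_eq_square)
qed

text \<open>Only these sums occur in the Ricci components. The summands are shown to be
  differentiable without computing their derivatives, and the sum is differentiated by means of the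
  Gram relation.\<close>

lemma pd_christoffel_trace:
  assumes x: "0 < x $ 4"
  shows "pd 3 (christoffel g 1 3 1) x + pd 3 (christoffel g 2 3 2) x = 0"
    "pd 4 (christoffel g 1 4 1) x + pd 4 (christoffel g 2 4 2) x = - 1 / (x $ 4)\<^sup>2"
proof -
  note sm = smooth smooth_on_Dz[OF smooth(1)] smooth_on_Dz[OF smooth(2)] smooth_on_Dz[OF smooth(3)]
    smooth_on_Dr[OF smooth(1)] smooth_on_Dr[OF smooth(2)] smooth_on_Dr[OF smooth(3)]
  have q: "(x$3, x$4) \<in> half_plane" using x by simp
  note df = smooth_on_imp_differentiable[OF _ q]
  have D: "(\<lambda>q. (f1 q * f2 q + f3 q * f4 q) / (2 * (snd q)\<^sup>2)) differentiable (at (x$3, x$4))"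
    if "smooth_on half_plane f1" "smooth_on half_plane f2" "smooth_on half_plane f3" "smooth_on half_plane f4" for f1 f2 f3 f4
    using x by (intro derivative_intros df that bounded_linear_imp_differentiable bounded_linear_snd) auto
  let ?f1 = "\<lambda>q. (\<eta> q * Dz V q + W q * Dz W q) / (2 * (snd q)\<^sup>2)"
  let ?f2 = "\<lambda>q. (V q * Dz \<eta> q + W q * Dz W q) / (2 * (snd q)\<^sup>2)"
  let ?f3 = "\<lambda>q. (\<eta> q * Dr V q + W q * Dr W q) / (2 * (snd q)\<^sup>2)"
  let ?f4 = "\<lambda>q. (V q * Dr \<eta> q + W q * Dr W q) / (2 * (snd q)\<^sup>2)"
  note d1 = differentiable_has_derivative[OF D[OF sm(3,5,2,6)]] and d2 = differentiable_has_derivative[OF D[OF sm(1,7,2,6)]]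
  note d3 = differentiable_has_derivative[OF D[OF sm(3,8,2,9)]] and d4 = differentiable_has_derivative[OF D[OF sm(1,10,2,9)]]
  have p: "pd 3 (christoffel g 1 3 1) x = Dz ?f1 (x$3, x$4)" "pd 3 (christoffel g 2 3 2) x = Dz ?f2 (x$3, x$4)"
     "pd 4 (christoffel g 1 4 1) x = Dr ?f3 (x$3, x$4)" "pd 4 (christoffel g 2 4 2) x = Dr ?f4 (x$3, x$4)"
    by (rule pd_of_half_plane_function(3)[OF _ d1 x] pd_of_half_plane_function(3)[OF _ d2 x]
          pd_of_half_plane_function(4)[OF _ d3 x] pd_of_half_plane_function(4)[OF _ d4 x],
        simp add: christoffel_swap christoffel_mixed)+
  have zero: "?f1 q + ?f2 q = 0" and inv: "?f3 q + ?f4 q = 1 / snd q" if "q \<in> half_plane" for q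
  proof -
    have "0 < snd q" using that by simp
    then show "?f1 q + ?f2 q = 0" "?f3 q + ?f4 q = 1 / snd q"
      using gram_z[of "snd q" "fst q"] gram_r[of "snd q" "fst q"]
      by (simp_all add: add_divide_distrib[symmetric] divide_simps power2_eq_square) (simp_all add: algebra_simps)
  qed
  have "((\<lambda>q. 0) has_derivative (\<lambda>h. (Dz ?f1 (x$3, x$4) + Dz ?f2 (x$3, x$4)) * fst h + (Dr ?f1 (x$3, x$4) + Dr ?f2 (x$3, x$4)) * snd h)) (at (x$3, x$4))"
    by (rule has_derivative_transform_within_open[OF has_derivative_eq_rhs[OF has_derivative_add[OF d1 d2]] open_half_plane q zero])
       (simp add: fun_eq_iff algebra_simps)
  from has_derivative_unique[OF this has_derivative_const]
  have "(Dz ?f1 (x$3, x$4) + Dz ?f2 (x$3, x$4)) * fst (1::real, 0::real) + (Dr ?f1 (x$3, x$4) + Dr ?f2 (x$3, x$4)) * snd (1::real, 0::real) = 0"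
    by metis
  then show "pd 3 (christoffel g 1 3 1) x + pd 3 (christoffel g 2 3 2) x = 0"
    unfolding p by simp
  have "((\<lambda>q. 1 / snd q) has_derivative (\<lambda>h. (Dz ?f3 (x$3, x$4) + Dz ?f4 (x$3, x$4)) * fst h + (Dr ?f3 (x$3, x$4) + Dr ?f4 (x$3, x$4)) * snd h)) (at (x$3, x$4))"
    by (rule has_derivative_transform_within_open[OF has_derivative_eq_rhs[OF has_derivative_add[OF d3 d4]] open_half_plane q inv])
       (simp add: fun_eq_iff algebra_simps)
  moreover have "((\<lambda>q. 1 / snd q) has_derivative (\<lambda>h. - snd h / (x$4)\<^sup>2)) (at (x$3, x$4))"
    using x by (auto intro!: derivative_eq_intros simp: fun_eq_iff power2_eq_square field_simps)
  ultimately have "(\<lambda>h. (Dz ?f3 (x$3, x$4) + Dz ?f4 (x$3, x$4)) * fst h + (Dr ?f3 (x$3, x$4) + Dr ?f4 (x$3, x$4)) * snd h) = (\<lambda>h. - snd h / (x$4)\<^sup>2)"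
    by (rule has_derivative_unique)
  from fun_cong[OF this, of "(0, 1)"]
  show "pd 4 (christoffel g 1 4 1) x + pd 4 (christoffel g 2 4 2) x = - 1 / (x $ 4)\<^sup>2"
    unfolding p by simp
qed

text \<open>The factor \<open>2 * A\<close> clears the denominators of
  \<open>christoffel_killing\<close> and leaves an equation on the flat half-plane.\<close>

lemma ricci_22:
  assumes x: "0 < x $ 4"
  shows "ricci g 2 2 x * (2 * A (x$3, x$4)) = - (Dz (Dz \<eta>) (x$3, x$4) + Dr (Dr \<eta>) (x$3, x$4)) - Dr \<eta> (x$3, x$4) / x $ 4
    + 2 * (christoffel g 1 2 3 x * Dz W (x$3, x$4) + christoffel g 2 2 3 x * Dz \<eta> (x$3, x$4)
         + christoffel g 1 2 4 x * Dr W (x$3, x$4) + christoffel g 2 2 4 x * Dr \<eta> (x$3, x$4))"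
proof -
  have z: "pd 1 (christoffel g 1 2 2) x = 0" "pd 2 (christoffel g 2 2 2) x = 0" "pd 2 (christoffel g 1 2 1) x = 0"
    "pd 2 (christoffel g 3 2 3) x = 0" "pd 2 (christoffel g 4 2 4) x = 0"
    by (rule pd_zero[OF _ x], simp add: christoffel_zero christoffel_swap)+
  have "A (x$3, x$4) \<noteq> 0" using A_pos[OF x, of "x $ 3"] by simp
  then show ?thesis
    by (simp add: ricci_def sum_4 z pd_christoffel_killing[OF x] christoffel_swap christoffel_killing[OF x]
        christoffel_conformal[OF x] christoffel_zero[OF x] christoffel_trace[OF x] field_simps)
qed

lemma ricci_12:
  assumes x: "0 < x $ 4"
  shows "ricci g 1 2 x * (2 * A (x$3, x$4)) = - (Dz (Dz W) (x$3, x$4) + Dr (Dr W) (x$3, x$4)) - Dr W (x$3, x$4) / x $ 4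
    + christoffel g 1 1 3 x * Dz W (x$3, x$4) + christoffel g 2 1 3 x * Dz \<eta> (x$3, x$4)
    - christoffel g 1 2 3 x * Dz V (x$3, x$4) + christoffel g 2 2 3 x * Dz W (x$3, x$4)
    + christoffel g 1 1 4 x * Dr W (x$3, x$4) + christoffel g 2 1 4 x * Dr \<eta> (x$3, x$4)
    - christoffel g 1 2 4 x * Dr V (x$3, x$4) + christoffel g 2 2 4 x * Dr W (x$3, x$4)"
proof -
  have z: "pd 1 (christoffel g 1 1 2) x = 0" "pd 2 (christoffel g 2 1 2) x = 0" "pd 2 (christoffel g 1 1 1) x = 0"
    "pd 2 (christoffel g 3 1 3) x = 0" "pd 2 (christoffel g 4 1 4) x = 0"
    by (rule pd_zero[OF _ x], simp add: christoffel_zero christoffel_swap)+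
  have "A (x$3, x$4) \<noteq> 0" using A_pos[OF x, of "x $ 3"] by simp
  then show ?thesis
    by (simp add: ricci_def sum_4 z pd_christoffel_killing[OF x] christoffel_swap christoffel_killing[OF x]
        christoffel_conformal[OF x] christoffel_zero[OF x] christoffel_trace[OF x] field_simps)
qed

text \<open>In the sum the undifferentiated \<open>cz\<close> and \<open>cr\<close> cancel; the
  conformal factor enters only through the flat Laplacian of ln A, which is
  \<open>2 * (czz + crr)\<close>.\<close>

lemma ricci_33_44:
  assumes x: "0 < x $ 4"
  shows "ricci g 3 3 x + ricci g 4 4 x = - 2 * (czz (x$3, x$4) + crr (x$3, x$4)) + 1 / (x $ 4)\<^sup>2
    - ((christoffel g 1 1 3 x)\<^sup>2 + 2 * christoffel g 1 2 3 x * christoffel g 2 1 3 x + (christoffel g 2 2 3 x)\<^sup>2)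
    - ((christoffel g 1 1 4 x)\<^sup>2 + 2 * christoffel g 1 2 4 x * christoffel g 2 1 4 x + (christoffel g 2 2 4 x)\<^sup>2)"
proof -
  have z: "pd 1 (christoffel g 1 3 3) x = 0" "pd 2 (christoffel g 2 3 3) x = 0"
    "pd 1 (christoffel g 1 4 4) x = 0" "pd 2 (christoffel g 2 4 4) x = 0"
    by (rule pd_zero[OF _ x], simp add: christoffel_zero christoffel_swap)+
  have t: "pd 3 (christoffel g 2 3 2) x = - pd 3 (christoffel g 1 3 1) x"
    "pd 4 (christoffel g 2 4 2) x = - 1 / (x $ 4)\<^sup>2 - pd 4 (christoffel g 1 4 1) x"
    using pd_christoffel_trace[OF x] by linarith+
  show ?thesis
    by (simp add: ricci_def sum_4 z t pd_christoffel_conformal[OF x] christoffel_swap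
        christoffel_conformal[OF x] christoffel_zero[OF x] power2_eq_square algebra_simps)
qed

end

text \<open>Here \<open>h\<close> is \<eta>, and \<open>v\<close>, \<open>w\<close>,
  \<open>e\<close> are the derivatives of \<open>V\<close>, \<open>W\<close>, \<eta> in one
  direction, \<tau> that of \<open>\<rho>\<^sup>2\<close> (0 along \<open>z\<close>,
  \<open>2 * r\<close> along \<rho>); \<open>(h * w - W * e) / r\<close> is a component of the
  twist. Clearing denominators and substituting \<open>gr\<close> and \<open>d\<close> leaves
  polynomial identities, used in turn for the equations of \<eta>, of the twist and of
  \<gamma>.\<close>

lemma block_trace_identities:
  fixes r V W e v w h \<tau> :: real
  assumes r: "0 < r" and h: "0 < h" and gr: "V * h + W\<^sup>2 = r\<^sup>2" and d: "v * h + V * e + 2 * W * w = \<tau>"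
  shows "(- h * w\<^sup>2 + 2 * W * w * e + V * e\<^sup>2) / r\<^sup>2 = e\<^sup>2 / h - ((h * w - W * e) / r)\<^sup>2 / h"
    and "h * ((h * v * w + W * w\<^sup>2 + V * w * e - W * v * e) / r\<^sup>2) - W * ((- h * w\<^sup>2 + 2 * W * w * e + V * e\<^sup>2) / r\<^sup>2)
      = (h * w - W * e) * \<tau> / r\<^sup>2"
    and "((h * v + W * w) / (2 * r\<^sup>2))\<^sup>2 + 2 * ((W * e - h * w) / (2 * r\<^sup>2)) * ((V * w - W * v) / (2 * r\<^sup>2))
        + ((V * e + W * w) / (2 * r\<^sup>2))\<^sup>2
      = \<tau>\<^sup>2 / (4 * r ^ 4) - \<tau> * e / (2 * r\<^sup>2 * h) - (((h * w - W * e) / r)\<^sup>2 - e\<^sup>2) / (2 * h\<^sup>2)"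
proof -
  have n: "r \<noteq> 0" "h \<noteq> 0" using r h by auto
  have "h * (- h * w\<^sup>2 + 2 * W * w * e + V * e\<^sup>2) = r\<^sup>2 * e\<^sup>2 - (h * w - W * e)\<^sup>2"
    unfolding gr[symmetric] by (simp add: power2_eq_square algebra_simps)
  then have "- h * w\<^sup>2 + 2 * W * w * e + V * e\<^sup>2 = (r\<^sup>2 * e\<^sup>2 - (h * w - W * e)\<^sup>2) / h"
    using n by (simp add: nonzero_eq_divide_eq mult.commute)
  then show "(- h * w\<^sup>2 + 2 * W * w * e + V * e\<^sup>2) / r\<^sup>2 = e\<^sup>2 / h - ((h * w - W * e) / r)\<^sup>2 / h"
  proof -
    have "(r\<^sup>2 * e\<^sup>2 - D\<^sup>2) / h / r\<^sup>2 = e\<^sup>2 / h - (D / r)\<^sup>2 / h" for D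
      using n by (simp add: power_divide diff_divide_distrib)
    then show ?thesis
      using \<open>- h * w\<^sup>2 + 2 * W * w * e + V * e\<^sup>2 = _\<close> by simp
  qed
  have "h * (h * v * w + W * w\<^sup>2 + V * w * e - W * v * e) - W * (- h * w\<^sup>2 + 2 * W * w * e + V * e\<^sup>2) = (h * w - W * e) * \<tau>"
    unfolding d[symmetric] by (simp add: power2_eq_square algebra_simps)
  then show "h * ((h * v * w + W * w\<^sup>2 + V * w * e - W * v * e) / r\<^sup>2) - W * ((- h * w\<^sup>2 + 2 * W * w * e + V * e\<^sup>2) / r\<^sup>2)
      = (h * w - W * e) * \<tau> / r\<^sup>2"
    by (metis (no_types) diff_divide_distrib times_divide_eq_right)
  have *: "(h * v + W * w)\<^sup>2 + 2 * (W * e - h * w) * (V * w - W * v) + (V * e + W * w)\<^sup>2 = \<tau>\<^sup>2 - 2 * r\<^sup>2 * (e * v + w\<^sup>2)"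
    unfolding d[symmetric] gr[symmetric] by (simp add: power2_eq_square algebra_simps)
  have "h\<^sup>2 * (e * v + w\<^sup>2) = \<tau> * e * h + (h * w - W * e)\<^sup>2 - r\<^sup>2 * e\<^sup>2"
    unfolding d[symmetric] gr[symmetric] by (simp add: power2_eq_square algebra_simps)
  then have ev: "e * v + w\<^sup>2 = (\<tau> * e * h + (h * w - W * e)\<^sup>2 - r\<^sup>2 * e\<^sup>2) / h\<^sup>2"
    using n by (simp add: nonzero_eq_divide_eq mult.commute)
  have "((h * v + W * w) / (2 * r\<^sup>2))\<^sup>2 + 2 * ((W * e - h * w) / (2 * r\<^sup>2)) * ((V * w - W * v) / (2 * r\<^sup>2))
        + ((V * e + W * w) / (2 * r\<^sup>2))\<^sup>2 = (\<tau>\<^sup>2 - 2 * r\<^sup>2 * (e * v + w\<^sup>2)) / (2 * r\<^sup>2)\<^sup>2"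
  proof -
    have "(a / k)\<^sup>2 + 2 * (b / k) * (c / k) + (d / k)\<^sup>2 = (a\<^sup>2 + 2 * b * c + d\<^sup>2) / k\<^sup>2" for a b c d k :: real
      by (simp add: power_divide add_divide_distrib power2_eq_square)
    then show ?thesis unfolding *[symmetric] .
  qed
  also have "\<dots> = \<tau>\<^sup>2 / (4 * r ^ 4) - (e * v + w\<^sup>2) / (2 * r\<^sup>2)"
    using n by (simp add: field_simps power2_eq_square power4_eq_xxxx)
  also have "(e * v + w\<^sup>2) / (2 * r\<^sup>2) = \<tau> * e / (2 * r\<^sup>2 * h) + (((h * w - W * e) / r)\<^sup>2 - e\<^sup>2) / (2 * h\<^sup>2)"
    unfolding ev using n by (simp add: field_simps power2_eq_square)
  finally show "((h * v + W * w) / (2 * r\<^sup>2))\<^sup>2 + 2 * ((W * e - h * w) / (2 * r\<^sup>2)) * ((V * w - W * v) / (2 * r\<^sup>2))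
        + ((V * e + W * w) / (2 * r\<^sup>2))\<^sup>2
      = \<tau>\<^sup>2 / (4 * r ^ 4) - \<tau> * e / (2 * r\<^sup>2 * h) - (((h * w - W * e) / r)\<^sup>2 - e\<^sup>2) / (2 * h\<^sup>2)"
    by simp
qed

text \<open>\<open>X\<close> and \<open>N\<close> stand for the Laplacians of \<gamma> and \<eta>,
  \<open>G\<close> for the squared gradient of \<eta>, \<open>K\<close> for
  \<open>P\<^sup>2 + Q\<^sup>2\<close> and \<open>e\<close> for the radial derivative of
  \<eta>.\<close>

lemma conformal_factor_algebra:
  fixes X N G K e r h :: real
  assumes 1: "2 * (X - N / (2 * h) + G / (2 * h\<^sup>2)) = e / (r * h) + (K - G) / (2 * h\<^sup>2)"
    and N: "N = - e / r + G / h - K / h" and n: "r \<noteq> 0" "h \<noteq> 0"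
  shows "X = - (G + K) / (4 * h\<^sup>2)"
proof -
  have f1: "N / (2 * h) = (- (e / (r * h)) + G / h\<^sup>2 - K / h\<^sup>2) / 2"
    unfolding N using n by (simp add: field_simps power2_eq_square)
  have f2: "G / (2 * h\<^sup>2) = (G / h\<^sup>2) / 2" "(K - G) / (2 * h\<^sup>2) = (K / h\<^sup>2 - G / h\<^sup>2) / 2"
    "- (G + K) / (4 * h\<^sup>2) = - (G / h\<^sup>2 + K / h\<^sup>2) / 4"
    by (simp_all add: diff_divide_distrib add_divide_distrib)
  have lin: "X = - (a + b) / 4" if "2 * (X - (- u + a - b) / 2 + a / 2) = u + (b - a) / 2" for a b u :: real
    using that by (simp add: field_simps)
  show ?thesis
    unfolding f2 by (rule lin[OF 1[unfolded f1 f2]])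
qed

lemma norm_contraction:
  fixes k V W e w h :: real
  shows "2 * ((W * e - h * w) / (2 * k) * w + (V * e + W * w) / (2 * k) * e) = (- h * w\<^sup>2 + 2 * W * w * e + V * e\<^sup>2) / k"
  by (simp add: add_divide_distrib diff_divide_distrib power2_eq_square algebra_simps)

lemma twist_contraction:
  fixes k V W e v w h :: real
  shows "(h * v + W * w) / (2 * k) * w + (V * w - W * v) / (2 * k) * e - (W * e - h * w) / (2 * k) * v
     + (V * e + W * w) / (2 * k) * w = (h * v * w + W * w\<^sup>2 + V * w * e - W * v * e) / k"
  by (simp add: add_divide_distrib diff_divide_distrib power2_eq_square algebra_simps)

text \<open>\<open>P\<close> and \<open>Q\<close> are the components of \<open>(\<eta> dW - W d\<eta>)/\<rho>\<close>, a divergence-free field whose flux is the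
  angular momentum.\<close>

context weyl_papapetrou
begin

definition P :: "real \<times> real \<Rightarrow> real" where "P q = (\<eta> q * Dr W q - W q * Dr \<eta> q) / snd q"
definition Q :: "real \<times> real \<Rightarrow> real" where "Q q = (\<eta> q * Dz W q - W q * Dz \<eta> q) / snd q"
text \<open>The radial derivative of \<open>P\<close>: in the derivative of the numerator the
  products of first derivatives cancel. The same happens for \<open>Qz\<close>.\<close>

definition Pr :: "real \<times> real \<Rightarrow> real" where
  "Pr q = (\<eta> q * Dr (Dr W) q - W q * Dr (Dr \<eta>) q) / snd q - P q / snd q"
definition Qz :: "real \<times> real \<Rightarrow> real" where
  "Qz q = (\<eta> q * Dz (Dz W) q - W q * Dz (Dz \<eta>) q) / snd q"

lemma P_has_derivative:
  assumes r: "0 < r"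
  shows "((\<lambda>r. P (z, r)) has_real_derivative Pr (z, r)) (at r)"
proof -
  note d = smooth_has_real_derivative(2)[OF smooth(2) r, of z] smooth_has_real_derivative(2)[OF smooth(3) r, of z]
    smooth_has_real_derivative(2)[OF smooth_on_Dr[OF smooth(2)] r, of z]
    smooth_has_real_derivative(2)[OF smooth_on_Dr[OF smooth(3)] r, of z]
  have "((\<lambda>r. (\<eta> (z, r) * Dr W (z, r) - W (z, r) * Dr \<eta> (z, r)) / r) has_real_derivative Pr (z, r)) (at r)"
    by (rule derivative_eq_intros d refl)+
       (use r in \<open>simp_all add: Pr_def P_def field_simps power2_eq_square\<close>)
  then show ?thesis by (simp add: P_def)
qed

lemma Q_has_derivative:
  assumes r: "0 < r"
  shows "((\<lambda>z. Q (z, r)) has_real_derivative Qz (z, r)) (at z)"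
proof -
  note d = smooth_has_real_derivative(1)[OF smooth(2) r, of z] smooth_has_real_derivative(1)[OF smooth(3) r, of z]
    smooth_has_real_derivative(1)[OF smooth_on_Dz[OF smooth(2)] r, of z]
    smooth_has_real_derivative(1)[OF smooth_on_Dz[OF smooth(3)] r, of z]
  have "((\<lambda>z. (\<eta> (z, r) * Dz W (z, r) - W (z, r) * Dz \<eta> (z, r)) / r) has_real_derivative Qz (z, r)) (at z)"
    by (rule derivative_eq_intros d refl)+
       (use r in \<open>simp_all add: Qz_def field_simps\<close>)
  then show ?thesis by (simp add: Q_def)
qed

end

locale vacuum_weyl_papapetrou = weyl_papapetrou +
  assumes vacuum: "\<And>x i j. 0 < x $ 4 \<Longrightarrow> ricci g i j x = 0"
begin

lemma norm_equation_raw: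
  assumes r: "0 < r"
  shows "Dz (Dz \<eta>) (z, r) + Dr (Dr \<eta>) (z, r) = - Dr \<eta> (z, r) / r
    + (- \<eta> (z, r) * (Dz W (z, r))\<^sup>2 + 2 * W (z, r) * Dz W (z, r) * Dz \<eta> (z, r) + V (z, r) * (Dz \<eta> (z, r))\<^sup>2) / r\<^sup>2
    + (- \<eta> (z, r) * (Dr W (z, r))\<^sup>2 + 2 * W (z, r) * Dr W (z, r) * Dr \<eta> (z, r) + V (z, r) * (Dr \<eta> (z, r))\<^sup>2) / r\<^sup>2"
proof -
  define x :: "real ^ 4" where "x = vector [0, 0, z, r]"
  have xx: "x $ 3 = z" "x $ 4 = r" by (simp_all add: x_def)
  have x: "0 < x $ 4" using r xx by simp
  have lin: "D = - n / r + T1 + T2" if "0 = - D - n / r + 2 * (p1 + p2 + p3 + p4)"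
    "2 * (p1 + p2) = T1" "2 * (p3 + p4) = T2" for D n p1 p2 p3 p4 T1 T2 :: real
    using that by simp
  show ?thesis
  proof (rule lin)
    show "0 = - (Dz (Dz \<eta>) (z, r) + Dr (Dr \<eta>) (z, r)) - Dr \<eta> (z, r) / r
      + 2 * (christoffel g 1 2 3 x * Dz W (z, r) + christoffel g 2 2 3 x * Dz \<eta> (z, r)
         + christoffel g 1 2 4 x * Dr W (z, r) + christoffel g 2 2 4 x * Dr \<eta> (z, r))"
      using ricci_22[OF x] by (simp add: vacuum[OF x] xx)
  qed (unfold christoffel_mixed[OF x] xx, rule norm_contraction, rule norm_contraction)
qed

lemma norm_equation:
  assumes r: "0 < r"
  shows "Dz (Dz \<eta>) (z, r) + Dr (Dr \<eta>) (z, r) = - Dr \<eta> (z, r) / r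
    + ((Dz \<eta> (z, r))\<^sup>2 + (Dr \<eta> (z, r))\<^sup>2) / \<eta> (z, r) - ((P (z, r))\<^sup>2 + (Q (z, r))\<^sup>2) / \<eta> (z, r)"
  using norm_equation_raw[OF r, of z]
    block_trace_identities(1)[OF r eta_pos[OF r] gram[OF r] gram_z[OF r], of z]
    block_trace_identities(1)[OF r eta_pos[OF r] gram[OF r] gram_r[OF r], of z]
  by (simp add: P_def Q_def add_divide_distrib)

text \<open>\<eta> times the vanishing of component 12 minus \<open>W\<close> times the vanishing of
  component 22; in this combination the quadratic terms collapse by the Gram relation.\<close>

lemma twist_equation:
  assumes r: "0 < r"
  shows "Pr (z, r) + Qz (z, r) = 0"
proof -
  define x :: "real ^ 4" where "x = vector [0, 0, z, r]"
  have xx: "x $ 3 = z" "x $ 4 = r" by (simp_all add: x_def)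
  have x: "0 < x $ 4" using r xx by simp
  let ?h = "\<eta> (z, r)" and ?W = "W (z, r)" and ?V = "V (z, r)"
  let ?S = "\<lambda>v w e. (?h * v * w + ?W * w\<^sup>2 + ?V * w * e - ?W * v * e) / r\<^sup>2"
  let ?T = "\<lambda>w e. (- ?h * w\<^sup>2 + 2 * ?W * w * e + ?V * e\<^sup>2) / r\<^sup>2"
  have W2: "Dz (Dz W) (z, r) + Dr (Dr W) (z, r) = - Dr W (z, r) / r
      + ?S (Dz V (z, r)) (Dz W (z, r)) (Dz \<eta> (z, r)) + ?S (Dr V (z, r)) (Dr W (z, r)) (Dr \<eta> (z, r))"
  proof -
    have lin: "D = - n / r + T1 + T2" if "0 = - D - n / r + p1 + p2 - p3 + p4 + p5 + p6 - p7 + p8"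
      "p1 + p2 - p3 + p4 = T1" "p5 + p6 - p7 + p8 = T2" for D n p1 p2 p3 p4 p5 p6 p7 p8 T1 T2 :: real
      using that by simp
    show ?thesis
    proof (rule lin)
      show "0 = - (Dz (Dz W) (z, r) + Dr (Dr W) (z, r)) - Dr W (z, r) / r
        + christoffel g 1 1 3 x * Dz W (z, r) + christoffel g 2 1 3 x * Dz \<eta> (z, r)
        - christoffel g 1 2 3 x * Dz V (z, r) + christoffel g 2 2 3 x * Dz W (z, r)
        + christoffel g 1 1 4 x * Dr W (z, r) + christoffel g 2 1 4 x * Dr \<eta> (z, r)
        - christoffel g 1 2 4 x * Dr V (z, r) + christoffel g 2 2 4 x * Dr W (z, r)"
        using ricci_12[OF x] by (simp add: vacuum[OF x] xx)
    qed (unfold christoffel_mixed[OF x] xx, rule twist_contraction, rule twist_contraction)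
  qed
  have z: "?h * ?S (Dz V (z, r)) (Dz W (z, r)) (Dz \<eta> (z, r)) - ?W * ?T (Dz W (z, r)) (Dz \<eta> (z, r)) = 0"
    using block_trace_identities(2)[OF r eta_pos[OF r] gram[OF r] gram_z[OF r], of z] by simp
  have rr: "?h * ?S (Dr V (z, r)) (Dr W (z, r)) (Dr \<eta> (z, r)) - ?W * ?T (Dr W (z, r)) (Dr \<eta> (z, r)) = 2 * P (z, r)"
    using block_trace_identities(2)[OF r eta_pos[OF r] gram[OF r] gram_r[OF r], of z] r
    by (simp add: P_def power2_eq_square)
  have P: "?h * (Dr W (z, r) / r) - ?W * (Dr \<eta> (z, r) / r) = P (z, r)"
    by (simp add: P_def diff_divide_distrib)
  \<comment> \<open>The first-order terms contribute \<open>- P\<close> and the quadratic ones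
    \<open>2 * P\<close>; the resulting \<open>P\<close> balances the term
    \<open>- P q / snd q\<close> in \<open>Pr\<close>.\<close>
  have "?h * (Dz (Dz W) (z, r) + Dr (Dr W) (z, r)) - ?W * (Dz (Dz \<eta>) (z, r) + Dr (Dr \<eta>) (z, r)) = P (z, r)"
    unfolding W2 norm_equation_raw[OF r]
    using z rr P by (simp only: distrib_left minus_divide_left[symmetric] mult_minus_right)
  then show ?thesis
    by (simp add: Pr_def Qz_def algebra_simps diff_divide_distrib[symmetric] add_divide_distrib[symmetric])
qed

text \<open>Components 33 and 44 added; the Laplacian of \<eta> contained in
  \<open>czz + crr\<close> is eliminated with \<open>norm_equation\<close>.\<close>

lemma conformal_equation:
  assumes r: "0 < r"
  shows "Dz (Dz \<gamma>) (z, r) + Dr (Dr \<gamma>) (z, r) =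
    - ((Dz \<eta> (z, r))\<^sup>2 + (Dr \<eta> (z, r))\<^sup>2 + (P (z, r))\<^sup>2 + (Q (z, r))\<^sup>2) / (4 * (\<eta> (z, r))\<^sup>2)"
proof -
  define x :: "real ^ 4" where "x = vector [0, 0, z, r]"
  have xx: "x $ 3 = z" "x $ 4 = r" by (simp_all add: x_def)
  have x: "0 < x $ 4" using r xx by simp
  have h: "0 < \<eta> (z, r)" using eta_pos[OF r] .
  have "2 * (czz (z, r) + crr (z, r)) = 1 / r\<^sup>2
      + (((Q (z, r))\<^sup>2 - (Dz \<eta> (z, r))\<^sup>2) / (2 * (\<eta> (z, r))\<^sup>2))
      - ((2 * r)\<^sup>2 / (4 * r ^ 4) - 2 * r * Dr \<eta> (z, r) / (2 * r\<^sup>2 * \<eta> (z, r)) - ((P (z, r))\<^sup>2 - (Dr \<eta> (z, r))\<^sup>2) / (2 * (\<eta> (z, r))\<^sup>2))"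
    using ricci_33_44[OF x] block_trace_identities(3)[OF r h gram[OF r] gram_z[OF r]]
      block_trace_identities(3)[OF r h gram[OF r] gram_r[OF r]]
    unfolding vacuum[OF x] xx christoffel_mixed[OF x] by (simp add: P_def Q_def)
  also have "(2 * r)\<^sup>2 / (4 * r ^ 4) = 1 / r\<^sup>2"
    using r by (simp add: power2_eq_square power4_eq_xxxx)
  also have "2 * r * Dr \<eta> (z, r) / (2 * r\<^sup>2 * \<eta> (z, r)) = Dr \<eta> (z, r) / (r * \<eta> (z, r))"
    using r by (simp add: power2_eq_square)
  finally have 1: "2 * (czz (z, r) + crr (z, r)) = Dr \<eta> (z, r) / (r * \<eta> (z, r))
      + (((P (z, r))\<^sup>2 + (Q (z, r))\<^sup>2) - ((Dz \<eta> (z, r))\<^sup>2 + (Dr \<eta> (z, r))\<^sup>2)) / (2 * (\<eta> (z, r))\<^sup>2)"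
    by (simp add: add_divide_distrib diff_divide_distrib)
  have 2: "czz (z, r) + crr (z, r) = Dz (Dz \<gamma>) (z, r) + Dr (Dr \<gamma>) (z, r)
     - (Dz (Dz \<eta>) (z, r) + Dr (Dr \<eta>) (z, r)) / (2 * \<eta> (z, r)) + ((Dz \<eta> (z, r))\<^sup>2 + (Dr \<eta> (z, r))\<^sup>2) / (2 * (\<eta> (z, r))\<^sup>2)"
    by (simp add: czz_def crr_def add_divide_distrib)
  have "Dz (Dz \<gamma>) (z, r) + Dr (Dr \<gamma>) (z, r) =
    - (((Dz \<eta> (z, r))\<^sup>2 + (Dr \<eta> (z, r))\<^sup>2) + ((P (z, r))\<^sup>2 + (Q (z, r))\<^sup>2)) / (4 * (\<eta> (z, r))\<^sup>2)"
    by (rule conformal_factor_algebra[OF 1[unfolded 2] norm_equation[OF r]]) (use r h in auto)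
  then show ?thesis by (simp only: add.assoc)
qed

end

section \<open>The angular momentum\<close>

lemma det_4:
  fixes A :: "real ^ 4 ^ 4"
  shows "det A =
     A$1$1 * (A$2$2 * (A$3$3 * A$4$4 - A$3$4 * A$4$3) - A$2$3 * (A$3$2 * A$4$4 - A$3$4 * A$4$2) + A$2$4 * (A$3$2 * A$4$3 - A$3$3 * A$4$2))
   - A$1$2 * (A$2$1 * (A$3$3 * A$4$4 - A$3$4 * A$4$3) - A$2$3 * (A$3$1 * A$4$4 - A$3$4 * A$4$1) + A$2$4 * (A$3$1 * A$4$3 - A$3$3 * A$4$1))
   + A$1$3 * (A$2$1 * (A$3$2 * A$4$4 - A$3$4 * A$4$2) - A$2$2 * (A$3$1 * A$4$4 - A$3$4 * A$4$1) + A$2$4 * (A$3$1 * A$4$2 - A$3$2 * A$4$1))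
   - A$1$4 * (A$2$1 * (A$3$2 * A$4$3 - A$3$3 * A$4$2) - A$2$2 * (A$3$1 * A$4$3 - A$3$3 * A$4$1) + A$2$3 * (A$3$1 * A$4$2 - A$3$2 * A$4$1))"
proof -
  have f: "finite {2::4, 3, 4}" "1 \<notin> {2::4, 3, 4}" "finite {3::4, 4}" "2 \<notin> {3::4, 4}" "finite {4::4}" "3 \<notin> {4::4}"
    by auto
  show ?thesis
    unfolding det_def UNIV_4
    unfolding sum_over_permutations_insert[OF f(1,2)]
    unfolding sum_over_permutations_insert[OF f(3,4)]
    unfolding sum_over_permutations_insert[OF f(5,6)]
    unfolding permutes_sing
    by (simp add: sign_swap_id permutation_swap_id sign_compose sign_id permutation_compose swap_id_eq algebra_simps)
qed

context weyl_papapetrou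
begin

lemma det_g:
  assumes x: "0 < x $ 4"
  shows "det (g x) = - (A (x $ 3, x $ 4) * x $ 4)\<^sup>2"
proof -
  have "det (g x) = - (A (x $ 3, x $ 4))\<^sup>2 * (V (x $ 3, x $ 4) * \<eta> (x $ 3, x $ 4) + (W (x $ 3, x $ 4))\<^sup>2)"
    by (simp add: det_4 g_components power2_eq_square algebra_simps)
  then show ?thesis
    using gram[OF x] by (simp add: power_mult_distrib)
qed

text \<open>On a torus with coordinates 2 and 3 the Hodge dual picks the raised components with
  indices 1 and 4. Raising with \<open>ginv\<close> combines the radial derivatives of
  \<open>W\<close> and \<eta> into the numerator of \<open>P\<close>.\<close>

lemma komar_integrand:
  assumes x: "0 < x $ 4"
  shows "hodge_star (g x) (exterior_deriv (\<lambda>y. g y *v axis 2 1) x) $ 2 $ 3 = P (x $ 3, x $ 4)"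
proof -
  let ?B = "exterior_deriv (\<lambda>y. g y *v axis 2 1) x"
  have gax: "(g y *v axis 2 1) $ j = g y $ j $ 2" for y j
    by (simp add: matrix_vector_mult_def axis_def sum_4)
  have B: "?B $ 1 $ 4 = - Dr W (x $ 3, x $ 4)" "?B $ 2 $ 4 = - Dr \<eta> (x $ 3, x $ 4)"
    "?B $ 4 $ 1 = Dr W (x $ 3, x $ 4)" "?B $ 4 $ 2 = Dr \<eta> (x $ 3, x $ 4)"
    by (simp_all add: exterior_deriv_def gax pd_g_components[OF x])
  have Ax: "0 < A (x $ 3, x $ 4)" using A_pos[OF x] .
  have l: "levi_civita 1 4 2 3 = 1" "levi_civita 4 1 2 3 = - 1"
    by (simp_all add: levi_civita_def det_4 axis_def)
  have l0: "levi_civita i j 2 3 = 0" if "(i, j) \<noteq> (1, 4)" "(i, j) \<noteq> (4, 1)" for i j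
    using that exhaust_4[of i] exhaust_4[of j] by (auto simp: levi_civita_def det_4 axis_def)
  define M where "M = ginv x ** ?B ** transpose (ginv x)"
  have M: "M $ 1 $ 4 = P (x $ 3, x $ 4) / (A (x $ 3, x $ 4) * x $ 4)" "M $ 4 $ 1 = - P (x $ 3, x $ 4) / (A (x $ 3, x $ 4) * x $ 4)"
    using x Ax by (simp_all add: M_def matrix_matrix_mult_def transpose_def sum_4 B P_def field_simps power2_eq_square)
  have "sqrt \<bar>det (g x)\<bar> = A (x $ 3, x $ 4) * x $ 4"
    using x Ax by (simp add: det_g[OF x])
  then show ?thesis
    using x Ax by (simp add: hodge_star_def Let_def matrix_inv_g[OF x] M_def[symmetric] sum_4 l l0 M)
qed

text \<open>The integrand is independent of the angle, so the prefactor becomes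
  \<open>2 * pi / (16 * pi) = 1/8\<close>.\<close>

lemma komar_eq:
  assumes r: "0 < r"
  shows "komar_angular_momentum L g t r = integral {-L/2..L/2} (\<lambda>z. P (z, r)) / 8"
proof -
  have "hodge_star (g (vector [t, \<phi>, z, r])) (exterior_deriv (\<lambda>y. g y *v axis 2 1) (vector [t, \<phi>, z, r])) $ 2 $ 3 = P (z, r)" for \<phi> z
    using komar_integrand[of "vector [t, \<phi>, z, r]"] r by simp
  then show ?thesis
    by (simp add: komar_angular_momentum_def Let_def)
qed

end

section \<open>Averages over a period\<close>

locale periodic_vacuum = vacuum_weyl_papapetrou +
  fixes L :: real
  assumes L_pos: "0 < L"
    and periodic: "\<And>z r. 0 < r \<Longrightarrow> W (z + L, r) = W (z, r)" "\<And>z r. 0 < r \<Longrightarrow> \<eta> (z + L, r) = \<eta> (z, r)"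
      "\<And>z r. 0 < r \<Longrightarrow> \<gamma> (z + L, r) = \<gamma> (z, r)"
begin

text \<open>An integral rather than a mean: thresholds for means appear below multiplied by
  \<open>L\<close>.\<close>

definition circ :: "(real \<times> real \<Rightarrow> real) \<Rightarrow> real \<Rightarrow> real" where
  "circ f r = integral {-L/2..L/2} (\<lambda>z. f (z, r))"

lemma continuous_on_slice:
  assumes "continuous_on half_plane f" "0 < r"
  shows "continuous_on S (\<lambda>z. f (z, r))"
  by (rule continuous_on_compose2[OF assms(1)]) (use assms(2) in \<open>auto intro!: continuous_intros\<close>)

lemma circ_has_integral:
  assumes "continuous_on half_plane f" "0 < r"
  shows "((\<lambda>z. f (z, r)) has_integral circ f r) {-L/2..L/2}"
  unfolding circ_def
  by (intro integrable_integral integrable_continuous_real continuous_on_slice assms)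

lemma circ_const: "((\<lambda>z. a) has_integral L * a) {-L/2..L/2}"
  using has_integral_const_real[of a "-L/2" "L/2"] L_pos by simp

lemma circ_mono:
  assumes "continuous_on half_plane f" "continuous_on half_plane h" "0 < r" "\<And>z. f (z, r) \<le> h (z, r)"
  shows "circ f r \<le> circ h r"
  by (rule has_integral_le[OF circ_has_integral[OF assms(1,3)] circ_has_integral[OF assms(2,3)]]) (rule assms(4))

lemma circ_deriv:
  assumes f: "continuous_on half_plane f" and f': "continuous_on half_plane f'" and r: "0 < r"
    and d: "\<And>z r. 0 < r \<Longrightarrow> ((\<lambda>r. f (z, r)) has_real_derivative f' (z, r)) (at r)"
  shows "(circ f has_real_derivative circ f' r) (at r)"
proof -
  have "((\<lambda>x. integral (cbox (-L/2) (L/2)) (\<lambda>z. f (z, x))) has_field_derivative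
      integral (cbox (-L/2) (L/2)) (\<lambda>z. f' (z, r))) (at r within {0<..})"
  proof (rule leibniz_rule_field_derivative)
    show "((\<lambda>x. f (t, x)) has_real_derivative f' (t, x)) (at x within {0<..})" if "x \<in> {0<..}" for x t
      using d[of x t] that by (auto intro: has_field_derivative_at_within)
    show "(\<lambda>z. f (z, x)) integrable_on cbox (- L / 2) (L / 2)" if "x \<in> {0<..}" for x
      using that by (auto intro!: integrable_continuous_real continuous_on_slice f)
    show "continuous_on ({0<..} \<times> cbox (- L / 2) (L / 2)) (\<lambda>(x, t). f' (t, x))"
      unfolding split_beta by (rule continuous_on_compose2[OF f']) (auto intro!: continuous_intros)
  qed (use r in auto)
  then show ?thesis
    using r by (simp add: circ_def[abs_def] at_within_open[of r "{0<..}"])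
qed

lemma circ_periodic_derivative:
  assumes r: "0 < r" and d: "\<And>z. ((\<lambda>z. f (z, r)) has_real_derivative f' (z, r)) (at z)"
    and per: "\<And>z. f (z + L, r) = f (z, r)"
  shows "circ f' r = 0"
proof -
  have "((\<lambda>z. f' (z, r)) has_integral f (L/2, r) - f (-L/2, r)) {-L/2..L/2}"
  proof (rule fundamental_theorem_of_calculus)
    show "((\<lambda>z. f (z, r)) has_vector_derivative f' (x, r)) (at x within {-L/2..L/2})" for x
      using has_field_derivative_at_within[OF d[of x]] by (simp add: has_real_derivative_iff_has_vector_derivative)
  qed (use L_pos in simp)
  moreover have "f (L/2, r) = f (-L/2, r)"
    using per[of "-L/2"] by simp
  ultimately show ?thesis
    unfolding circ_def by (simp add: integral_unique)
qed

text \<open>Two values on the circle differ by at most the total variation; averaging over one of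
  the two points gives the mean.\<close>

lemma circ_oscillation:
  assumes f: "continuous_on half_plane f" and f': "continuous_on half_plane f'" and r: "0 < r"
    and d: "\<And>z. ((\<lambda>z. f (z, r)) has_real_derivative f' (z, r)) (at z)"
    and z: "z \<in> {-L/2..L/2}"
  shows "f (z, r) \<le> circ f r / L + circ (\<lambda>q. \<bar>f' q\<bar>) r"
proof -
  let ?O = "circ (\<lambda>q. \<bar>f' q\<bar>) r"
  have af: "continuous_on half_plane (\<lambda>q. \<bar>f' q\<bar>)"
    by (intro continuous_intros f')
  have osc: "\<bar>f (b, r) - f (a, r)\<bar> \<le> ?O" if ab: "-L/2 \<le> a" "a \<le> b" "b \<le> L/2" for a b
  proof -
    have 1: "((\<lambda>z. f' (z, r)) has_integral f (b, r) - f (a, r)) {a..b}"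
    proof (rule fundamental_theorem_of_calculus[OF ab(2)])
      show "((\<lambda>z. f (z, r)) has_vector_derivative f' (x, r)) (at x within {a..b})" for x
        using has_field_derivative_at_within[OF d[of x]] by (simp add: has_real_derivative_iff_has_vector_derivative)
    qed
    have 2: "(\<lambda>z. \<bar>f' (z, r)\<bar>) integrable_on {a..b}"
      by (intro integrable_continuous_real continuous_on_slice[OF af r])
    have "norm (integral {a..b} (\<lambda>z. f' (z, r))) \<le> integral {a..b} (\<lambda>z. \<bar>f' (z, r)\<bar>)"
      by (rule integral_norm_bound_integral[OF has_integral_integrable[OF 1] 2]) simp
    then have "norm (f (b, r) - f (a, r)) \<le> integral {a..b} (\<lambda>z. \<bar>f' (z, r)\<bar>)"
      by (simp only: integral_unique[OF 1])
    also have "\<dots> \<le> ?O"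
      unfolding circ_def using ab
      by (intro integral_subset_le integrable_continuous_real continuous_on_slice[OF af r]) auto
    finally show ?thesis by simp
  qed
  have le: "f (z, r) - ?O \<le> f (y, r)" if y: "y \<in> {-L/2..L/2}" for y
    using osc[of y z] osc[of z y] y z by (cases "y \<le> z") auto
  have "L * (f (z, r) - ?O) \<le> circ f r"
    by (rule has_integral_le[OF circ_const circ_has_integral[OF f r]]) (use le in auto)
  then show ?thesis
    using L_pos by (simp add: field_simps)
qed

section \<open>The logarithm of \<eta>, the energy density and their fluxes\<close>

definition \<sigma> :: "real \<times> real \<Rightarrow> real" where "\<sigma> q = ln (\<eta> q)"
definition \<sigma>z :: "real \<times> real \<Rightarrow> real" where "\<sigma>z q = Dz \<eta> q / \<eta> q"
definition \<sigma>r :: "real \<times> real \<Rightarrow> real" where "\<sigma>r q = Dr \<eta> q / \<eta> q"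
definition \<sigma>zz :: "real \<times> real \<Rightarrow> real" where "\<sigma>zz q = Dz (Dz \<eta>) q / \<eta> q - (Dz \<eta> q)\<^sup>2 / (\<eta> q)\<^sup>2"
definition \<sigma>rr :: "real \<times> real \<Rightarrow> real" where "\<sigma>rr q = Dr (Dr \<eta>) q / \<eta> q - (Dr \<eta> q)\<^sup>2 / (\<eta> q)\<^sup>2"
definition K :: "real \<times> real \<Rightarrow> real" where "K q = ((P q)\<^sup>2 + (Q q)\<^sup>2) / (\<eta> q)\<^sup>2"

lemma eta_ne: "q \<in> half_plane \<Longrightarrow> \<eta> q \<noteq> 0" "q \<in> half_plane \<Longrightarrow> 0 < \<eta> q"
  using eta_pos[of "snd q" "fst q"] by auto

lemmas basic_cont = smooth_on_continuous[OF smooth(2)] smooth_on_continuous[OF smooth(3)]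
  smooth_on_continuous[OF smooth_on_Dz[OF smooth(2)]] smooth_on_continuous[OF smooth_on_Dr[OF smooth(2)]]
  smooth_on_continuous[OF smooth_on_Dz[OF smooth(3)]] smooth_on_continuous[OF smooth_on_Dr[OF smooth(3)]]
  smooth_on_continuous[OF smooth_on_Dz[OF smooth_on_Dz[OF smooth(2)]]] smooth_on_continuous[OF smooth_on_Dr[OF smooth_on_Dr[OF smooth(2)]]]
  smooth_on_continuous[OF smooth_on_Dz[OF smooth_on_Dz[OF smooth(3)]]] smooth_on_continuous[OF smooth_on_Dr[OF smooth_on_Dr[OF smooth(3)]]]
  smooth_on_continuous[OF smooth_on_Dr[OF smooth(4)]] smooth_on_continuous[OF smooth_on_Dz[OF smooth(4)]]
  smooth_on_continuous[OF smooth_on_Dr[OF smooth_on_Dr[OF smooth(4)]]] smooth_on_continuous[OF smooth_on_Dz[OF smooth_on_Dz[OF smooth(4)]]]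

lemma \<sigma>_cont: "continuous_on half_plane \<sigma>"
  unfolding \<sigma>_def[abs_def] by (intro continuous_intros basic_cont ballI eta_ne)

lemma P_cont: "continuous_on half_plane P"
  unfolding P_def[abs_def] by (intro continuous_intros basic_cont) auto

lemma Q_cont: "continuous_on half_plane Q"
  unfolding Q_def[abs_def] by (intro continuous_intros basic_cont) auto

lemma field_cont:
  "continuous_on half_plane \<sigma>z" "continuous_on half_plane \<sigma>r" "continuous_on half_plane \<sigma>zz" "continuous_on half_plane \<sigma>rr"
  "continuous_on half_plane K" "continuous_on half_plane Pr" "continuous_on half_plane Qz"
  unfolding \<sigma>z_def[abs_def] \<sigma>r_def[abs_def] \<sigma>zz_def[abs_def] \<sigma>rr_def[abs_def] K_def[abs_def] Pr_def[abs_def] Qz_def[abs_def]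
  using eta_ne by (auto intro!: continuous_intros basic_cont P_cont Q_cont)

lemma \<sigma>_derivs:
  assumes r: "0 < r"
  shows "((\<lambda>z. \<sigma> (z, r)) has_real_derivative \<sigma>z (z, r)) (at z)" "((\<lambda>r. \<sigma> (z, r)) has_real_derivative \<sigma>r (z, r)) (at r)"
    "((\<lambda>z. \<sigma>z (z, r)) has_real_derivative \<sigma>zz (z, r)) (at z)" "((\<lambda>r. \<sigma>r (z, r)) has_real_derivative \<sigma>rr (z, r)) (at r)"
proof -
  note dz = smooth_has_real_derivative(1)[OF smooth(3) r, of z] smooth_has_real_derivative(1)[OF smooth_on_Dz[OF smooth(3)] r, of z]
  note dr = smooth_has_real_derivative(2)[OF smooth(3) r, of z] smooth_has_real_derivative(2)[OF smooth_on_Dr[OF smooth(3)] r, of z]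
  have n: "0 < \<eta> (z, r)" using eta_pos[OF r] .
  show "((\<lambda>z. \<sigma> (z, r)) has_real_derivative \<sigma>z (z, r)) (at z)"
    unfolding \<sigma>_def by (rule derivative_eq_intros dz n refl)+ (simp add: \<sigma>z_def)
  show "((\<lambda>r. \<sigma> (z, r)) has_real_derivative \<sigma>r (z, r)) (at r)"
    unfolding \<sigma>_def by (rule derivative_eq_intros dr n refl)+ (simp add: \<sigma>r_def)
  show "((\<lambda>z. \<sigma>z (z, r)) has_real_derivative \<sigma>zz (z, r)) (at z)"
    unfolding \<sigma>z_def by (rule derivative_eq_intros dz refl)+ (use n in \<open>simp_all add: \<sigma>zz_def power2_eq_square diff_divide_distrib\<close>)
  show "((\<lambda>r. \<sigma>r (z, r)) has_real_derivative \<sigma>rr (z, r)) (at r)"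
    unfolding \<sigma>r_def by (rule derivative_eq_intros dr refl)+ (use n in \<open>simp_all add: \<sigma>rr_def power2_eq_square diff_divide_distrib\<close>)
qed

text \<open>\<open>norm_equation\<close> divided by \<eta>: its gradient term is exactly what
  distinguishes the Laplacian of ln \<eta> from that of \<eta> divided by \<eta>.\<close>

lemma log_norm_equation:
  assumes r: "0 < r"
  shows "\<sigma>r (z, r) + r * \<sigma>rr (z, r) = - r * \<sigma>zz (z, r) - r * K (z, r)"
proof -
  have lin: "e / h + r * (a / h - e\<^sup>2 / h\<^sup>2) = - r * (b / h - d\<^sup>2 / h\<^sup>2) - r * (k / h\<^sup>2)"
    if "b + a = - e / r + (d\<^sup>2 + e\<^sup>2) / h - k / h" "h \<noteq> 0" for a b d e h k :: real
  proof -
    have a: "a = - e / r + (d\<^sup>2 + e\<^sup>2) / h - k / h - b" using that(1) by simp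
    show ?thesis
      unfolding a using r that(2) by (simp add: field_simps power2_eq_square)
  qed
  show ?thesis
    unfolding \<sigma>r_def \<sigma>rr_def \<sigma>zz_def K_def
    by (rule lin[OF norm_equation[OF r]]) (use eta_pos[OF r, of z] in simp)
qed

definition F :: "real \<times> real \<Rightarrow> real" where "F q = (\<sigma>z q)\<^sup>2 + (\<sigma>r q)\<^sup>2 + K q"

lemma F_cont: "continuous_on half_plane F"
  unfolding F_def[abs_def] by (intro continuous_intros field_cont)

lemma periodic_fields:
  assumes r: "0 < r"
  shows "\<sigma>z (z + L, r) = \<sigma>z (z, r)" "Q (z + L, r) = Q (z, r)" "Dz \<gamma> (z + L, r) = Dz \<gamma> (z, r)"
proof -
  have 1: "Dz \<eta> (z + L, r) = Dz \<eta> (z, r)" "Dz W (z + L, r) = Dz W (z, r)"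
    using smooth_periodic_D(1)[of \<eta> L r z] smooth_periodic_D(1)[of W L r z] smooth periodic r by blast+
  then show "\<sigma>z (z + L, r) = \<sigma>z (z, r)" "Q (z + L, r) = Q (z, r)"
    using periodic r by (simp_all add: \<sigma>z_def Q_def)
  show "Dz \<gamma> (z + L, r) = Dz \<gamma> (z, r)"
    using smooth_periodic_D(1)[of \<gamma> L r z] smooth periodic r by blast
qed

text \<open>The twist field is divergence-free, and its horizontal component is periodic.\<close>

lemma twist_flux_const:
  assumes r: "0 < r" "0 < r'"
  shows "circ P r = circ P r'"
proof -
  have "(circ P has_real_derivative 0) (at x)" if x: "0 < x" for x
  proof -
    have "circ Pr x = - circ Qz x"
      unfolding circ_def integral_neg[symmetric]
      by (rule integral_cong) (use twist_equation[OF x] in \<open>simp add: eq_neg_iff_add_eq_0\<close>)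
    also have "circ Qz x = 0"
      by (rule circ_periodic_derivative[OF x Q_has_derivative[OF x] periodic_fields(2)[OF x]])
    finally show ?thesis
      using circ_deriv[OF P_cont field_cont(6) x P_has_derivative] by simp
  qed
  then have "(circ P has_real_derivative 0) (at x within {0<..})" if "x \<in> {0<..}" for x
    using that has_field_derivative_at_within by blast
  then obtain c where "\<And>x. x \<in> {0<..} \<Longrightarrow> circ P x = c"
    using has_field_derivative_zero_constant[of "{0<..}" "circ P"] by auto
  then show ?thesis using r by simp
qed

lemma log_flux_deriv:
  assumes r: "0 < r"
  shows "((\<lambda>r. r * circ \<sigma>r r) has_real_derivative - r * circ K r) (at r)"
proof -
  have "((\<lambda>r. r * circ \<sigma>r r) has_real_derivative (circ \<sigma>r r + r * circ \<sigma>rr r)) (at r)"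
    using DERIV_mult[OF DERIV_ident circ_deriv[OF field_cont(2,4) r \<sigma>_derivs(4)]] by (simp add: mult.commute)
  moreover have "circ \<sigma>r r + r * circ \<sigma>rr r = - r * circ K r"
  proof -
    have 1: "((\<lambda>z. \<sigma>r (z, r) + r * \<sigma>rr (z, r)) has_integral circ \<sigma>r r + r * circ \<sigma>rr r) {-L/2..L/2}"
      by (intro has_integral_add has_integral_mult_right circ_has_integral field_cont r)
    have 2: "((\<lambda>z. - r * \<sigma>zz (z, r) - r * K (z, r)) has_integral - r * circ \<sigma>zz r - r * circ K r) {-L/2..L/2}"
      by (intro has_integral_diff has_integral_mult_right circ_has_integral field_cont r)
    have "circ \<sigma>zz r = 0"
      by (rule circ_periodic_derivative[OF r \<sigma>_derivs(3)[OF r] periodic_fields(1)[OF r]])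
    then show ?thesis
      using has_integral_unique[OF 1[unfolded log_norm_equation[OF r]] 2] by simp
  qed
  ultimately show ?thesis by simp
qed

lemma conformal_flux_deriv:
  assumes r: "0 < r"
  shows "(circ (Dr \<gamma>) has_real_derivative - circ F r / 4) (at r)"
proof -
  have 1: "((\<lambda>z. Dz (Dz \<gamma>) (z, r) + Dr (Dr \<gamma>) (z, r)) has_integral circ (Dz (Dz \<gamma>)) r + circ (Dr (Dr \<gamma>)) r) {-L/2..L/2}"
    by (intro has_integral_add circ_has_integral basic_cont r)
  have 2: "circ (Dz (Dz \<gamma>)) r = 0"
    by (rule circ_periodic_derivative[OF r smooth_has_real_derivative(1)[OF smooth_on_Dz[OF smooth(4)] r] periodic_fields(3)[OF r]])
  have 3: "Dz (Dz \<gamma>) (z, r) + Dr (Dr \<gamma>) (z, r) = (- 1/4) * F (z, r)" for z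
    unfolding conformal_equation[OF r] F_def \<sigma>z_def \<sigma>r_def K_def
    by (simp add: power_divide add_divide_distrib diff_divide_distrib)
  have 4: "((\<lambda>z. (- 1/4) * F (z, r)) has_integral (- 1/4) * circ F r) {-L/2..L/2}"
    by (intro has_integral_mult_right circ_has_integral F_cont r)
  have "circ (Dr (Dr \<gamma>)) r = - circ F r / 4"
    using has_integral_unique[OF 1[unfolded 3] 4] 2 by simp
  then show ?thesis
    using circ_deriv[OF basic_cont(11,13) r smooth_has_real_derivative(2)[OF smooth_on_Dr[OF smooth(4)]]] by simp
qed

text \<open>Cauchy-Schwarz bounds the integral of \<open>P\<^sup>2\<close> below by the flux. The
  factor \<open>1/\<eta>\<^sup>2\<close> is controlled by the mean of \<sigma> and its variation,
  and the variation by \<open>2 * |\<sigma>z| \<le> a + \<sigma>z\<^sup>2 / a\<close>. The weight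
  \<open>a\<close> stays free because small and fixed values are wanted in turn.\<close>

lemma circ_K_lower_bound:
  assumes r: "0 < r" and a: "0 < a"
  shows "(circ P r)\<^sup>2 / L * exp (- 2 * circ \<sigma> r / L - L * a - circ F r / a) \<le> circ K r" "circ K r \<le> circ F r"
proof -
  let ?c = "circ P r" and ?O = "circ (\<lambda>q. \<bar>\<sigma>z q\<bar>) r"
  let ?e = "exp (- 2 * circ \<sigma> r / L - 2 * ?O)"
  have K0: "0 \<le> K q" for q by (simp add: K_def)
  show "circ K r \<le> circ F r"
    by (rule circ_mono[OF field_cont(5) F_cont r]) (simp add: F_def)
  have i1: "((\<lambda>z. (P (z, r))\<^sup>2) has_integral circ (\<lambda>q. (P q)\<^sup>2) r) {-L/2..L/2}"
    by (rule circ_has_integral[of "\<lambda>q. (P q)\<^sup>2", OF _ r]) (intro continuous_intros P_cont)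
  have i2: "((\<lambda>z. 2 * (?c/L) * P (z, r) - (?c/L)\<^sup>2) has_integral 2 * (?c/L) * ?c - L * (?c/L)\<^sup>2) {-L/2..L/2}"
    by (intro has_integral_diff has_integral_mult_right circ_has_integral P_cont r circ_const)
  \<comment> \<open>Cauchy-Schwarz pointwise: the square of \<open>P\<close> minus its mean is
    nonnegative.\<close>
  have i3: "2 * (?c/L) * P (z, r) - (?c/L)\<^sup>2 \<le> (P (z, r))\<^sup>2" for z
    using zero_le_power2[of "P (z, r) - ?c/L"] by (simp add: power2_diff algebra_simps)
  have "2 * (?c/L) * ?c - L * (?c/L)\<^sup>2 \<le> circ (\<lambda>q. (P q)\<^sup>2) r"
    by (rule has_integral_le[OF i2 i1 i3])
  then have CS: "?c\<^sup>2 / L \<le> circ (\<lambda>q. (P q)\<^sup>2) r"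
    using L_pos by (simp add: power2_eq_square field_simps)
  have "?e * (P (z, r))\<^sup>2 \<le> K (z, r)" if z: "z \<in> {-L/2..L/2}" for z
  proof -
    have "\<sigma> (z, r) \<le> circ \<sigma> r / L + ?O"
      by (rule circ_oscillation[OF \<sigma>_cont field_cont(1) r \<sigma>_derivs(1)[OF r] z])
    then have "?e \<le> exp (- 2 * \<sigma> (z, r))" by simp
    also have "\<dots> = 1 / (\<eta> (z, r))\<^sup>2"
      using eta_pos[OF r, of z] by (simp add: \<sigma>_def exp_minus exp_double inverse_eq_divide)
    finally have "?e * (P (z, r))\<^sup>2 \<le> 1 / (\<eta> (z, r))\<^sup>2 * (P (z, r))\<^sup>2"
      by (rule mult_right_mono) simp
    also have "\<dots> \<le> K (z, r)"
      by (simp add: K_def divide_right_mono)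
    finally show ?thesis .
  qed
  then have "?e * circ (\<lambda>q. (P q)\<^sup>2) r \<le> circ K r"
    by (rule has_integral_le[OF has_integral_mult_right[OF i1] circ_has_integral[OF field_cont(5) r]])
  moreover have "?e * (?c\<^sup>2 / L) \<le> ?e * circ (\<lambda>q. (P q)\<^sup>2) r"
    using CS by (intro mult_left_mono) auto
  moreover have "2 * ?O \<le> L * a + circ F r / a"
  proof -
    have 1: "((\<lambda>z. 2 * \<bar>\<sigma>z (z, r)\<bar>) has_integral 2 * ?O) {-L/2..L/2}"
      by (intro has_integral_mult_right circ_has_integral[of "\<lambda>q. \<bar>\<sigma>z q\<bar>"] continuous_intros field_cont r)
    have 2: "((\<lambda>z. a + (1/a) * F (z, r)) has_integral L * a + (1/a) * circ F r) {-L/2..L/2}"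
      by (intro has_integral_add has_integral_mult_right circ_has_integral F_cont r circ_const)
    have "2 * \<bar>\<sigma>z (z, r)\<bar> \<le> a + (1/a) * F (z, r)" for z
    proof -
      have "0 \<le> (\<bar>\<sigma>z (z, r)\<bar> - a)\<^sup>2" by simp
      then have "2 * \<bar>\<sigma>z (z, r)\<bar> * a \<le> a\<^sup>2 + (\<sigma>z (z, r))\<^sup>2"
        by (simp add: power2_diff algebra_simps)
      also have "\<dots> \<le> a\<^sup>2 + F (z, r)"
        using K0 by (simp add: F_def)
      finally show ?thesis
        using a by (simp add: field_simps power2_eq_square)
    qed
    then show ?thesis
      using has_integral_le[OF 1 2] by simp
  qed
  then have "exp (- 2 * circ \<sigma> r / L - L * a - circ F r / a) \<le> ?e"
    by simp
  then have "?c\<^sup>2 / L * exp (- 2 * circ \<sigma> r / L - L * a - circ F r / a) \<le> ?c\<^sup>2 / L * ?e"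
    using L_pos by (intro mult_left_mono) auto
  ultimately show "?c\<^sup>2 / L * exp (- 2 * circ \<sigma> r / L - L * a - circ F r / a) \<le> circ K r"
    by (simp add: mult.commute)
qed

lemma log_flux_gt:
  assumes flux: "\<And>r. 0 < r \<Longrightarrow> 0 \<le> circ (Dr \<gamma>) r" and J: "0 < r0" "circ P r0 \<noteq> 0" and r: "0 < r"
  shows "L < r * circ \<sigma>r r"
proof (rule ccontr)
  define c where "c = (circ P r0)\<^sup>2 / L"
  define \<alpha> where "\<alpha> r = r * circ \<sigma>r r" for r
  assume "\<not> ?thesis"
  then have \<alpha>r: "\<alpha> r \<le> L" by (simp add: \<alpha>_def)
  have c: "0 < c" using J L_pos by (simp add: c_def)
  have Pc: "(circ P x)\<^sup>2 / L = c" if "0 < x" for x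
    using twist_flux_const[OF that J(1)] by (simp add: c_def)
  have K0: "0 \<le> circ K x" if "0 < x" for x
    using circ_K_lower_bound(1)[OF that zero_less_one] Pc[OF that] c
    by (smt (verit) mult_pos_pos exp_gt_zero)
  have \<alpha>': "(\<alpha> has_real_derivative - x * circ K x) (at x)" if "0 < x" for x
    unfolding \<alpha>_def[abs_def] by (rule log_flux_deriv[OF that])
  have S': "(circ \<sigma> has_real_derivative \<alpha> x / x) (at x)" if "0 < x" for x
    using circ_deriv[OF \<sigma>_cont field_cont(2) that \<sigma>_derivs(2)] that by (simp add: \<alpha>_def)
  have \<alpha>_mono: "\<alpha> y \<le> \<alpha> x" if "0 < x" "x \<le> y" for x y
  proof (rule DERIV_nonpos_imp_nonincreasing[OF that(2)])
    fix t assume "x \<le> t" "t \<le> y"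
    then show "\<exists>d. DERIV \<alpha> t :> d \<and> d \<le> 0"
      using \<alpha>'[of t] K0[of t] that(1) by (intro exI[of _ "- t * circ K t"]) (simp add: mult_nonneg_nonneg)
  qed
  have S_bound: "circ \<sigma> y \<le> circ \<sigma> x + b * (ln y - ln x)" if "0 < x" "x \<le> y" "\<And>t. x \<le> t \<Longrightarrow> \<alpha> t \<le> b" for x y b
  proof -
    have "circ \<sigma> y - b * ln y \<le> circ \<sigma> x - b * ln x"
    proof (rule DERIV_nonpos_imp_nonincreasing[OF that(2)])
      fix t assume t: "x \<le> t" "t \<le> y"
      then have t0: "0 < t" using that(1) by linarith
      have "((\<lambda>t. circ \<sigma> t - b * ln t) has_real_derivative \<alpha> t / t - b * (1 / t)) (at t)"
        using t0 by (auto intro!: derivative_eq_intros S')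
      moreover have "\<alpha> t / t - b * (1 / t) \<le> 0"
        using that(3)[OF t(1)] t0 by (simp add: divide_right_mono)
      ultimately show "\<exists>d. DERIV (\<lambda>t. circ \<sigma> t - b * ln t) t :> d \<and> d \<le> 0" by blast
    qed
    then show ?thesis by (simp add: algebra_simps)
  qed
  \<comment> \<open>The constant in the integrated form of \<open>\<alpha> \<le> L\<close>, which
    keeps \<open>exp (- 2 * circ \<sigma> x / L)\<close> above a constant times
    \<open>1/x\<^sup>2\<close>.\<close>
  define C1 where "C1 = circ \<sigma> r - L * ln r"
  have C1: "circ \<sigma> x \<le> L * ln x + C1" if "r \<le> x" for x
  proof -
    have "\<alpha> t \<le> L" if "r \<le> t" for t
      using \<alpha>_mono[OF r that] \<alpha>r by linarith
    from S_bound[OF r that this] show ?thesis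
      by (simp add: C1_def algebra_simps)
  qed
  define k where "k = c * exp (- 2 * C1 / L)"
  have k: "0 < k" using c by (simp add: k_def)
  \<comment> \<open>The choice \<open>1/\<rho>\<close> in the lower bound for \<open>K\<close> makes the error terms integrable; as \<open>\<Phi>\<close> then does not
    increase, \<open>\<alpha>\<close> tends to \<open>-\<infinity>\<close>.\<close>
  define \<Phi> where "\<Phi> x = \<alpha> x + k * ln x + k * L / x + 4 * k * circ (Dr \<gamma>) x" for x
  have \<Phi>: "\<Phi> y \<le> \<Phi> r" if "r \<le> y" for y
  proof (rule DERIV_nonpos_imp_nonincreasing[OF that])
    fix x assume x: "r \<le> x" "x \<le> y"
    then have x0: "0 < x" using r by linarith
    let ?d = "- x * circ K x + k * (1 / x) - k * L / x\<^sup>2 + 4 * k * (- circ F x / 4)"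
    have "(\<Phi> has_real_derivative ?d) (at x)"
      unfolding \<Phi>_def[abs_def] using x0
      by (auto intro!: derivative_eq_intros \<alpha>' conformal_flux_deriv simp: power2_eq_square)
    moreover have "?d \<le> 0"
    proof -
      have "exp (- 2 * C1 / L) * (1 / x\<^sup>2) = exp (- 2 * (L * ln x + C1) / L)"
      proof -
        have "- 2 * (L * ln x + C1) / L = - 2 * C1 / L + - 2 * ln x"
          using L_pos by (simp add: field_simps)
        then have "exp (- 2 * (L * ln x + C1) / L) = exp (- 2 * C1 / L) * exp (- 2 * ln x)"
          by (simp only: exp_add)
        also have "exp (- 2 * ln x) = 1 / x\<^sup>2"
          using x0 by (simp add: exp_minus exp_double inverse_eq_divide)
        finally show ?thesis by simp
      qed
      also have "\<dots> \<le> exp (- 2 * circ \<sigma> x / L)"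
        unfolding exp_le_cancel_iff using C1[OF x(1)] L_pos by (intro divide_right_mono) auto
      finally have e1: "exp (- 2 * C1 / L) * (1 / x\<^sup>2) \<le> exp (- 2 * circ \<sigma> x / L)" .
      \<comment> \<open>\<open>1 + t \<le> exp t\<close> makes the error terms additive; after
        multiplication by \<open>k / x\<close> they are the derivatives of the last two terms of
        \<Phi>.\<close>
      have e2: "1 - L / x - x * circ F x \<le> exp (- L * (1/x) - circ F x / (1/x))"
      proof -
        have "- L * (1/x) - circ F x / (1/x) = - (L / x) - x * circ F x" by simp
        moreover have "1 - L / x - x * circ F x = 1 + (- (L / x) - x * circ F x)" by simp
        ultimately show ?thesis
          using exp_ge_add_one_self by metis
      qed
      have "k * (1 / x\<^sup>2) * (1 - L / x - x * circ F x) \<le> k * (1 / x\<^sup>2) * exp (- L * (1/x) - circ F x / (1/x))"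
        using e2 k by (intro mult_left_mono) auto
      also have "\<dots> = c * (exp (- 2 * C1 / L) * (1 / x\<^sup>2)) * exp (- L * (1/x) - circ F x / (1/x))"
        by (simp add: k_def)
      also have "\<dots> \<le> c * exp (- 2 * circ \<sigma> x / L) * exp (- L * (1/x) - circ F x / (1/x))"
        using e1 c by (intro mult_right_mono mult_left_mono) auto
      also have "\<dots> = c * exp (- 2 * circ \<sigma> x / L - L * (1/x) - circ F x / (1/x))"
        by (simp flip: exp_add)
      also have "\<dots> \<le> circ K x"
        using circ_K_lower_bound(1)[OF x0, of "1/x"] x0 Pc[OF x0] by simp
      finally have "x * (k * (1 / x\<^sup>2) * (1 - L / x - x * circ F x)) \<le> x * circ K x"
        using x0 by (intro mult_left_mono) auto
      moreover have "x * (k * (1 / x\<^sup>2) * (1 - L / x - x * circ F x)) = k * (1 / x) - k * L / x\<^sup>2 - k * circ F x"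
        using x0 by (simp add: field_simps power2_eq_square)
      ultimately show ?thesis by simp
    qed
    ultimately show "\<exists>d. DERIV \<Phi> x :> d \<and> d \<le> 0" by blast
  qed
  \<comment> \<open>Nonnegativity of the flux of \<gamma> allows the last two terms of \<Phi> to be
    dropped.\<close>
  have \<alpha>_log: "\<alpha> x \<le> \<Phi> r - k * ln x" if "r \<le> x" for x
  proof -
    have "0 < x" using that r by linarith
    then have "0 \<le> k * L / x" "0 \<le> 4 * k * circ (Dr \<gamma>) x"
      using k L_pos flux by auto
    then show ?thesis using \<Phi>[OF that] unfolding \<Phi>_def by linarith
  qed
  \<comment> \<open>Beyond this radius \<open>\<alpha> \<le> - L\<close>, so the mean of \<sigma>
    falls at least like - ln x and the lower bound for \<open>K\<close> grows instead of
    decaying.\<close>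
  define r2 where "r2 = max r (exp ((\<Phi> r + L) / k))"
  have r2: "r \<le> r2" "0 < r2" using r by (auto simp: r2_def)
  have \<alpha>_neg: "\<alpha> x \<le> - L" if "r2 \<le> x" for x
  proof -
    have "exp ((\<Phi> r + L) / k) \<le> x" using that by (simp add: r2_def)
    then have "(\<Phi> r + L) / k \<le> ln x"
      using ln_ge_iff[of x] that r2(2) by simp
    then have "\<Phi> r + L \<le> k * ln x"
      using k by (simp add: divide_le_eq mult.commute)
    then show ?thesis using \<alpha>_log[of x] that r2(1) by linarith
  qed
  define C2 where "C2 = circ \<sigma> r2 + L * ln r2"
  have C2: "circ \<sigma> x \<le> C2 - L * ln x" if "r2 \<le> x" for x
    using S_bound[OF r2(2) that \<alpha>_neg] by (simp add: C2_def algebra_simps)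
  define k2 where "k2 = c * exp (- 2 * C2 / L - L)"
  have k2: "0 < k2" using c by (simp add: k2_def)
  \<comment> \<open>Makes \<open>k2 * x\<^sup>2 \<ge> exp 1\<close> from here on: if
    \<open>circ F x\<close> were below 1, the lower bound for \<open>circ K x\<close> would already
    reach 1.\<close>
  define r3 where "r3 = max r2 (sqrt (exp 1 / k2))"
  have r3: "r2 \<le> r3" "0 < r3" using r2 by (auto simp: r3_def)
  have F1: "1 \<le> circ F x" if x: "r3 \<le> x" for x
  proof (rule ccontr)
    assume F: "\<not> 1 \<le> circ F x"
    have x0: "0 < x" using x r3 by linarith
    have "exp (- 2 * C2 / L) * x\<^sup>2 = exp (- 2 * (C2 - L * ln x) / L)"
    proof -
      have "- 2 * (C2 - L * ln x) / L = - 2 * C2 / L + 2 * ln x"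
        using L_pos by (simp add: field_simps)
      then have "exp (- 2 * (C2 - L * ln x) / L) = exp (- 2 * C2 / L) * exp (2 * ln x)"
        by (simp only: exp_add)
      also have "exp (2 * ln x) = x\<^sup>2"
        using x0 by (simp add: exp_double)
      finally show ?thesis by simp
    qed
    also have "\<dots> \<le> exp (- 2 * circ \<sigma> x / L)"
      unfolding exp_le_cancel_iff using C2[of x] x r3 L_pos by (intro divide_right_mono) auto
    finally have e1: "exp (- 2 * C2 / L) * x\<^sup>2 \<le> exp (- 2 * circ \<sigma> x / L)" .
    have "k2 * x\<^sup>2 * exp (- 1) = c * (exp (- 2 * C2 / L) * x\<^sup>2) * exp (- L - 1)"
      by (simp add: k2_def exp_diff exp_minus field_simps)
    also have "\<dots> \<le> c * exp (- 2 * circ \<sigma> x / L) * exp (- L - circ F x)"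
      using e1 c F by (intro mult_mono mult_left_mono) auto
    also have "\<dots> = c * exp (- 2 * circ \<sigma> x / L - L * 1 - circ F x / 1)"
      by (simp flip: exp_add)
    also have "\<dots> \<le> circ F x"
      using circ_K_lower_bound[OF x0 zero_less_one] Pc[OF x0] by simp
    finally have "k2 * x\<^sup>2 * exp (- 1) < 1" using F by simp
    moreover have "exp 1 / k2 \<le> x\<^sup>2"
    proof -
      have "sqrt (exp 1 / k2) \<le> x" using x by (simp add: r3_def)
      then have "(sqrt (exp 1 / k2))\<^sup>2 \<le> x\<^sup>2"
        using k2 by (intro power_mono) auto
      then show ?thesis using k2 by simp
    qed
    then have "exp 1 \<le> k2 * x\<^sup>2"
      using k2 by (simp add: divide_le_eq mult.commute)
    then have "exp 1 * exp (- 1) \<le> k2 * x\<^sup>2 * exp (- 1)"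
      by (intro mult_right_mono) auto
    then have "1 \<le> k2 * x\<^sup>2 * exp (- 1)"
      by (simp flip: exp_add)
    ultimately show False by simp
  qed
  \<comment> \<open>Beyond \<open>r3\<close> the flux of \<gamma> falls with slope at least 1/4 in
    absolute value, so at \<open>y\<close> it is at most -1.\<close>
  define y where "y = r3 + 4 * (circ (Dr \<gamma>) r3 + 1)"
  have y: "r3 \<le> y" using flux[OF r3(2)] by (simp add: y_def)
  have "circ (Dr \<gamma>) y + y / 4 \<le> circ (Dr \<gamma>) r3 + r3 / 4"
  proof (rule DERIV_nonpos_imp_nonincreasing[OF y])
    fix x assume x: "r3 \<le> x" "x \<le> y"
    have "((\<lambda>x. circ (Dr \<gamma>) x + x / 4) has_real_derivative - circ F x / 4 + 1 / 4) (at x)"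
      using x r3 by (auto intro!: derivative_eq_intros conformal_flux_deriv)
    moreover have "- circ F x / 4 + 1 / 4 \<le> 0" using F1[OF x(1)] by simp
    ultimately show "\<exists>d. DERIV (\<lambda>x. circ (Dr \<gamma>) x + x / 4) x :> d \<and> d \<le> 0" by blast
  qed
  then have "circ (Dr \<gamma>) y < 0" by (simp add: y_def field_simps)
  then show False using flux[of y] y r3 by linarith
qed

end

section \<open>The horizon\<close>

text \<open>The sum \<open>R\<close> of the distances to the two poles exceeds \<open>2 * m\<close>.
  At distance at least \<open>d\<close> from the poles inside the segment the excess is at most
  \<open>r\<^sup>2 / d\<close>, by a tangent estimate for the square roots.\<close>

lemma omega_S_bounds:
  assumes m: "0 < m" and r: "0 < r"
  shows "omega_S m (z, r) \<le> 0"
    and "\<lbrakk>0 < d; \<bar>z\<bar> \<le> m - d\<rbrakk> \<Longrightarrow> omega_S m (z, r) \<le> 2 * ln r - ln (4 * m * d)"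
proof -
  define R where "R = sqrt ((z - m)\<^sup>2 + r\<^sup>2) + sqrt ((z + m)\<^sup>2 + r\<^sup>2)"
  have om: "omega_S m (z, r) = ln ((R - 2 * m) / (R + 2 * m))"
    by (simp add: omega_S_def R_def Let_def)
  have gt: "\<bar>a\<bar> < sqrt (a\<^sup>2 + r\<^sup>2)" for a
    using r real_sqrt_less_mono[of "a\<^sup>2" "a\<^sup>2 + r\<^sup>2"] by simp
  have R: "2 * m < R"
    unfolding R_def using gt[of "z - m"] gt[of "z + m"] by linarith
  then show "omega_S m (z, r) \<le> 0"
    unfolding om using m by (intro ln_le_zero_iff[THEN iffD2]) (auto simp: divide_le_eq)
  assume d: "0 < d" "\<bar>z\<bar> \<le> m - d"
  \<comment> \<open>After squaring, the cross term \<open>2 * a * (r\<^sup>2 / (2 * d))\<close>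
    alone dominates \<open>r\<^sup>2\<close>, because \<open>d \<le> a\<close>.\<close>
  have up: "sqrt (a\<^sup>2 + r\<^sup>2) \<le> a + r\<^sup>2 / (2 * d)" if a: "d \<le> a" for a
  proof (rule real_le_lsqrt)
    show "0 \<le> a + r\<^sup>2 / (2 * d)" using a d by simp
    have "d * r\<^sup>2 \<le> a * r\<^sup>2" using a by (intro mult_right_mono) auto
    then have "r\<^sup>2 \<le> a * r\<^sup>2 / d" using d by (simp add: pos_le_divide_eq mult.commute)
    then have "r\<^sup>2 \<le> 2 * a * (r\<^sup>2 / (2 * d))" by simp
    then show "a\<^sup>2 + r\<^sup>2 \<le> (a + r\<^sup>2 / (2 * d))\<^sup>2"
      unfolding power2_sum[of a] using zero_le_power2[of "r\<^sup>2 / (2 * d)"] by linarith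
  qed
  have "sqrt ((z - m)\<^sup>2 + r\<^sup>2) \<le> (m - z) + r\<^sup>2 / (2 * d)"
    using up[of "m - z"] d by (simp add: power2_commute)
  moreover have "sqrt ((z + m)\<^sup>2 + r\<^sup>2) \<le> (m + z) + r\<^sup>2 / (2 * d)"
    using up[of "m + z"] d by (simp add: add.commute)
  ultimately have "R - 2 * m \<le> r\<^sup>2 / d"
    unfolding R_def by simp
  then have "(R - 2 * m) / (R + 2 * m) \<le> (r\<^sup>2 / d) / (4 * m)"
    using R m d by (intro frac_le) auto
  also have "\<dots> = r\<^sup>2 / (4 * m * d)" by simp
  finally have "ln ((R - 2 * m) / (R + 2 * m)) \<le> ln (r\<^sup>2 / (4 * m * d))"
    using R m d r by (subst ln_le_cancel_iff) auto
  also have "\<dots> = 2 * ln r - ln (4 * m * d)"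
    using r m d by (simp add: ln_div ln_realpow)
  finally show "omega_S m (z, r) \<le> 2 * ln r - ln (4 * m * d)"
    unfolding om .
qed

lemma omega_S_continuous:
  assumes "0 < m" "0 < r"
  shows "continuous_on S (\<lambda>z. omega_S m (z, r))"
proof -
  have "\<bar>a\<bar> < sqrt (a\<^sup>2 + r\<^sup>2)" for a
    using assms real_sqrt_less_mono[of "a\<^sup>2" "a\<^sup>2 + r\<^sup>2"] by simp
  then have "2 * m < sqrt ((z - m)\<^sup>2 + r\<^sup>2) + sqrt ((z + m)\<^sup>2 + r\<^sup>2)" for z
    by (smt (verit))
  then have "sqrt ((z - m)\<^sup>2 + r\<^sup>2) + sqrt ((z + m)\<^sup>2 + r\<^sup>2) - 2 * m \<noteq> 0"
    "sqrt ((z - m)\<^sup>2 + r\<^sup>2) + sqrt ((z + m)\<^sup>2 + r\<^sup>2) + 2 * m \<noteq> 0" for z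
    using assms by (smt (verit))+
  then show ?thesis
    unfolding omega_S_def Let_def fst_conv snd_conv
    by (intro continuous_intros) auto
qed

context periodic_vacuum
begin

text \<open>On \<open>|z| \<le> m'\<close> the function \<open>- omega_S\<close> supplies
  \<open>- 2 * ln r\<close>, elsewhere it is just nonnegative; integration over the length
  \<open>2 * m'\<close> gives \<open>- 4 * m' * ln r\<close>. Taking \<open>m' < m\<close> avoids
  the poles, where the constant \<open>c\<close> degenerates.\<close>

lemma circ_log_lower_bound:
  assumes m: "0 < m" "2 * m < L" and m': "0 < m'" "m' < m" and bdry: "eta_boundary_behaviour L m \<eta>"
  obtains B \<delta> where "0 < \<delta>" "\<And>r. 0 < r \<Longrightarrow> r \<le> \<delta> \<Longrightarrow> 2 * L * ln r - 4 * m' * ln r - B \<le> circ \<sigma> r"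
proof -
  obtain \<delta> u where \<delta>: "0 < \<delta>" and u: "continuous_on ({-L/2..L/2} \<times> {0..\<delta>}) u"
    "\<And>z \<rho>. z \<in> {-L/2..L/2} \<Longrightarrow> \<rho> \<in> {0<..\<delta>} \<Longrightarrow> u (z, \<rho>) = ln (\<eta> (z, \<rho>)) - 2 * ln \<rho> + omega_S m (z, \<rho>)"
    using bdry unfolding eta_boundary_behaviour_def by blast
  have "compact (u ` ({-L/2..L/2} \<times> {0..\<delta>}))"
    by (intro compact_continuous_image u compact_Times compact_Icc)
  then obtain B where B: "\<And>q. q \<in> {-L/2..L/2} \<times> {0..\<delta>} \<Longrightarrow> \<bar>u q\<bar> \<le> B"
    by (force dest!: compact_imp_bounded simp: bounded_iff)
  define c where "c = ln (4 * m * (m - m'))"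
  show thesis
  proof (rule that[of \<delta> "L * B - 2 * m' * c"])
    fix r assume r: "0 < r" "r \<le> \<delta>"
    let ?w = "\<lambda>z. - omega_S m (z, r)"
    have wc: "continuous_on S ?w" for S
      by (intro continuous_intros omega_S_continuous m r)
    have "2 * m' * (c - 2 * ln r) = integral {-m'..m'} (\<lambda>z. c - 2 * ln r)"
      using m' by simp
    also have "\<dots> \<le> integral {-m'..m'} ?w"
    proof (rule Henstock_Kurzweil_Integration.integral_le)
      show "c - 2 * ln r \<le> ?w z" if "z \<in> {-m'..m'}" for z
        using omega_S_bounds(2)[OF m(1) r(1), of "m - m'" z] that m' by (auto simp: c_def abs_le_iff)
    qed (auto intro!: integrable_continuous_real wc)
    also have "\<dots> \<le> integral {-L/2..L/2} ?w"
      using m m' omega_S_bounds(1)[OF m(1) r(1)]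
      by (intro integral_subset_le integrable_continuous_real wc) auto
    finally have w: "2 * m' * (c - 2 * ln r) \<le> integral {-L/2..L/2} ?w" .
    have "((\<lambda>z. (2 * ln r - B) + ?w z) has_integral L * (2 * ln r - B) + integral {-L/2..L/2} ?w) {-L/2..L/2}"
      by (intro has_integral_add circ_const integrable_integral integrable_continuous_real wc)
    moreover have "(2 * ln r - B) + ?w z \<le> \<sigma> (z, r)" if z: "z \<in> {-L/2..L/2}" for z
      using u(2)[OF z, of r] B[of "(z, r)"] z r by (simp add: \<sigma>_def abs_le_iff)
    ultimately have "L * (2 * ln r - B) + integral {-L/2..L/2} ?w \<le> circ \<sigma> r"
      using has_integral_le[OF _ circ_has_integral[OF \<sigma>_cont r(1)]] by blast
    then show "2 * L * ln r - 4 * m' * ln r - (L * B - 2 * m' * c) \<le> circ \<sigma> r"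
      using w by (simp add: algebra_simps)
  qed (rule \<delta>)
qed

lemma four_mass_le_period:
  assumes flux: "\<And>r. 0 < r \<Longrightarrow> 0 \<le> circ (Dr \<gamma>) r" and J: "0 < r0" "circ P r0 \<noteq> 0"
    and m: "0 < m" "2 * m < L" and bdry: "eta_boundary_behaviour L m \<eta>"
  shows "4 * m \<le> L"
proof (rule ccontr)
  assume "\<not> 4 * m \<le> L"
  then have "L / 4 < m" by simp
  \<comment> \<open>Room on both sides: \<open>4 * m' - L\<close> stays positive, and the interval
    stays away from the poles.\<close>
  then obtain m' where m': "L / 4 < m'" "m' < m" using dense by blast
  have m'0: "0 < m'" using m' L_pos by linarith
  obtain B \<delta> where \<delta>: "0 < \<delta>" and lower: "\<And>r. 0 < r \<Longrightarrow> r \<le> \<delta> \<Longrightarrow> 2 * L * ln r - 4 * m' * ln r - B \<le> circ \<sigma> r"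
    using circ_log_lower_bound[OF m m'0 m'(2) bdry] by metis
  have upper: "circ \<sigma> r \<le> circ \<sigma> 1 + L * ln r" if r: "0 < r" "r \<le> 1" for r
  proof -
    have "circ \<sigma> r - L * ln r \<le> circ \<sigma> 1 - L * ln 1"
    proof (rule DERIV_nonneg_imp_nondecreasing[OF r(2)])
      fix t assume t: "r \<le> t" "t \<le> 1"
      then have t0: "0 < t" using r by linarith
      have "((\<lambda>t. circ \<sigma> t - L * ln t) has_real_derivative circ \<sigma>r t - L * (1 / t)) (at t)"
        using t0 by (auto intro!: derivative_eq_intros circ_deriv[OF \<sigma>_cont field_cont(2) _ \<sigma>_derivs(2)])
      moreover have "0 \<le> circ \<sigma>r t - L * (1 / t)"
        using log_flux_gt[OF flux J t0] t0 by (simp add: divide_le_eq mult.commute)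
      ultimately show "\<exists>d. DERIV (\<lambda>t. circ \<sigma> t - L * ln t) t :> d \<and> 0 \<le> d" by blast
    qed
    then show ?thesis by simp
  qed
  \<comment> \<open>With \<open>ln r = - N\<close>, the last summand brings \<open>r\<close> below
    \<delta>, and the first makes \<open>(4 * m' - L) * N\<close> exceed the sum of the constants in
    both bounds.\<close>
  define N where "N = (\<bar>circ \<sigma> 1\<bar> + \<bar>B\<bar> + 1) / (4 * m' - L) + \<bar>ln \<delta>\<bar>"
  have pos: "0 < 4 * m' - L" using m' by linarith
  then have N0: "0 \<le> N" by (simp add: N_def)
  define r where "r = exp (- N)"
  have r: "0 < r" "r \<le> 1" using N0 by (auto simp: r_def)
  have "ln r \<le> ln \<delta>"
    using pos by (simp add: r_def N_def) (smt (verit) divide_nonneg_pos abs_ge_zero)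
  then have r\<delta>: "r \<le> \<delta>" using r \<delta> by simp
  have "2 * L * ln r - 4 * m' * ln r - B \<le> circ \<sigma> 1 + L * ln r"
    using lower[OF r(1) r\<delta>] upper[OF r] by linarith
  then have "(4 * m' - L) * N \<le> circ \<sigma> 1 + B"
    by (simp add: r_def algebra_simps)
  moreover have "(4 * m' - L) * N \<ge> \<bar>circ \<sigma> 1\<bar> + \<bar>B\<bar> + 1"
  proof -
    have "(4 * m' - L) * ((\<bar>circ \<sigma> 1\<bar> + \<bar>B\<bar> + 1) / (4 * m' - L)) \<le> (4 * m' - L) * N"
      unfolding N_def using pos by (intro mult_left_mono) auto
    then show ?thesis using pos by simp
  qed
  ultimately show False by linarith
qed

end

theorem theorem1:
  fixes L m t0 \<rho>0 :: real and V W \<eta> \<gamma> :: "real \<times> real \<Rightarrow> real"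
  assumes "m > 0" and "L > 2 * m"
    and "periodic_black_hole L m V W \<eta> \<gamma>"
    and "\<rho>0 > 0"
    and "komar_angular_momentum L (spacetime_metric V W \<eta> \<gamma>) t0 \<rho>0 \<noteq> 0"
    and "q_complete_at_infinity L \<gamma>"
  shows "L / m \<ge> 4"
proof -
  interpret bh: periodic_black_hole L m V W \<eta> \<gamma>
    by (rule assms(3))
  interpret periodic_vacuum V W \<eta> \<gamma> L
    by unfold_locales
       (use assms(1,2) bh.smooth bh.periodic bh.eta_pos bh.gram bh.vacuum in auto)
  have "0 \<le> circ (Dr \<gamma>) r" if r: "0 < r" for r
    unfolding circ_def
  proof (rule complete_imp_flux_nonneg[OF L_pos smooth(4) periodic(3) _ assms(6) r])
    fix z r :: real assume "0 < r"
    then show "Dz (Dz \<gamma>) (z, r) + Dr (Dr \<gamma>) (z, r) \<le> 0"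
      unfolding conformal_equation[OF \<open>0 < r\<close>]
      by (intro divide_nonpos_nonneg iffD2[OF neg_le_0_iff_le] add_nonneg_nonneg) auto
  qed
  \<comment> \<open>Up to the factor 1/8 this flux is the angular momentum.\<close>
  moreover have "circ P \<rho>0 \<noteq> 0"
    using assms(5) komar_eq[OF assms(4), of L t0] by (simp add: circ_def)
  ultimately have "4 * m \<le> L"
    using four_mass_le_period assms(1,2,4) bh.eta_boundary by blast
  then show ?thesis
    using assms(1) by (simp add: pos_le_divide_eq)
qed

end
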